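(* Consider any voting protocol in which each candidate receives a numerical score based on the votes, and the candidate with the highest score wins. Suppose that the score function is monotone, that is: whenever a voter $i$ changes its vote from $>_i^{\mathrm{old}}$ to $>_i^{\mathrm{new}}$ (the other votes being unchanged) in such a way that, for a candidate $a$, $\{b : a >_i^{\mathrm{old}} b\} \subseteq \{b : a >_i^{\mathrm{new}} b\}$, the score of $a$ does not decrease. Finally, assume that the winner can be determined in polynomial time. Then, for this protocol, the decision problem DCWM (destructive coalitional weighted manipulation) is in $\mathcal{P}$.
   Context: An election consists of $m$ candidates, $n$ voters each casting a vote (a total order on the candidates; $a >_i b$ means voter $i$ ranks $a$ above $b$), and a winner determination function given by the voting protocol. Neither $m$ nor $n$ is bounded. Voters have nonnegative integer weights, encoded in binary; a vote of weight $k$ is interpreted as $k$ identical unweighted votes. DCWM (for a given protocol): given a set $S$ of weighted votes, the weights for a set $T$ of votes that are still open, and a candidate $h$, decide whether the votes in $T$ can be cast so that $h$ does not win the election determined by the votes in $S\cup T$. Ties for the highest score are broken adversarially to the manipulators: $h$ counts as not winning only if some other candidate has a strictly higher score than $h$. *)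

theory Defs
  imports Complex_Main "HOL-Computational_Algebra.Polynomial"
begin

section \<open>Polynomial-time Turing machines\<close>

text \<open>
  Deterministic machines with any fixed number of two-way infinite tapes. Languages are over a
  finite type \<open>'a\<close>; a machine may use finitely many work symbols \<open>Aux n\<close> besides the blank and
  the input symbols.
\<close>

datatype 'a cell = Blank | Input 'a | Aux nat

datatype dir = Left | Right | Stay

text \<open>
  In a tape \<open>(l, r)\<close> the head stands on the first cell of \<open>r\<close>, and \<open>l\<close> lists the cells to its
  left, nearest first. All cells beyond the two lists are blank.
\<close>

type_synonym 'a tape = "'a cell list \<times> 'a cell list"

fun read :: "'a tape \<Rightarrow> 'a cell" where
  "read (l, []) = Blank"
| "read (l, x # r) = x"

fun put :: "'a cell \<Rightarrow> 'a tape \<Rightarrow> 'a tape" where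
  "put y (l, r) = (l, y # tl r)"

fun move :: "dir \<Rightarrow> 'a tape \<Rightarrow> 'a tape" where
  "move Left ([], r) = ([], Blank # r)"
| "move Left (x # l, r) = (l, x # r)"
| "move Right (l, []) = (Blank # l, [])"
| "move Right (l, x # r) = (x # l, r)"
| "move Stay t = t"

record 'a tm =
  tapes :: nat
  states :: "nat set"
  symbols :: "'a cell set"
  start :: nat
  accept :: nat
  reject :: nat
  delta :: "nat \<Rightarrow> 'a cell list \<Rightarrow> nat \<times> ('a cell \<times> dir) list"

definition wf_tm :: "('a::finite) tm \<Rightarrow> bool" where
  "wf_tm M \<longleftrightarrow>
     tapes M > 0 \<and>
     finite (states M) \<and> {start M, accept M, reject M} \<subseteq> states M \<and> accept M \<noteq> reject M \<and>
     finite (symbols M) \<and> insert Blank (range Input) \<subseteq> symbols M \<and>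
     (\<forall>q \<in> states M - {accept M, reject M}. \<forall>xs \<in> lists (symbols M). length xs = tapes M \<longrightarrow>
        fst (delta M q xs) \<in> states M \<and>
        length (snd (delta M q xs)) = tapes M \<and>
        fst ` set (snd (delta M q xs)) \<subseteq> symbols M)"

type_synonym 'a config = "nat \<times> 'a tape list"

definition init :: "'a tm \<Rightarrow> 'a list \<Rightarrow> 'a config" where
  "init M w = (start M, ([], map Input w) # replicate (tapes M - 1) ([], []))"

definition step :: "'a tm \<Rightarrow> 'a config \<Rightarrow> 'a config" where
  "step M c =
     (case c of (q, ts) \<Rightarrow>
        if q = accept M \<or> q = reject M then c
        else (case delta M q (map read ts) of (q', acts) \<Rightarrow>
          (q', map2 (\<lambda>(y, d) t. move d (put y t)) acts ts)))"

text \<open>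
  Halting configurations are fixed points of \<open>step\<close>, so being in state \<open>accept\<close> or \<open>reject\<close> after
  exactly \<open>t\<close> iterations means having halted within \<open>t\<close> steps.
\<close>

definition decides_in :: "('a::finite) tm \<Rightarrow> 'a list set \<Rightarrow> (nat \<Rightarrow> nat) \<Rightarrow> bool" where
  "decides_in M L t \<longleftrightarrow>
     (\<forall>w. fst ((step M ^^ t (length w)) (init M w)) = (if w \<in> L then accept M else reject M))"

definition class_P :: "('a::finite) list set set" where
  "class_P = {L. \<exists>(M :: 'a tm) (p :: nat poly). wf_tm M \<and> decides_in M L (poly p)}"


section \<open>Elections\<close>

text \<open>
  The candidates of an election with \<open>m\<close> candidates are the numbers below \<open>m\<close>. A vote (total order)
  is given by the list of all candidates, most preferred first. A profile is the list of the votes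
  of voters \<open>0, 1, \<dots>\<close>, so that anonymity of the protocol is not presupposed.
\<close>

type_synonym vote = "nat list"

definition is_vote :: "nat \<Rightarrow> vote \<Rightarrow> bool" where
  "is_vote m v \<longleftrightarrow> distinct v \<and> set v = {..<m}"

definition prefers :: "vote \<Rightarrow> nat \<Rightarrow> nat \<Rightarrow> bool" where
  "prefers v a b \<longleftrightarrow> (\<exists>i j. i < j \<and> j < length v \<and> v ! i = a \<and> v ! j = b)"

definition unweighted :: "(vote \<times> nat) list \<Rightarrow> vote list" where
  "unweighted W = concat (map (\<lambda>(v, k). replicate k v) W)"

text \<open>
  A scoring rule \<open>score m P a\<close> assigns to every number \<open>m\<close> of candidates, profile \<open>P\<close> and candidate
  \<open>a\<close> the score of \<open>a\<close>.
\<close>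

type_synonym scoring = "nat \<Rightarrow> vote list \<Rightarrow> nat \<Rightarrow> real"

definition monotone_score :: "scoring \<Rightarrow> bool" where
  "monotone_score score \<longleftrightarrow>
     (\<forall>m P i new a.
        (\<forall>v \<in> set P. is_vote m v) \<and> i < length P \<and> is_vote m new \<and> a < m \<and>
        {b. prefers (P ! i) a b} \<subseteq> {b. prefers new a b} \<longrightarrow>
        score m P a \<le> score m (P[i := new]) a)"

text \<open>Ties are broken in favour of the candidate in question.\<close>

definition wins :: "scoring \<Rightarrow> nat \<Rightarrow> vote list \<Rightarrow> nat \<Rightarrow> bool" where
  "wins score m P c \<longleftrightarrow> \<not> (\<exists>a < m. a \<noteq> c \<and> score m P a > score m P c)"


section \<open>The decision problems\<close>

text \<open>
  Weights are written in binary, least significant bit first and without superfluous zeros.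
  Candidates are written in unary; since an instance comprises the list of its candidates, this
  changes its length only polynomially.
\<close>

datatype symbol = Zero | One | Tally | Comma | Colon | Semicolon | Bar

instance symbol :: finite
proof
  have "(UNIV :: symbol set) = {Zero, One, Tally, Comma, Colon, Semicolon, Bar}"
    using symbol.exhaust by blast
  then show "finite (UNIV :: symbol set)"
    by (metis finite.emptyI finite.insertI)
qed

fun enc_weight :: "nat \<Rightarrow> symbol list" where
  "enc_weight k = (if k = 0 then [] else (if odd k then One else Zero) # enc_weight (k div 2))"

declare enc_weight.simps [simp del]

definition enc_cand :: "nat \<Rightarrow> symbol list" where
  "enc_cand c = replicate c Tally"

definition enc_vote :: "vote \<Rightarrow> symbol list" where
  "enc_vote v = concat (map (\<lambda>c. enc_cand c @ [Comma]) v)"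

definition enc_votes :: "(vote \<times> nat) list \<Rightarrow> symbol list" where
  "enc_votes W = concat (map (\<lambda>(v, k). enc_vote v @ [Colon] @ enc_weight k @ [Semicolon]) W)"

definition enc_weights :: "nat list \<Rightarrow> symbol list" where
  "enc_weights T = concat (map (\<lambda>k. enc_weight k @ [Semicolon]) T)"

definition enc_election :: "nat \<Rightarrow> nat \<Rightarrow> (vote \<times> nat) list \<Rightarrow> symbol list" where
  "enc_election m c W = replicate m Tally @ [Bar] @ enc_cand c @ [Bar] @ enc_votes W"

definition enc_dcwm :: "nat \<Rightarrow> nat \<Rightarrow> (vote \<times> nat) list \<Rightarrow> nat list \<Rightarrow> symbol list" where
  "enc_dcwm m h S T = enc_election m h S @ [Bar] @ enc_weights T"

text \<open>Winner determination: does candidate \<open>c\<close> win the weighted election \<open>W\<close>?\<close>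

definition WINNER :: "scoring \<Rightarrow> symbol list set" where
  "WINNER score =
     {enc_election m c W | m c W.
        c < m \<and> (\<forall>(v, k) \<in> set W. is_vote m v) \<and> wins score m (unweighted W) c}"

definition DCWM :: "scoring \<Rightarrow> symbol list set" where
  "DCWM score =
     {enc_dcwm m h S T | m h S T.
        h < m \<and> (\<forall>(v, k) \<in> set S. is_vote m v) \<and>
        (\<exists>V. length V = length T \<and> (\<forall>v \<in> set V. is_vote m v) \<and>
             \<not> wins score m (unweighted (S @ zip V T)) h)}"

end

theory Submission
  imports Defs
begin

text \<open>
  For a candidate \<open>a \<noteq> h\<close> let all open votes rank \<open>a\<close> first and \<open>h\<close> last. By monotonicity no other way
  of casting them gives \<open>a\<close> a higher or \<open>h\<close> a lower score. So \<open>h\<close> can be prevented from winning iff,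
  for some \<open>a\<close>, it loses in this election. Taking the \<open>a\<close> whose own score is largest, \<open>a\<close> itself is
  then a winner. Hence it suffices to ask, for each of the \<open>m - 1\<close> candidates \<open>a\<close>, whether \<open>a\<close> wins and
  \<open>h\<close> does not. As winner determination rejects malformed elections, the positive answer for \<open>a\<close>
  also certifies that the given votes and weights are encoded properly.

  The oracle calls are carried out by a while-program on finitely many stacks, each of which lives
  on one tape of the resulting machine.
\<close>

text \<open>No score is ever computed: the only effective access to the protocol is winner
  determination, so the best rival cannot be singled out and all rivals are tried. The complement of
  \<open>WINNER score\<close> contains every malformed word, hence a negative answer for
  \<open>h\<close> means nothing by itself; it is used only together with a positive answer for a
  word that differs from it in the named candidate alone. Since all open votes are equal, a query
  arises from the given word by inserting the same block in front of each open weight. Weights are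
  thus copied without being decoded, and the exponentially long unweighted profile occurs only in
  the correctness argument. Stack programs serve because \<open>class_P\<close> speaks of concrete
  machines: programs are composed and timed by structural rules, translated into a machine once, and
  can contain the given machine as a subprogram.\<close>

fun peek :: "'c list \<Rightarrow> 'c option" where
  "peek [] = None"
| "peek (x # xs) = Some x"

type_synonym 'a tops = "nat \<Rightarrow> 'a cell option"
type_synonym 'a stacks = "nat \<Rightarrow> 'a cell list"

definition tops_of :: "'a stacks \<Rightarrow> 'a tops" where
  tops_of_apply [simp]: "tops_of \<sigma> i = peek (\<sigma> i)"

datatype 'a cmd =
    Act "'a tops \<Rightarrow> nat \<Rightarrow> 'a cell list"
  | Seq "'a cmd" "'a cmd"
  | Cond "'a tops \<Rightarrow> bool" "'a cmd" "'a cmd"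
  | Loop "'a tops \<Rightarrow> bool" "'a cmd"

text \<open>Since \<open>tl [] = []\<close>, an empty stack needs no special case: \<open>g\<close>
  sees \<open>None\<close> there, and whatever it returns is pushed.\<close>

definition act :: "('a tops \<Rightarrow> nat \<Rightarrow> 'a cell list) \<Rightarrow> 'a stacks \<Rightarrow> 'a stacks" where
  "act g \<sigma> = (\<lambda>i. g (tops_of \<sigma>) i @ tl (\<sigma> i))"

text \<open>The times are exact step counts of the compiled machine: an action takes two steps, and
  each test or unfolding of a control construct takes one. The limit of two symbols is what an
  action can write in two steps.\<close>

inductive exec :: "'a cmd \<Rightarrow> 'a stacks \<Rightarrow> nat \<Rightarrow> 'a stacks \<Rightarrow> bool" where
  Act: "(\<And>i. length (g (tops_of \<sigma>) i) \<le> 2) \<Longrightarrow> exec (Act g) \<sigma> 2 (act g \<sigma>)"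
| Seq: "exec c \<sigma> t \<sigma>' \<Longrightarrow> exec d \<sigma>' t' \<sigma>'' \<Longrightarrow> exec (Seq c d) \<sigma> (Suc (t + t')) \<sigma>''"
| CondT: "b (tops_of \<sigma>) \<Longrightarrow> exec c \<sigma> t \<sigma>' \<Longrightarrow> exec (Cond b c d) \<sigma> (Suc t) \<sigma>'"
| CondF: "\<not> b (tops_of \<sigma>) \<Longrightarrow> exec d \<sigma> t \<sigma>' \<Longrightarrow> exec (Cond b c d) \<sigma> (Suc t) \<sigma>'"
| LoopT: "b (tops_of \<sigma>) \<Longrightarrow> exec c \<sigma> t \<sigma>' \<Longrightarrow> exec (Loop b c) \<sigma>' t' \<sigma>'' \<Longrightarrow>
    exec (Loop b c) \<sigma> (Suc (t + t')) \<sigma>''"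
| LoopF: "\<not> b (tops_of \<sigma>) \<Longrightarrow> exec (Loop b c) \<sigma> 1 \<sigma>"

text \<open>An action is an arbitrary function of the tops. Only its values on tops over
  \<open>\<Gamma>\<close> with stacks below \<open>N\<close> matter; \<open>wf_cmd\<close> asks that
  it stay within these bounds, so finitely many tapes and symbols suffice.\<close>

definition wf_tops :: "nat \<Rightarrow> 'a cell set \<Rightarrow> 'a tops \<Rightarrow> bool" where
  "wf_tops N \<Gamma> tp \<longleftrightarrow> (\<forall>i z. tp i = Some z \<longrightarrow> z \<in> \<Gamma>) \<and> (\<forall>i \<ge> N. tp i = None)"

primrec wf_cmd :: "nat \<Rightarrow> 'a cell set \<Rightarrow> 'a cmd \<Rightarrow> bool" where
  "wf_cmd N \<Gamma> (Act g) \<longleftrightarrow>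
     (\<forall>tp. wf_tops N \<Gamma> tp \<longrightarrow> (\<forall>i. set (g tp i) \<subseteq> \<Gamma>) \<and> (\<forall>i \<ge> N. g tp i = []))"
| "wf_cmd N \<Gamma> (Seq c d) \<longleftrightarrow> wf_cmd N \<Gamma> c \<and> wf_cmd N \<Gamma> d"
| "wf_cmd N \<Gamma> (Cond b c d) \<longleftrightarrow> wf_cmd N \<Gamma> c \<and> wf_cmd N \<Gamma> d"
| "wf_cmd N \<Gamma> (Loop b c) \<longleftrightarrow> wf_cmd N \<Gamma> c"


section \<open>Compilation to Turing machines\<close>

text \<open>Stack symbols are shifted away from \<open>Blank\<close>, which marks the bottom of a stack.\<close>

fun up :: "'a cell \<Rightarrow> 'a cell" where
  "up Blank = Aux 0"
| "up (Input a) = Input a"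
| "up (Aux n) = Aux (Suc n)"

fun down :: "'a cell \<Rightarrow> 'a cell option" where
  "down Blank = None"
| "down (Input a) = Some (Input a)"
| "down (Aux 0) = Some Blank"
| "down (Aux (Suc n)) = Some (Aux n)"

lemma down_up [simp]: "down (up x) = Some x"
  by (cases x) auto

lemma up_neq_Blank [simp]: "up x \<noteq> Blank" "Blank \<noteq> up x"
  by (cases x; simp)+

text \<open>The head stands on the top of the stack. Popping moves it to the right and leaves a
  blank behind, which accounts for \<open>i\<close>; rewriting the blank below the bottom makes it
  explicit, which accounts for \<open>j\<close>.\<close>

definition holds :: "'a tape \<Rightarrow> 'a cell list \<Rightarrow> bool" where
  "holds t xs \<longleftrightarrow> (\<exists>i j. t = (replicate i Blank, map up xs @ replicate j Blank))"

lemma holds_read: "holds t xs \<Longrightarrow> down (read t) = peek xs"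
proof -
  assume "holds t xs"
  then obtain i j where t: "t = (replicate i Blank, map up xs @ replicate j Blank)"
    by (auto simp: holds_def)
  show ?thesis unfolding t by (cases xs; cases j) auto
qed

text \<open>Writing back the symbol just read is not the identity on pairs of lists: past the end of
  the list it adds an explicit \<open>Blank\<close>, which is absorbed by \<open>j\<close>.\<close>

lemma holds_rewrite: "holds t xs \<Longrightarrow> holds (move Stay (put (read t) t)) xs"
proof -
  assume "holds t xs"
  then obtain i j where t: "t = (replicate i Blank, map up xs @ replicate j Blank)"
    by (auto simp: holds_def)
  show ?thesis
  proof (cases xs)
    case Nil
    have "move Stay (put (read t) t) = (replicate i Blank, map up xs @ replicate (Suc (j - 1)) Blank)"
      unfolding t Nil by (cases j) auto
    then show ?thesis unfolding holds_def by blast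
  next
    case (Cons a list)
    then have "move Stay (put (read t) t) = t" by (simp add: t)
    then show ?thesis using \<open>holds t xs\<close> by simp
  qed
qed

text \<open>
  Replacing the top of a stack by at most two symbols takes two steps of the machine: the lower
  one is written first, and the upper one remains pending in the control state.
\<close>

fun write_lower :: "'a cell \<Rightarrow> 'a cell list \<Rightarrow> 'a cell \<times> dir" where
  "write_lower x [] = (Blank, if x = Blank then Stay else Right)"
| "write_lower x [y] = (up y, Stay)"
| "write_lower x (z # y # ys) = (up y, Left)"

fun pending :: "'a cell list \<Rightarrow> 'a cell option" where
  "pending [] = None"
| "pending [y] = None"
| "pending (z # y # ys) = Some (up z)"

definition write_upper :: "'a cell option \<Rightarrow> 'a cell \<Rightarrow> 'a cell \<times> dir" where
  "write_upper p x = (case p of None \<Rightarrow> x | Some z \<Rightarrow> z, Stay)"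

definition apply_act :: "'a cell \<times> dir \<Rightarrow> 'a tape \<Rightarrow> 'a tape" where
  "apply_act a t = move (snd a) (put (fst a) t)"

lemma holds_write:
  assumes "holds t xs" and len: "length ys \<le> 2"
  defines "t1 \<equiv> apply_act (write_lower (read t) ys) t"
  shows "holds (apply_act (write_upper (pending ys) (read t1)) t1) (ys @ tl xs)"
proof -
  obtain i j where t: "t = (replicate i Blank, map up xs @ replicate j Blank)"
    using assms(1) by (auto simp: holds_def)
  consider "ys = []" | y where "ys = [y]" | z y where "ys = [z, y]"
    using len by (cases ys rule: pending.cases) auto
  then show ?thesis
  proof cases
    case 1
    have "holds t1 (tl xs)"
    proof (cases xs)
      case Nil
      then show ?thesis
        using holds_rewrite[OF assms(1)] 1 unfolding t1_def apply_act_def t by (cases j) auto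
    next
      case (Cons a list)
      then have "t1 = (replicate (Suc i) Blank, map up list @ replicate j Blank)"
        by (simp add: t1_def 1 apply_act_def t)
      then show ?thesis unfolding holds_def Cons list.sel by blast
    qed
    from holds_rewrite[OF this] show ?thesis
      by (simp add: 1 apply_act_def write_upper_def)
  next
    case 2
    have "t1 = (replicate i Blank, map up (y # tl xs) @ replicate (if xs = [] then j - 1 else j) Blank)"
      unfolding t1_def apply_act_def t 2 by (cases xs; cases j) auto
    then have "holds t1 (y # tl xs)" unfolding holds_def by blast
    from holds_rewrite[OF this] show ?thesis
      by (simp add: 2 apply_act_def write_upper_def)
  next
    case 3
    \<comment> \<open>Truncated subtraction is intended: for \<open>i = 0\<close> the move to the
      left supplies a fresh blank cell itself.\<close>
    have "t1 = (replicate (i - 1) Blank,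
        Blank # map up (y # tl xs) @ replicate (if xs = [] then j - 1 else j) Blank)"
      unfolding t1_def apply_act_def t 3 by (cases xs; cases j; cases i) auto
    then have "apply_act (write_upper (pending ys) (read t1)) t1 = (replicate (i - 1) Blank,
        map up (z # y # tl xs) @ replicate (if xs = [] then j - 1 else j) Blank)"
      by (simp add: 3 apply_act_def write_upper_def)
    then show ?thesis unfolding holds_def 3 by auto
  qed
qed

section \<open>Control states: continuations and pending writes\<close>

definition decode_tops :: "'a cell list \<Rightarrow> 'a tops" where
  "decode_tops xs = (\<lambda>i. if i < length xs then down (xs ! i) else None)"

text \<open>A control state consists of the commands still to be executed and the upper symbols
  still to be written. An empty second component means that no write is under way; with at least one
  tape this cannot be confused with a pending list.\<close>

type_synonym 'a ctrl = "'a cmd list \<times> 'a cell option list"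

definition rewrite_all :: "'a cell list \<Rightarrow> ('a cell \<times> dir) list" where
  "rewrite_all xs = map (\<lambda>x. (x, Stay)) xs"

fun ctrl_delta :: "'a ctrl \<Rightarrow> 'a cell list \<Rightarrow> 'a ctrl \<times> ('a cell \<times> dir) list" where
  "ctrl_delta (K, p # ps) xs = ((K, []), map2 write_upper (p # ps) xs)"
| "ctrl_delta ([], []) xs = (([], []), rewrite_all xs)"
| "ctrl_delta (Act g # K, []) xs =
     (let ys = map (g (decode_tops xs)) [0..<length xs]
      in ((K, map pending ys), map2 write_lower xs ys))"
| "ctrl_delta (Seq c d # K, []) xs = ((c # d # K, []), rewrite_all xs)"
| "ctrl_delta (Cond b c d # K, []) xs =
     (((if b (decode_tops xs) then c else d) # K, []), rewrite_all xs)"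
| "ctrl_delta (Loop b c # K, []) xs =
     ((if b (decode_tops xs) then c # Loop b c # K else K, []), rewrite_all xs)"

text \<open>A superset of the continuations that a run from \<open>c # K\<close> passes through
  before it reaches \<open>K\<close>. It is finite, by recursion on the program, because the body of
  a loop returns to the loop itself and so adds nothing to the continuation from one pass to the
  next.\<close>

primrec conts :: "'a cmd \<Rightarrow> 'a cmd list \<Rightarrow> 'a cmd list set" where
  "conts (Act g) K = {Act g # K}"
| "conts (Seq c d) K = insert (Seq c d # K) (conts c (d # K) \<union> conts d K)"
| "conts (Cond b c d) K = insert (Cond b c d # K) (conts c K \<union> conts d K)"
| "conts (Loop b c) K = insert (Loop b c # K) (conts c (Loop b c # K))"

fun next_conts :: "'a cmd list \<Rightarrow> 'a cmd list set" where
  "next_conts [] = {[]}"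
| "next_conts (Act g # K) = {K}"
| "next_conts (Seq c d # K) = {c # d # K}"
| "next_conts (Cond b c d # K) = {c # K, d # K}"
| "next_conts (Loop b c # K) = {K, c # Loop b c # K}"

lemma finite_conts: "finite (conts c K)"
  by (induction c arbitrary: K) auto

lemma Cons_in_conts: "c # K \<in> conts c K"
  by (cases c) auto

lemma next_conts_closed: "K \<in> conts c K0 \<Longrightarrow> next_conts K \<subseteq> insert K0 (conts c K0)"
proof (induction c arbitrary: K0 K)
  case (Seq c d)
  then show ?case using Cons_in_conts[of d K0] Cons_in_conts[of c "d # K0"] by fastforce
next
  case (Cond b c d)
  then show ?case using Cons_in_conts[of d K0] Cons_in_conts[of c "K0"] by fastforce
next
  case (Loop b c)
  then show ?case using Cons_in_conts[of c "Loop b c # K0"] by fastforce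
qed auto

lemma wf_Act_in_conts: "Act g # K \<in> conts c K0 \<Longrightarrow> wf_cmd N \<Gamma> c \<Longrightarrow> wf_cmd N \<Gamma> (Act g)"
proof (induction c arbitrary: K0)
  case (Act f)
  then show ?case by simp
next
  case (Seq c d)
  then show ?case unfolding conts.simps wf_cmd.simps(2) by blast
next
  case (Cond b c d)
  then show ?case unfolding conts.simps wf_cmd.simps(3) by blast
next
  case (Loop b c)
  then show ?case unfolding conts.simps wf_cmd.simps(4) by blast
qed

lemma halted: "fst c = accept M \<or> fst c = reject M \<Longrightarrow> (step M ^^ n) c = c"
proof (induction n)
  case (Suc n)
  then show ?case by (auto simp: step_def split: prod.splits)
qed simp

section \<open>The machine of a program\<close>

locale compiled =
  fixes N :: nat and \<Gamma> :: "('a::finite) cell set" and prog :: "'a cmd" and out :: nat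
  assumes N: "N > 0" and fin: "finite \<Gamma>" and inputs: "range Input \<subseteq> \<Gamma>"
    and wf: "wf_cmd N \<Gamma> prog"
begin

definition tape_symbols :: "'a cell set" where
  "tape_symbols = insert Blank (up ` \<Gamma>)"

definition all_conts :: "'a cmd list set" where
  "all_conts = insert [] (conts prog [])"

definition ctrls :: "'a ctrl set" where
  "ctrls = all_conts \<times> insert [] {ps. set ps \<subseteq> insert None (Some ` tape_symbols) \<and> length ps = N}"

lemma finite_tape_symbols: "finite tape_symbols"
  by (simp add: tape_symbols_def fin)

lemma finite_ctrls: "finite ctrls"
  unfolding ctrls_def all_conts_def
  by (intro finite_cartesian_product finite.insertI finite_conts finite_lists_length_eq)
     (simp add: finite_tape_symbols)

text \<open>States of a \<open>tm\<close> are numbers, so the control states are numbered by some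
  injection; 0 and 1 are kept free for the accepting and the rejecting state.\<close>

definition code :: "'a ctrl \<Rightarrow> nat" where
  "code = (SOME f. inj_on f ctrls \<and> f ` ctrls \<subseteq> {2..})"

lemma inj_code: "inj_on code ctrls" and code_ge: "code ` ctrls \<subseteq> {2..}"
proof -
  obtain f :: "'a ctrl \<Rightarrow> nat" where f: "inj_on f ctrls"
    using finite_imp_inj_to_nat_seg[OF finite_ctrls] by blast
  have "inj_on (\<lambda>x. f x + 2) ctrls \<and> (\<lambda>x. f x + 2) ` ctrls \<subseteq> {2..}"
    using f by (auto simp: inj_on_def)
  then have "inj_on code ctrls \<and> code ` ctrls \<subseteq> {2..}"
    unfolding code_def
    by (rule someI[of "\<lambda>f. inj_on f ctrls \<and> f ` ctrls \<subseteq> {2..}"])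
  then show "inj_on code ctrls" "code ` ctrls \<subseteq> {2..}" by auto
qed

text \<open>In the control state \<open>([], [])\<close> the program is finished, and one last step
  turns the emptiness of stack \<open>out\<close> into the verdict. This step is the reason for
  \<open>Suc t\<close> in \<open>exec_decides\<close>.\<close>

definition machine :: "'a tm" where
  "machine =
     \<lparr>tapes = N, states = {0, 1} \<union> code ` ctrls, symbols = tape_symbols,
      start = code ([prog], []), accept = 0, reject = 1,
      delta = (\<lambda>q xs. let s = inv_into ctrls code q in
        if s = ([], []) then (if decode_tops xs out \<noteq> None then 0 else 1, rewrite_all xs)
        else (case ctrl_delta s xs of (s', as) \<Rightarrow> (code s', as)))\<rparr>"

lemma decode_code: "s \<in> ctrls \<Longrightarrow> inv_into ctrls code (code s) = s"
  by (simp add: inj_code)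

lemma wf_decode_tops:
  assumes "set xs \<subseteq> tape_symbols" and "length xs = N"
  shows "wf_tops N \<Gamma> (decode_tops xs)"
  unfolding wf_tops_def
proof (intro conjI allI impI)
  fix i z
  assume "decode_tops xs i = Some z"
  then have "i < length xs" "down (xs ! i) = Some z"
    by (auto simp: decode_tops_def split: if_splits)
  moreover have "xs ! i \<in> tape_symbols" using \<open>i < length xs\<close> assms by auto
  ultimately show "z \<in> \<Gamma>" by (auto simp: tape_symbols_def)
qed (simp add: decode_tops_def assms)

lemma pending_in: "set y \<subseteq> \<Gamma> \<Longrightarrow> pending y \<in> insert None (Some ` tape_symbols)"
  by (cases y rule: pending.cases) (auto simp: tape_symbols_def)

lemma ctrl_delta_wf:
  assumes s: "s \<in> ctrls" and xs: "set xs \<subseteq> tape_symbols" "length xs = N"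
    and "ctrl_delta s xs = (s', as)"
  shows "s' \<in> ctrls \<and> length as = N \<and> fst ` set as \<subseteq> tape_symbols"
proof -
  obtain K ps where sK: "s = (K, ps)" and K: "K \<in> all_conts"
    and ps: "ps = [] \<or> (set ps \<subseteq> insert None (Some ` tape_symbols) \<and> length ps = N)"
    using s by (auto simp: ctrls_def)
  have nxt: "K' \<in> all_conts" if "K' \<in> next_conts K" for K'
    using next_conts_closed[of K prog "[]"] K that by (auto simp: all_conts_def)
  have rw: "length (rewrite_all xs) = N" "fst ` set (rewrite_all xs) \<subseteq> tape_symbols"
    using xs by (auto simp: rewrite_all_def)
  have ctrlI: "(K', []) \<in> ctrls" if "K' \<in> all_conts" for K'
    using that by (auto simp: ctrls_def)
  show ?thesis
  proof (cases ps)
    case (Cons p ps')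
    then have ps: "set ps \<subseteq> insert None (Some ` tape_symbols)" "length ps = N" using ps by auto
    have "fst (write_upper q x) \<in> tape_symbols" if "(q, x) \<in> set (zip ps xs)" for q x
    proof -
      have "q \<in> set ps" "x \<in> set xs" using that set_zip_leftD set_zip_rightD by fast+
      then show ?thesis using ps xs by (auto simp: write_upper_def split: option.splits)
    qed
    then have "fst ` set (map2 write_upper ps xs) \<subseteq> tape_symbols" by auto
    moreover have "s' = (K, [])" "as = map2 write_upper ps xs"
      using assms(4) by (auto simp: sK Cons)
    ultimately show ?thesis using ctrlI K ps xs by auto
  next
    case Nil
    show ?thesis
    proof (cases K rule: next_conts.cases)
      case 1
      then show ?thesis using assms(4) rw ctrlI K by (auto simp: sK Nil)
    next
      case (2 g K')
      define ys where "ys = map (g (decode_tops xs)) [0..<N]"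
      have g: "set (g (decode_tops xs) i) \<subseteq> \<Gamma>" for i
        using wf_Act_in_conts[of g K' prog "[]" N \<Gamma>] K wf wf_decode_tops[OF xs]
        by (auto simp: all_conts_def 2)
      have s': "s' = (K', map pending ys)" "as = map2 write_lower xs ys"
        using assms(4) by (auto simp: sK 2 Nil Let_def ys_def xs)
      have ys: "set y \<subseteq> \<Gamma>" if "y \<in> set ys" for y
        using g that by (auto simp: ys_def)
      have "set (map pending ys) \<subseteq> insert None (Some ` tape_symbols)"
        unfolding set_map by (intro image_subsetI pending_in ys)
      moreover have "fst (write_lower x y) \<in> tape_symbols" if "set y \<subseteq> \<Gamma>" for x y
        using that by (cases y rule: pending.cases) (auto simp: tape_symbols_def)
      then have "fst ` set (map2 write_lower xs ys) \<subseteq> tape_symbols"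
        using ys by (auto dest: set_zip_rightD)
      ultimately show ?thesis
        using nxt[of K'] unfolding s' ctrls_def by (auto simp: 2 ys_def xs)
    next
      case (3 c d K')
      then show ?thesis using assms(4) rw ctrlI nxt[of "c # d # K'"] by (auto simp: sK Nil)
    next
      case (4 b c d K')
      then show ?thesis using assms(4) rw ctrlI nxt[of "c # K'"] nxt[of "d # K'"]
        by (auto simp: sK Nil)
    next
      case (5 b c K')
      then show ?thesis using assms(4) rw ctrlI nxt[of "K'"] nxt[of "c # Loop b c # K'"]
        by (auto simp: sK Nil split: if_splits)
    qed
  qed
qed

lemma start_in_ctrls: "([prog], []) \<in> ctrls"
  using Cons_in_conts[of prog "[]"] by (simp add: ctrls_def all_conts_def)

lemma wf_machine: "wf_tm machine"
proof -
  have delta: "fst (delta machine q xs) \<in> states machine \<and> length (snd (delta machine q xs)) = N \<and>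
      fst ` set (snd (delta machine q xs)) \<subseteq> tape_symbols"
    if q: "q \<in> states machine - {accept machine, reject machine}"
      and xs: "xs \<in> lists tape_symbols" "length xs = N" for q xs
  proof -
    from q obtain s where s: "s \<in> ctrls" "q = code s" by (auto simp: machine_def)
    have xs': "set xs \<subseteq> tape_symbols" using xs by auto
    show ?thesis
    proof (cases "s = ([], [])")
      case True
      then show ?thesis using xs xs' decode_code[OF s(1)]
        by (auto simp: machine_def s(2) rewrite_all_def)
    next
      case False
      obtain s' as where "ctrl_delta s xs = (s', as)" by fastforce
      then show ?thesis using ctrl_delta_wf[OF s(1) xs' xs(2)] False decode_code[OF s(1)]
        by (auto simp: machine_def s(2))
    qed
  qed
  have "Input a \<in> tape_symbols" for a
    using inputs unfolding tape_symbols_def by (metis image_eqI insertCI rangeI subsetD up.simps(2))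
  then show ?thesis
    using delta finite_ctrls start_in_ctrls finite_tape_symbols N
    unfolding wf_tm_def by (auto simp: machine_def tape_symbols_def)
qed

section \<open>The machine simulates the runs of the program\<close>

definition represents :: "'a stacks \<Rightarrow> 'a tape list \<Rightarrow> bool" where
  "represents \<sigma> ts \<longleftrightarrow>
     length ts = N \<and> (\<forall>i < N. holds (ts ! i) (\<sigma> i)) \<and> (\<forall>i \<ge> N. \<sigma> i = []) \<and>
     (\<forall>i. set (\<sigma> i) \<subseteq> \<Gamma>)"

lemma represents_tops: "represents \<sigma> ts \<Longrightarrow> decode_tops (map read ts) = tops_of \<sigma>"
  by (rule ext) (auto simp: represents_def decode_tops_def holds_read)

lemma peek_SomeD: "peek xs = Some z \<Longrightarrow> z \<in> set xs"
  by (cases xs) auto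

lemma wf_tops_of: "represents \<sigma> ts \<Longrightarrow> wf_tops N \<Gamma> (tops_of \<sigma>)"
  unfolding represents_def wf_tops_def by (auto dest!: peek_SomeD)

lemma map2_apply_act: "map2 (\<lambda>(y, d) t. move d (put y t)) as ts = map2 apply_act as ts"
  by (auto simp: apply_act_def)

lemma step_machine:
  assumes "s \<in> ctrls" "s \<noteq> ([], [])" "ctrl_delta s (map read ts) = (s', as)"
  shows "step machine (code s, ts) = (code s', map2 apply_act as ts)"
proof -
  have "code s \<ge> 2" using assms(1) code_ge by auto
  then show ?thesis
    using assms by (simp add: step_def machine_def decode_code map2_apply_act)
qed

lemma represents_rewrite:
  "represents \<sigma> ts \<Longrightarrow> represents \<sigma> (map2 apply_act (rewrite_all (map read ts)) ts)"
  by (auto simp: represents_def rewrite_all_def apply_act_def intro: holds_rewrite[simplified])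

lemma step_rewrite:
  assumes "K \<in> all_conts" "K \<noteq> []" "represents \<sigma> ts"
    and "ctrl_delta (K, []) (map read ts) = ((K', []), rewrite_all (map read ts))"
  shows "\<exists>ts'. step machine (code (K, []), ts) = (code (K', []), ts') \<and> represents \<sigma> ts'"
  using step_machine[OF _ _ assms(4)] represents_rewrite[OF assms(3)] assms(1,2)
  by (simp add: ctrls_def)

lemma funpow_trans: "(f ^^ m) x = y \<Longrightarrow> (f ^^ n) y = z \<Longrightarrow> (f ^^ (m + n)) x = z"
  by (simp add: add.commute[of m] funpow_add)

text \<open>The continuation \<open>K\<close> is generalized in the induction: the first half of
  \<open>Seq c d\<close> runs in front of \<open>d # K\<close>, and a loop body in front of the loop
  itself.\<close>

lemma exec_machine:
  assumes "exec c \<sigma> t \<sigma>'" "represents \<sigma> ts" "wf_cmd N \<Gamma> c"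
    and "conts c K \<subseteq> all_conts" "K \<in> all_conts"
  shows "\<exists>ts'. (step machine ^^ t) (code (c # K, []), ts) = (code (K, []), ts') \<and>
    represents \<sigma>' ts'"
  using assms
proof (induction arbitrary: ts K rule: exec.induct)
  case (Act g \<sigma>)
  let ?xs = "map read ts"
  have tops: "decode_tops ?xs = tops_of \<sigma>" by (rule represents_tops[OF Act.prems(1)])
  have len: "length ts = N" using Act.prems(1) by (simp add: represents_def)
  define ys where "ys = map (g (tops_of \<sigma>)) [0..<N]"
  define ts1 where "ts1 = map2 apply_act (map2 write_lower ?xs ys) ts"
  define ts2 where "ts2 = map2 apply_act (map2 write_upper (map pending ys) (map read ts1)) ts1"
  have 1: "step machine (code (Act g # K, []), ts) = (code (K, map pending ys), ts1)"
    unfolding ts1_def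
  proof (rule step_machine)
    show "ctrl_delta (Act g # K, []) ?xs = ((K, map pending ys), map2 write_lower ?xs ys)"
      by (simp add: tops ys_def len Let_def del: map_map)
  qed (use Act.prems in \<open>auto simp: ctrls_def\<close>)
  have g: "set (g (tops_of \<sigma>) i) \<subseteq> \<Gamma>" for i
    using Act.prems(2) wf_tops_of[OF Act.prems(1)] by auto
  have "(K, map pending ys) \<in> ctrls"
  proof -
    have "set (map pending ys) \<subseteq> insert None (Some ` tape_symbols)"
      unfolding set_map ys_def using g by (auto intro!: pending_in simp del: insert_iff)
    then show ?thesis using Act.prems(4) by (auto simp: ctrls_def ys_def)
  qed
  \<comment> \<open>Here \<open>N > 0\<close> is essential: the pending list must be nonempty for
    \<open>ctrl_delta\<close> to treat the next step as the second half of the action.\<close>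
  moreover have "map pending ys \<noteq> []" using N by (simp add: ys_def)
  moreover from this have "ctrl_delta (K, map pending ys) (map read ts1) =
      ((K, []), map2 write_upper (map pending ys) (map read ts1))"
    by (cases "map pending ys") (simp_all del: list.map)
  ultimately have 2: "step machine (code (K, map pending ys), ts1) = (code (K, []), ts2)"
    unfolding ts2_def by (intro step_machine) auto
  have "holds (ts2 ! i) (act g \<sigma> i)" if "i < N" for i
  proof -
    have "holds (ts ! i) (\<sigma> i)" using Act.prems(1) that by (simp add: represents_def)
    from holds_write[OF this Act.hyps[of i]] show ?thesis
      using that len by (simp add: ts2_def ts1_def ys_def act_def)
  qed
  moreover have "set (act g \<sigma> i) \<subseteq> \<Gamma>" for i
  proof -
    have "set (tl (\<sigma> i)) \<subseteq> set (\<sigma> i)" by (cases "\<sigma> i") auto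
    also have "\<dots> \<subseteq> \<Gamma>" using Act.prems(1) by (simp add: represents_def)
    finally show ?thesis using g[of i] by (simp add: act_def)
  qed
  moreover have "act g \<sigma> i = []" if "i \<ge> N" for i
    using Act.prems(1,2) wf_tops_of[OF Act.prems(1)] that by (auto simp: act_def represents_def)
  ultimately have "represents (act g \<sigma>) ts2"
    by (simp add: represents_def ts2_def ts1_def ys_def len)
  then show ?case using 1 2 by (simp add: numeral_2_eq_2)
next
  case (Seq c \<sigma> t \<sigma>' d t' \<sigma>'')
  have K: "Seq c d # K \<in> all_conts" "d # K \<in> all_conts"
    using Seq.prems Cons_in_conts[of d K] by auto
  from step_rewrite[OF K(1) _ Seq.prems(1)] obtain ts0 where
    0: "step machine (code (Seq c d # K, []), ts) = (code (c # d # K, []), ts0)" "represents \<sigma> ts0"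
    by fastforce
  from Seq.IH(1)[OF 0(2) _ _ K(2)] Seq.prems obtain ts1 where
    1: "(step machine ^^ t) (code (c # d # K, []), ts0) = (code (d # K, []), ts1)" "represents \<sigma>' ts1"
    by auto
  from Seq.IH(2)[OF 1(2), of K] Seq.prems obtain ts2 where
    2: "(step machine ^^ t') (code (d # K, []), ts1) = (code (K, []), ts2)" "represents \<sigma>'' ts2"
    by auto
  from funpow_trans[OF 1(1) 2(1)] 0(1) 2(2) show ?case
    by (auto simp: funpow_Suc_right simp del: funpow.simps(2))
next
  case (CondT b \<sigma> c t \<sigma>' d)
  have K: "Cond b c d # K \<in> all_conts" using CondT.prems by auto
  from step_rewrite[OF K _ CondT.prems(1), of "c # K"] CondT.hyps(1) obtain ts0 where
    0: "step machine (code (Cond b c d # K, []), ts) = (code (c # K, []), ts0)" "represents \<sigma> ts0"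
    by (auto simp: represents_tops[OF CondT.prems(1)])
  from CondT.IH[OF 0(2), of K] CondT.prems obtain ts1 where
    1: "(step machine ^^ t) (code (c # K, []), ts0) = (code (K, []), ts1)" "represents \<sigma>' ts1"
    by auto
  show ?case using 0 1 by (auto simp: funpow_Suc_right simp del: funpow.simps(2))
next
  case (CondF b \<sigma> d t \<sigma>' c)
  have K: "Cond b c d # K \<in> all_conts" using CondF.prems by auto
  from step_rewrite[OF K _ CondF.prems(1), of "d # K"] CondF.hyps(1) obtain ts0 where
    0: "step machine (code (Cond b c d # K, []), ts) = (code (d # K, []), ts0)" "represents \<sigma> ts0"
    by (auto simp: represents_tops[OF CondF.prems(1)])
  from CondF.IH[OF 0(2), of K] CondF.prems obtain ts1 where
    1: "(step machine ^^ t) (code (d # K, []), ts0) = (code (K, []), ts1)" "represents \<sigma>' ts1"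
    by auto
  show ?case using 0 1 by (auto simp: funpow_Suc_right simp del: funpow.simps(2))
next
  case (LoopT b \<sigma> c t \<sigma>' t' \<sigma>'')
  have K: "Loop b c # K \<in> all_conts" using LoopT.prems by auto
  from step_rewrite[OF K _ LoopT.prems(1), of "c # Loop b c # K"] LoopT.hyps(1) obtain ts0 where
    0: "step machine (code (Loop b c # K, []), ts) = (code (c # Loop b c # K, []), ts0)"
      "represents \<sigma> ts0"
    by (auto simp: represents_tops[OF LoopT.prems(1)])
  from LoopT.IH(1)[OF 0(2) _ _ K] LoopT.prems obtain ts1 where
    1: "(step machine ^^ t) (code (c # Loop b c # K, []), ts0) = (code (Loop b c # K, []), ts1)"
      "represents \<sigma>' ts1"
    by auto
  from LoopT.IH(2)[OF 1(2), of K] LoopT.prems obtain ts2 where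
    2: "(step machine ^^ t') (code (Loop b c # K, []), ts1) = (code (K, []), ts2)"
      "represents \<sigma>'' ts2"
    by auto
  from funpow_trans[OF 1(1) 2(1)] 0(1) 2(2) show ?case
    by (auto simp: funpow_Suc_right simp del: funpow.simps(2))
next
  case (LoopF b \<sigma> c)
  have K: "Loop b c # K \<in> all_conts" using LoopF.prems by auto
  from step_rewrite[OF K _ LoopF.prems(1), of K] LoopF.hyps(1) show ?case
    by (auto simp: represents_tops[OF LoopF.prems(1)])
qed

lemma exec_decides:
  assumes "exec prog (\<lambda>i. if i = 0 then map Input w else []) t \<sigma>" and "Suc t \<le> T"
  shows "fst ((step machine ^^ T) (init machine w)) =
    (if \<sigma> out \<noteq> [] then accept machine else reject machine)"
proof -
  let ?\<sigma> = "\<lambda>i::nat. if i = 0 then map Input w else []"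
  obtain q0 ts where init: "init machine w = (q0, ts)" by fastforce
  have q0: "q0 = code ([prog], [])" and ts: "ts = ([], map Input w) # replicate (N - 1) ([], [])"
    using init by (auto simp: init_def machine_def)
  have upI: "map Input w = map up (map Input w)" for w :: "'a list" by simp
  \<comment> \<open>\<open>up\<close> fixes input symbols, so the initial tapes already represent
    the initial stacks, with no surplus blanks on either side.\<close>
  have "holds (ts ! i) (?\<sigma> i)" if "i < N" for i
    using that N unfolding ts holds_def
    by (cases i) (auto intro!: exI[of _ 0])
  moreover have "set (?\<sigma> i) \<subseteq> \<Gamma>" for i using inputs by auto
  ultimately have "represents ?\<sigma> ts" using N by (auto simp: represents_def ts)
  from exec_machine[OF assms(1) this wf, of "[]"] obtain ts' where
    t: "(step machine ^^ t) (init machine w) = (code ([], []), ts')" "represents \<sigma> ts'"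
    by (auto simp: all_conts_def init q0)
  have in_ctrls: "([], []) \<in> ctrls" by (simp add: ctrls_def all_conts_def)
  then have "code ([], []) \<ge> 2" using code_ge by auto
  then have fin: "fst (step machine (code ([], []), ts')) =
      (if \<sigma> out \<noteq> [] then accept machine else reject machine)"
    using represents_tops[OF t(2)] decode_code[OF in_ctrls]
    by (cases "\<sigma> out") (auto simp: step_def machine_def split: prod.splits)
  obtain k where k: "T = k + Suc t" using assms(2) by (metis add.commute le_Suc_ex)
  have "(step machine ^^ T) (init machine w) =
      (step machine ^^ k) (step machine (code ([], []), ts'))"
    unfolding k funpow_add by (simp add: t)
  then show ?thesis using halted[of "step machine (code ([], []), ts')" machine k] fin by auto
qed

end

section \<open>Polynomial-time stack programs\<close>

text \<open>
  Here \<open>x\<close> stands for the logical variables of a Hoare triple; the polynomial must not depend on them.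
\<close>

definition ptime ::
  "'a cmd \<Rightarrow> ('x \<Rightarrow> bool) \<Rightarrow> ('x \<Rightarrow> 'a stacks) \<Rightarrow> ('x \<Rightarrow> 'a stacks) \<Rightarrow> bool" where
  "ptime c X s s' \<longleftrightarrow>
     (\<exists>p :: nat poly. \<forall>x N. X x \<longrightarrow> (\<forall>i. length (s x i) \<le> N) \<longrightarrow>
        (\<exists>t \<le> poly p N. exec c (s x) t (s' x)))"

lemma poly_nat_mono: "m \<le> n \<Longrightarrow> poly (p :: nat poly) m \<le> poly p n"
  by (induction p) (auto intro: add_mono mult_mono)

text \<open>An action takes two steps and puts at most two symbols in place of the top. Time
  therefore bounds growth, which lets polynomial bounds compose.\<close>

lemma exec_length: "exec c \<sigma> t \<sigma>' \<Longrightarrow> length (\<sigma>' i) \<le> length (\<sigma> i) + t"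
proof (induction rule: exec.induct)
  case (Act g \<sigma>)
  have "length (g (tops_of \<sigma>) i) \<le> 2" by (rule Act)
  then show ?case by (simp add: act_def)
qed auto

lemma exec_Loop_step:
  assumes "b (tops_of \<sigma>)" "exec c \<sigma> t \<sigma>'" "exec (Loop b c) \<sigma>' t' \<sigma>''" "T = Suc (t + t')"
  shows "exec (Loop b c) \<sigma> T \<sigma>''"
  using exec.LoopT[OF assms(1-3)] assms(4) by simp

lemma ptime_cong:
  assumes "ptime c X s s'" and "\<And>x. X x \<Longrightarrow> s x = u x" and "\<And>x. X x \<Longrightarrow> s' x = u' x"
  shows "ptime c X u u'"
proof -
  obtain p :: "nat poly" where p: "\<And>x N. X x \<Longrightarrow> (\<And>i. length (s x i) \<le> N) \<Longrightarrow>
      \<exists>t \<le> poly p N. exec c (s x) t (s' x)"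
    using assms(1) unfolding ptime_def by blast
  have "\<exists>t \<le> poly p N. exec c (u x) t (u' x)" if "X x" "\<forall>i. length (u x i) \<le> N" for x N
    using p[of x N] that assms(2,3)[of x] by simp
  then show ?thesis unfolding ptime_def by blast
qed

lemma ptime_post:
  assumes "ptime c X s s'" and "\<And>x. X x \<Longrightarrow> s' x = u' x"
  shows "ptime c X s u'"
  by (rule ptime_cong[OF assms(1)]) (simp_all add: assms(2))

lemma ptime_Seq:
  assumes "ptime c X s s1" and "ptime d X s1 s2"
  shows "ptime (Seq c d) X s s2"
proof -
  obtain p :: "nat poly" where p: "\<And>x N. X x \<Longrightarrow> (\<And>i. length (s x i) \<le> N) \<Longrightarrow>
      \<exists>t \<le> poly p N. exec c (s x) t (s1 x)"
    using assms(1) unfolding ptime_def by blast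
  obtain q :: "nat poly" where q: "\<And>x N. X x \<Longrightarrow> (\<And>i. length (s1 x i) \<le> N) \<Longrightarrow>
      \<exists>t \<le> poly q N. exec d (s1 x) t (s2 x)"
    using assms(2) unfolding ptime_def by blast
  \<comment> \<open>After the first program all stacks have length at most
    \<open>N + poly p N\<close>; this is the argument at which \<open>q\<close> is taken.\<close>
  have "\<exists>t \<le> poly (1 + p + pcompose q ([:0, 1:] + p)) N. exec (Seq c d) (s x) t (s2 x)"
    if x: "X x" and N: "\<And>i. length (s x i) \<le> N" for x N
  proof -
    obtain t where t: "t \<le> poly p N" "exec c (s x) t (s1 x)" using p[OF x N] by blast
    have "length (s1 x i) \<le> N + poly p N" for i
      using exec_length[OF t(2), of i] N[of i] t(1) by linarith
    from q[OF x this] obtain t' where t': "t' \<le> poly q (N + poly p N)" "exec d (s1 x) t' (s2 x)"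
      by blast
    from exec.Seq[OF t(2) t'(2)] show ?thesis
      using t(1) t'(1) by (intro exI[of _ "Suc (t + t')"]) (simp add: poly_pcompose)
  qed
  then show ?thesis unfolding ptime_def by blast
qed

lemma ptime_Cond:
  assumes "ptime c (\<lambda>x. X x \<and> b (tops_of (s x))) s s1"
    and "ptime d (\<lambda>x. X x \<and> \<not> b (tops_of (s x))) s s2"
  shows "ptime (Cond b c d) X s (\<lambda>x. if b (tops_of (s x)) then s1 x else s2 x)"
proof -
  obtain p :: "nat poly" where p: "\<And>x N. X x \<Longrightarrow> b (tops_of (s x)) \<Longrightarrow>
      (\<And>i. length (s x i) \<le> N) \<Longrightarrow> \<exists>t \<le> poly p N. exec c (s x) t (s1 x)"
    using assms(1) unfolding ptime_def by blast
  obtain q :: "nat poly" where q: "\<And>x N. X x \<Longrightarrow> \<not> b (tops_of (s x)) \<Longrightarrow>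
      (\<And>i. length (s x i) \<le> N) \<Longrightarrow> \<exists>t \<le> poly q N. exec d (s x) t (s2 x)"
    using assms(2) unfolding ptime_def by blast
  have "\<exists>t \<le> poly (1 + p + q) N.
      exec (Cond b c d) (s x) t (if b (tops_of (s x)) then s1 x else s2 x)"
    if x: "X x" and N: "\<And>i. length (s x i) \<le> N" for x N
  proof (cases "b (tops_of (s x))")
    case True
    from p[OF x True N] obtain t where t: "t \<le> poly p N" "exec c (s x) t (s1 x)" by blast
    from exec.CondT[of b, OF True t(2)] show ?thesis
      using t(1) True by (intro exI[of _ "Suc t"]) simp
  next
    case False
    from q[OF x False N] obtain t where t: "t \<le> poly q N" "exec d (s x) t (s2 x)" by blast
    from exec.CondF[of b, OF False t(2)] show ?thesis
      using t(1) False by (intro exI[of _ "Suc t"]) simp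
  qed
  then show ?thesis unfolding ptime_def by blast
qed

lemma exec_Loop_iterate:
  assumes "\<And>i. i < n \<Longrightarrow> b (tops_of (A i)) \<and> (\<exists>t \<le> T. exec c (A i) t (A (Suc i)))"
    and "\<not> b (tops_of (A n))"
  shows "\<exists>t \<le> n * Suc T + 1. exec (Loop b c) (A 0) t (A n)"
  using assms
proof (induction n arbitrary: A)
  case 0
  then have "exec (Loop b c) (A 0) 1 (A 0)" by (intro exec.LoopF)
  then show ?case by auto
next
  case (Suc n)
  from Suc.prems(1)[of 0] obtain t where t: "b (tops_of (A 0))" "t \<le> T" "exec c (A 0) t (A 1)"
    by auto
  from Suc.IH[of "\<lambda>i. A (Suc i)"] Suc.prems obtain t' where
    t': "t' \<le> n * Suc T + 1" "exec (Loop b c) (A 1) t' (A (Suc n))"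
    by auto
  from exec.LoopT[of b, OF t(1,3) t'(2)] t(2) t'(1) show ?case
    by (intro exI[of _ "Suc (t + t')"]) simp
qed

text \<open>Polynomially many passes through a polynomial body do not suffice, as each pass might
  double a stack. Hence the state \<open>A x i\<close> before each pass is given explicitly, with a
  size bound in terms of the initial state. The pass number belongs to the logical variables of the
  body, so the time bound is the same for all passes.\<close>

lemma ptime_Loop:
  fixes A :: "'x \<Rightarrow> nat \<Rightarrow> 'a stacks"
  assumes body: "ptime c (\<lambda>(x, i). X x \<and> i < n x) (\<lambda>(x, i). A x i) (\<lambda>(x, i). A x (Suc i))"
    and cont: "\<And>x i. X x \<Longrightarrow> i < n x \<Longrightarrow> b (tops_of (A x i))"
    and stop: "\<And>x. X x \<Longrightarrow> \<not> b (tops_of (A x (n x)))"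
    and count: "\<And>x N. X x \<Longrightarrow> (\<And>r. length (A x 0 r) \<le> N) \<Longrightarrow> n x \<le> poly q N"
    and size: "\<And>x N i r. X x \<Longrightarrow> (\<And>r. length (A x 0 r) \<le> N) \<Longrightarrow> i < n x \<Longrightarrow>
      length (A x i r) \<le> poly q' N"
  shows "ptime (Loop b c) X (\<lambda>x. A x 0) (\<lambda>x. A x (n x))"
proof -
  obtain p :: "nat poly" where p0: "\<forall>y N. (case y of (x, i) \<Rightarrow> X x \<and> i < n x) \<longrightarrow>
      (\<forall>r. length ((case y of (x, i) \<Rightarrow> A x i) r) \<le> N) \<longrightarrow>
      (\<exists>t \<le> poly p N. exec c (case y of (x, i) \<Rightarrow> A x i) t (case y of (x, i) \<Rightarrow> A x (Suc i)))"
    using body unfolding ptime_def by blast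
  have p: "\<exists>t \<le> poly p N. exec c (A x i) t (A x (Suc i))"
    if "X x" "i < n x" "\<And>r. length (A x i r) \<le> N" for x i N
    using p0[rule_format, of "(x, i)" N] that by simp
  have "\<exists>t \<le> poly (q * (1 + pcompose p q') + 1) N. exec (Loop b c) (A x 0) t (A x (n x))"
    if x: "X x" and N: "\<And>r. length (A x 0 r) \<le> N" for x N
  proof -
    have "\<exists>t \<le> poly p (poly q' N). exec c (A x i) t (A x (Suc i))" if "i < n x" for i
      using p[OF x that] size[OF x N that] by blast
    then obtain t where t: "t \<le> n x * Suc (poly p (poly q' N)) + 1"
        "exec (Loop b c) (A x 0) t (A x (n x))"
      using exec_Loop_iterate[of "n x" b "A x" "poly p (poly q' N)" c] cont[OF x] stop[OF x] by blast
    have "n x * Suc (poly p (poly q' N)) \<le> poly q N * Suc (poly p (poly q' N))"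
      using count[OF x N] by (rule mult_le_mono1)
    then have "t \<le> poly (q * (1 + pcompose p q') + 1) N"
      using t(1) by (simp add: poly_pcompose)
    then show ?thesis using t(2) by blast
  qed
  then show ?thesis unfolding ptime_def by blast
qed

lemma ptime_linear_le:
  assumes "\<And>x. X x \<Longrightarrow> \<exists>r t. t \<le> a * length (s x r) + d \<and> exec c (s x) t (s' x)"
  shows "ptime c X s s'"
proof -
  have "\<exists>t \<le> poly [:d, a:] N. exec c (s x) t (s' x)"
    if x: "X x" and N: "\<And>i. length (s x i) \<le> N" for x N
  proof -
    obtain r t where r: "t \<le> a * length (s x r) + d" "exec c (s x) t (s' x)"
      using assms[OF x] by blast
    have "a * length (s x r) + d \<le> poly [:d, a:] N" using N[of r] by (simp add: mult.commute)
    then show ?thesis using r le_trans by blast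
  qed
  then show ?thesis unfolding ptime_def by blast
qed

lemma ptime_linear:
  assumes "\<And>x. X x \<Longrightarrow> \<exists>r. exec c (s x) (a * length (s x r) + d) (s' x)"
  shows "ptime c X s s'"
  by (rule ptime_linear_le[where a = a and d = d]) (use assms in blast)

lemma ptime_const:
  assumes "\<And>x. X x \<Longrightarrow> exec c (s x) d (s' x)"
  shows "ptime c X s s'"
  by (rule ptime_linear_le[where a = 0 and d = d]) (use assms in force)


section \<open>Basic programs\<close>

text \<open>An action always removes the top, so leaving a stack alone means returning its
  top.\<close>

definition keep :: "'a tops \<Rightarrow> nat \<Rightarrow> 'a cell list" where
  "keep tp i = (case tp i of None \<Rightarrow> [] | Some z \<Rightarrow> [z])"

lemma keep_tops [simp]: "keep (tops_of \<sigma>) i @ tl (\<sigma> i) = \<sigma> i"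
  by (cases "\<sigma> i") (auto simp: keep_def)

lemma length_keep: "length (keep tp i) \<le> 1"
  by (auto simp: keep_def split: option.splits)

lemma length_keep_Suc: "length (keep tp i) \<le> Suc n"
  using length_keep[of tp i] by simp

lemma keep_wf:
  "wf_tops N \<Gamma> tp \<Longrightarrow> set (keep tp i) \<subseteq> \<Gamma>"
  "wf_tops N \<Gamma> tp \<Longrightarrow> i \<ge> N \<Longrightarrow> keep tp i = []"
  by (auto simp: keep_def wf_tops_def split: option.splits)

definition push :: "nat \<Rightarrow> 'a cell \<Rightarrow> 'a cmd" where
  "push j z = Act (\<lambda>tp. (keep tp)(j := z # keep tp j))"

definition pop :: "nat \<Rightarrow> 'a cmd" where
  "pop j = Act (\<lambda>tp. (keep tp)(j := []))"

definition nop :: "'a cmd" where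
  "nop = Act keep"

definition shift :: "nat \<Rightarrow> nat \<Rightarrow> 'a cmd" where
  "shift i j = Act (\<lambda>tp. (keep tp)(i := [], j := keep tp i @ keep tp j))"

definition shift2 :: "nat \<Rightarrow> nat \<Rightarrow> nat \<Rightarrow> 'a cmd" where
  "shift2 k i j =
     Act (\<lambda>tp. (keep tp)(k := [], i := keep tp k @ keep tp i, j := keep tp k @ keep tp j))"

definition shift_while :: "('a cell \<Rightarrow> bool) \<Rightarrow> nat \<Rightarrow> nat \<Rightarrow> 'a cmd" where
  "shift_while Q i j = Loop (\<lambda>tp. \<exists>z. tp i = Some z \<and> Q z) (shift i j)"

definition clear :: "nat \<Rightarrow> 'a cmd" where
  "clear i = Loop (\<lambda>tp. tp i \<noteq> None) (pop i)"

text \<open>Register 9 is the scratch stack: the source is reversed onto it and from there returned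
  to both stacks, so the two reversals cancel and the source survives. Register 9 has to be empty
  before.\<close>

definition copy :: "nat \<Rightarrow> nat \<Rightarrow> 'a cmd" where
  "copy i j = Seq (shift_while (\<lambda>_. True) i 9) (Loop (\<lambda>tp. tp 9 \<noteq> None) (shift2 9 i j))"

primrec seqs :: "'a cmd list \<Rightarrow> 'a cmd" where
  "seqs [] = nop"
| "seqs (c # cs) = Seq c (seqs cs)"

lemma wf_push: "j < N \<Longrightarrow> z \<in> \<Gamma> \<Longrightarrow> wf_cmd N \<Gamma> (push j z)"
  using keep_wf by (fastforce simp: push_def)

lemma wf_pop: "wf_cmd N \<Gamma> (pop j)"
  using keep_wf by (fastforce simp: pop_def)

lemma wf_nop: "wf_cmd N \<Gamma> nop"
  using keep_wf by (fastforce simp: nop_def)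

lemma wf_shift: "i < N \<Longrightarrow> j < N \<Longrightarrow> wf_cmd N \<Gamma> (shift i j)"
  using keep_wf by (fastforce simp: shift_def)

lemma wf_shift2: "k < N \<Longrightarrow> i < N \<Longrightarrow> j < N \<Longrightarrow> wf_cmd N \<Gamma> (shift2 k i j)"
  using keep_wf by (fastforce simp: shift2_def)

lemma wf_shift_while: "i < N \<Longrightarrow> j < N \<Longrightarrow> wf_cmd N \<Gamma> (shift_while Q i j)"
  by (simp add: shift_while_def wf_shift)

lemma wf_clear: "wf_cmd N \<Gamma> (clear i)"
  by (simp add: clear_def wf_pop)

lemma wf_copy: "i < N \<Longrightarrow> j < N \<Longrightarrow> 9 < N \<Longrightarrow> wf_cmd N \<Gamma> (copy i j)"
  by (simp add: copy_def wf_shift2 wf_shift_while)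

lemma wf_seqs: "(\<And>c. c \<in> set cs \<Longrightarrow> wf_cmd N \<Gamma> c) \<Longrightarrow> wf_cmd N \<Gamma> (seqs cs)"
  by (induction cs) (auto simp: wf_nop)

lemmas wf_basic = wf_push wf_pop wf_nop wf_shift wf_shift_while wf_clear wf_copy

lemma exec_push: "exec (push j z) \<sigma> 2 (\<sigma>(j := z # \<sigma> j))"
proof -
  have "act (\<lambda>tp. (keep tp)(j := z # keep tp j)) \<sigma> = \<sigma>(j := z # \<sigma> j)"
    by (rule ext) (simp add: act_def)
  then show ?thesis
    using exec.Act[of "\<lambda>tp. (keep tp)(j := z # keep tp j)" \<sigma>]
    by (simp add: push_def length_keep length_keep_Suc numeral_2_eq_2)
qed

lemma exec_pop: "exec (pop j) \<sigma> 2 (\<sigma>(j := tl (\<sigma> j)))"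
proof -
  have "act (\<lambda>tp. (keep tp)(j := [])) \<sigma> = \<sigma>(j := tl (\<sigma> j))"
    by (rule ext) (simp add: act_def)
  then show ?thesis
    using exec.Act[of "\<lambda>tp. (keep tp)(j := [])" \<sigma>]
    by (simp add: pop_def length_keep_Suc numeral_2_eq_2)
qed

lemma exec_nop: "exec nop \<sigma> 2 \<sigma>"
proof -
  have "act keep \<sigma> = \<sigma>" by (rule ext) (simp add: act_def)
  then show ?thesis
    using exec.Act[of keep \<sigma>] by (simp add: nop_def length_keep_Suc numeral_2_eq_2)
qed

lemma exec_shift:
  assumes "i \<noteq> j" "\<sigma> i = z # xs"
  shows "exec (shift i j) \<sigma> 2 (\<sigma>(i := xs, j := z # \<sigma> j))"
proof -
  let ?g = "\<lambda>tp. (keep tp)(i := [], j := keep tp i @ keep tp j)"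
  have "keep (tops_of \<sigma>) i = [z]" using assms(2) by (simp add: keep_def)
  then have "act ?g \<sigma> = \<sigma>(i := xs, j := z # \<sigma> j)"
    using assms by (intro ext) (simp add: act_def)
  moreover have "length (?g (tops_of \<sigma>) k) \<le> 2" for k
    using length_keep[of "tops_of \<sigma>" i] length_keep[of "tops_of \<sigma>" j] length_keep[of "tops_of \<sigma>" k]
    by simp
  ultimately show ?thesis using exec.Act[of ?g \<sigma>] by (simp add: shift_def)
qed

lemma exec_shift2:
  assumes "k \<noteq> i" "k \<noteq> j" "i \<noteq> j" "\<sigma> k = z # xs"
  shows "exec (shift2 k i j) \<sigma> 2 (\<sigma>(k := xs, i := z # \<sigma> i, j := z # \<sigma> j))"
proof -
  let ?g = "\<lambda>tp. (keep tp)(k := [], i := keep tp k @ keep tp i, j := keep tp k @ keep tp j)"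
  have "keep (tops_of \<sigma>) k = [z]" using assms(4) by (simp add: keep_def)
  then have "act ?g \<sigma> = \<sigma>(k := xs, i := z # \<sigma> i, j := z # \<sigma> j)"
    using assms by (intro ext) (simp add: act_def)
  moreover have "length (?g (tops_of \<sigma>) l) \<le> 2" for l
    using length_keep[of "tops_of \<sigma>" i] length_keep[of "tops_of \<sigma>" j] length_keep[of "tops_of \<sigma>" k]
      length_keep[of "tops_of \<sigma>" l]
    by simp
  ultimately show ?thesis using exec.Act[of ?g \<sigma>] by (simp add: shift2_def)
qed

text \<open>Each symbol costs one step for the test and two for the action; the \<open>1\<close> is
  the final failing test. The symbols arrive in reverse order.\<close>

lemma exec_shift_while:
  assumes "i \<noteq> j"
  shows "exec (shift_while Q i j) \<sigma> (3 * length (takeWhile Q (\<sigma> i)) + 1)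
    (\<sigma>(i := dropWhile Q (\<sigma> i), j := rev (takeWhile Q (\<sigma> i)) @ \<sigma> j))"
proof (induction "\<sigma> i" arbitrary: \<sigma>)
  case Nil
  then have "\<sigma> i = []" by simp
  then show ?case using exec.LoopF[of "\<lambda>tp. \<exists>z. tp i = Some z \<and> Q z" \<sigma> "shift i j"]
    by (simp add: shift_while_def fun_upd_idem)
next
  case (Cons z xs)
  then have z: "\<sigma> i = z # xs" by simp
  show ?case
  proof (cases "Q z")
    case False
    then show ?thesis using exec.LoopF[of "\<lambda>tp. \<exists>z. tp i = Some z \<and> Q z" \<sigma> "shift i j"] z
      by (simp add: shift_while_def fun_upd_idem)
  next
    case True
    let ?\<sigma>1 = "\<sigma>(i := xs, j := z # \<sigma> j)"
    have "exec (shift_while Q i j) ?\<sigma>1 (3 * length (takeWhile Q xs) + 1)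
        (?\<sigma>1(i := dropWhile Q xs, j := rev (takeWhile Q xs) @ z # \<sigma> j))"
      using Cons(1)[of ?\<sigma>1] assms by simp
    moreover have "?\<sigma>1(i := dropWhile Q xs, j := rev (takeWhile Q xs) @ z # \<sigma> j) =
        \<sigma>(i := dropWhile Q (\<sigma> i), j := rev (takeWhile Q (\<sigma> i)) @ \<sigma> j)"
      using assms True z by (intro ext) auto
    ultimately show ?thesis
      unfolding shift_while_def
      by (intro exec_Loop_step[OF _ exec_shift[of i j \<sigma> z xs, OF assms z]]) (auto simp: True z)
  qed
qed

lemma exec_clear: "exec (clear i) \<sigma> (3 * length (\<sigma> i) + 1) (\<sigma>(i := []))"
proof (induction "\<sigma> i" arbitrary: \<sigma>)
  case Nil
  then have "\<sigma> i = []" by simp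
  then show ?case using exec.LoopF[of "\<lambda>tp. tp i \<noteq> None" \<sigma> "pop i"]
    by (simp add: clear_def fun_upd_idem)
next
  case (Cons z xs)
  then have z: "\<sigma> i = z # xs" by simp
  have "exec (clear i) (\<sigma>(i := xs)) (3 * length xs + 1) (\<sigma>(i := []))"
    using Cons(1)[of "\<sigma>(i := xs)"] by simp
  then show ?case
    unfolding clear_def by (intro exec_Loop_step[OF _ exec_pop[of i \<sigma>]]) (auto simp: z)
qed

lemma exec_copy_back:
  assumes "k \<noteq> i" "k \<noteq> j" "i \<noteq> j"
  shows "exec (Loop (\<lambda>tp. tp k \<noteq> None) (shift2 k i j)) \<sigma> (3 * length (\<sigma> k) + 1)
    (\<sigma>(k := [], i := rev (\<sigma> k) @ \<sigma> i, j := rev (\<sigma> k) @ \<sigma> j))"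
proof (induction "\<sigma> k" arbitrary: \<sigma>)
  case Nil
  then have "\<sigma> k = []" by simp
  then show ?case using exec.LoopF[of "\<lambda>tp. tp k \<noteq> None" \<sigma> "shift2 k i j"]
    by (simp add: fun_upd_idem)
next
  case (Cons z xs)
  then have z: "\<sigma> k = z # xs" by simp
  let ?\<sigma>1 = "\<sigma>(k := xs, i := z # \<sigma> i, j := z # \<sigma> j)"
  have "exec (Loop (\<lambda>tp. tp k \<noteq> None) (shift2 k i j)) ?\<sigma>1 (3 * length xs + 1)
      (?\<sigma>1(k := [], i := rev xs @ z # \<sigma> i, j := rev xs @ z # \<sigma> j))"
    using Cons(1)[of ?\<sigma>1] assms by simp
  moreover have "?\<sigma>1(k := [], i := rev xs @ z # \<sigma> i, j := rev xs @ z # \<sigma> j) =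
      \<sigma>(k := [], i := rev (\<sigma> k) @ \<sigma> i, j := rev (\<sigma> k) @ \<sigma> j)"
    using assms z by (intro ext) auto
  ultimately show ?case
    by (intro exec_Loop_step[OF _ exec_shift2[of k i j \<sigma> z xs, OF assms z]]) (auto simp: z)
qed

lemma exec_copy:
  assumes "i \<noteq> 9" "j \<noteq> 9" "i \<noteq> j" "\<sigma> 9 = []"
  shows "exec (copy i j) \<sigma> (6 * length (\<sigma> i) + 3) (\<sigma>(j := \<sigma> i @ \<sigma> j))"
proof -
  have tW: "takeWhile (\<lambda>_. True) xs = xs" "dropWhile (\<lambda>_. True) xs = []" for xs :: "'a cell list"
    by (induction xs) auto
  let ?\<sigma>1 = "\<sigma>(i := [], 9 := rev (\<sigma> i))"
  have 1: "exec (shift_while (\<lambda>_. True) i 9) \<sigma> (3 * length (\<sigma> i) + 1) ?\<sigma>1"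
    using exec_shift_while[OF assms(1), of "\<lambda>_. True" \<sigma>] by (simp add: tW assms)
  have "?\<sigma>1(9 := [], i := rev (?\<sigma>1 9) @ ?\<sigma>1 i, j := rev (?\<sigma>1 9) @ ?\<sigma>1 j) = \<sigma>(j := \<sigma> i @ \<sigma> j)"
    using assms by (intro ext) auto
  then have 2: "exec (Loop (\<lambda>tp. tp 9 \<noteq> None) (shift2 9 i j)) ?\<sigma>1 (3 * length (\<sigma> i) + 1)
      (\<sigma>(j := \<sigma> i @ \<sigma> j))"
    using exec_copy_back[of 9 i j ?\<sigma>1] assms by simp
  have "6 * length (\<sigma> i) + 3 = Suc (3 * length (\<sigma> i) + 1 + (3 * length (\<sigma> i) + 1))" by simp
  then show ?thesis
    using exec.Seq[OF 1 2] unfolding copy_def by (simp only:)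
qed

lemma ptime_push: "ptime (push j z) X s (\<lambda>x. (s x)(j := z # s x j))"
  by (rule ptime_const[where d = 2]) (rule exec_push)

lemma ptime_pop: "ptime (pop j) X s (\<lambda>x. (s x)(j := tl (s x j)))"
  by (rule ptime_const[where d = 2]) (rule exec_pop)

lemma ptime_nop: "ptime nop X s s"
  by (rule ptime_const[where d = 2]) (rule exec_nop)

lemma ptime_shift:
  assumes "i \<noteq> j" "\<And>x. X x \<Longrightarrow> s x i = z x # xs x"
  shows "ptime (shift i j) X s (\<lambda>x. (s x)(i := xs x, j := z x # s x j))"
  by (rule ptime_const[where d = 2]) (rule exec_shift, rule assms(1), erule assms(2))

lemma ptime_shift_while:
  assumes "i \<noteq> j"
  shows "ptime (shift_while Q i j) X s
    (\<lambda>x. (s x)(i := dropWhile Q (s x i), j := rev (takeWhile Q (s x i)) @ s x j))"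
proof (rule ptime_linear_le[where a = 3 and d = 1])
  fix x
  have "3 * length (takeWhile Q (s x i)) + 1 \<le> 3 * length (s x i) + 1"
    using length_takeWhile_le[of Q "s x i"] by simp
  then show "\<exists>r t. t \<le> 3 * length (s x r) + 1 \<and> exec (shift_while Q i j) (s x) t
      ((s x)(i := dropWhile Q (s x i), j := rev (takeWhile Q (s x i)) @ s x j))"
    using exec_shift_while[OF assms, of Q "s x"] by blast
qed

lemma ptime_clear: "ptime (clear i) X s (\<lambda>x. (s x)(i := []))"
  by (rule ptime_linear[where a = 3 and d = 1]) (use exec_clear in blast)

lemma ptime_copy:
  assumes "i \<noteq> 9" "j \<noteq> 9" "i \<noteq> j" "\<And>x. X x \<Longrightarrow> s x 9 = []"
  shows "ptime (copy i j) X s (\<lambda>x. (s x)(j := s x i @ s x j))"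
  by (rule ptime_linear[where a = 6 and d = 3]) (use exec_copy[OF assms(1-3)] assms(4) in blast)

lemma ptime_seqs_clear:
  "ptime (seqs (map clear rs)) X s (\<lambda>x r. if r \<in> set rs then [] else s x r)"
proof (induction rs arbitrary: s)
  case Nil
  then show ?case by (simp add: ptime_nop)
next
  case (Cons r rs)
  show ?case
    unfolding list.map seqs.simps
    by (rule ptime_post[OF ptime_Seq[OF ptime_clear Cons.IH]]) auto
qed

section \<open>Running a Turing machine as a stack program\<close>

lemma halting_config: "fst c = accept M \<or> fst c = reject M \<Longrightarrow> step M c = c"
  using halted[of c M 1] by simp

text \<open>With a tape split into two stacks at the head, one step of a machine replaces the top of
  each half by at most two symbols, so it fits into a single action. Only a move to the left lets
  one half depend on the other: the top of the left half becomes the scanned cell, or a new blank if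
  there is none.\<close>

definition new_left :: "'a cell \<times> dir \<Rightarrow> 'a cell list \<Rightarrow> 'a cell list" where
  "new_left a ks = (case snd a of Left \<Rightarrow> [] | Right \<Rightarrow> fst a # ks | Stay \<Rightarrow> ks)"

definition new_right :: "'a cell \<times> dir \<Rightarrow> 'a cell option \<Rightarrow> 'a cell list" where
  "new_right a lt =
     (case snd a of
        Left \<Rightarrow> [case lt of None \<Rightarrow> Blank | Some z \<Rightarrow> z, fst a]
      | Right \<Rightarrow> []
      | Stay \<Rightarrow> [fst a])"

lemma apply_act_stacks:
  "apply_act a (l, r) =
    (new_left a (case peek l of None \<Rightarrow> [] | Some z \<Rightarrow> [z]) @ tl l, new_right a (peek l) @ tl r)"
  by (cases a; cases "snd a"; cases l; cases r)
     (auto simp: apply_act_def new_left_def new_right_def)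

lemma length_new_left: "length ks \<le> 1 \<Longrightarrow> length (new_left a ks) \<le> 2"
  by (auto simp: new_left_def split: dir.splits)

lemma length_new_right: "length (new_right a lt) \<le> 2"
  by (auto simp: new_right_def split: dir.splits)

lemma read_peek: "read t = (case peek (snd t) of None \<Rightarrow> Blank | Some z \<Rightarrow> z)"
  by (cases t rule: read.cases) auto

text \<open>
  Tape \<open>j\<close> of the simulated machine is held in registers \<open>16 + 2j\<close> (cells left of the head) and
  \<open>17 + 2j\<close>, its state in register 13, and its verdict is left in register 12.
\<close>

locale decider =
  fixes M :: "('a::finite) tm" and L :: "'a list set" and p :: "nat poly"
  assumes wf_M: "wf_tm M" and decides: "decides_in M L (poly p)"
begin

text \<open>The transition function of \<open>M\<close> is constrained only on legal states and
  symbols, so simulated runs have to be confined to them.\<close>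

definition valid_config :: "'a config \<Rightarrow> bool" where
  "valid_config c \<longleftrightarrow> fst c \<in> states M \<and> length (snd c) = tapes M \<and>
     (\<forall>t \<in> set (snd c). set (fst t) \<subseteq> symbols M \<and> set (snd t) \<subseteq> symbols M)"

lemma Blank_symbol: "Blank \<in> symbols M"
  using wf_M by (auto simp: wf_tm_def)

lemma read_symbol: "set (snd t) \<subseteq> symbols M \<Longrightarrow> read t \<in> symbols M"
  by (cases t rule: read.cases) (auto simp: Blank_symbol)

lemma apply_act_symbols:
  assumes "set l \<subseteq> symbols M" "set r \<subseteq> symbols M" "fst a \<in> symbols M"
  shows "set (fst (apply_act a (l, r))) \<subseteq> symbols M \<and> set (snd (apply_act a (l, r))) \<subseteq> symbols M"
proof -
  have "set (tl xs) \<subseteq> set xs" for xs :: "'a cell list" by (cases xs) auto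
  then show ?thesis
    using assms Blank_symbol by (cases l)
      (fastforce simp: apply_act_stacks new_left_def new_right_def split: dir.splits)+
qed

lemma step_unfold:
  assumes "q \<noteq> accept M" "q \<noteq> reject M"
  shows "step M (q, ts) = (fst (delta M q (map read ts)), map2 apply_act (snd (delta M q (map read ts))) ts)"
  using assms by (auto simp: step_def apply_act_def split: prod.splits)

lemma delta_wf:
  assumes "q \<in> states M" "q \<noteq> accept M" "q \<noteq> reject M" "set xs \<subseteq> symbols M" "length xs = tapes M"
  shows "fst (delta M q xs) \<in> states M" "length (snd (delta M q xs)) = tapes M"
    "\<And>a. a \<in> set (snd (delta M q xs)) \<Longrightarrow> fst a \<in> symbols M"
proof -
  have "xs \<in> lists (symbols M)" using assms(4) by auto
  then have "fst (delta M q xs) \<in> states M \<and> length (snd (delta M q xs)) = tapes M \<and>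
      fst ` set (snd (delta M q xs)) \<subseteq> symbols M"
    using wf_M assms unfolding wf_tm_def by simp
  then show "fst (delta M q xs) \<in> states M" "length (snd (delta M q xs)) = tapes M"
    "\<And>a. a \<in> set (snd (delta M q xs)) \<Longrightarrow> fst a \<in> symbols M" by auto
qed

lemma reads_wf: "valid_config (q, ts) \<Longrightarrow> set (map read ts) \<subseteq> symbols M"
  using read_symbol by (auto simp: valid_config_def)

lemma valid_step: "valid_config c \<Longrightarrow> valid_config (step M c)"
proof -
  assume c: "valid_config c"
  obtain q ts where qts: "c = (q, ts)" by fastforce
  show ?thesis
  proof (cases "q = accept M \<or> q = reject M")
    case True
    then show ?thesis using c halting_config[of c M] by (simp add: qts)
  next
    case False
    have len: "length ts = tapes M" and q: "q \<in> states M" using c by (auto simp: valid_config_def qts)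
    note d = delta_wf[OF q _ _ reads_wf[OF c[unfolded qts]]]
    have "set (fst t) \<subseteq> symbols M \<and> set (snd t) \<subseteq> symbols M"
      if "t \<in> set (map2 apply_act (snd (delta M q (map read ts))) ts)" for t
    proof -
      obtain a u where t: "t = apply_act a u" "(a, u) \<in> set (zip (snd (delta M q (map read ts))) ts)"
        using \<open>t \<in> _\<close> by (metis (no_types, lifting) case_prod_conv image_iff list.set_map surj_pair)
      have "a \<in> set (snd (delta M q (map read ts)))" "u \<in> set ts"
        using t(2) by (rule set_zip_leftD, rule set_zip_rightD)
      then show ?thesis
        using apply_act_symbols[of "fst u" "snd u" a] d(3) False len c
        by (simp add: valid_config_def qts t)
    qed
    moreover have "step M c = (fst (delta M q (map read ts)), map2 apply_act (snd (delta M q (map read ts))) ts)"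
      using False by (simp add: qts step_unfold)
    ultimately show ?thesis
      using d(1,2) False len unfolding valid_config_def by simp
  qed
qed

lemma valid_init: "valid_config (init M w)"
  using wf_M by (auto simp: valid_config_def init_def wf_tm_def split: if_splits)

lemma valid_run: "valid_config ((step M ^^ i) (init M w))"
  by (induction i) (auto simp: valid_init valid_step)

lemma length_step:
  assumes "\<And>t. t \<in> set (snd c) \<Longrightarrow> length (fst t) \<le> B \<and> length (snd t) \<le> B"
    and "t \<in> set (snd (step M c))"
  shows "length (fst t) \<le> B + 2 \<and> length (snd t) \<le> B + 2"
proof -
  obtain q ts where qts: "c = (q, ts)" by fastforce
  show ?thesis
  proof (cases "q = accept M \<or> q = reject M")
    case True
    then show ?thesis using assms halting_config[of c M] by (fastforce simp: qts)
  next
    case False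
    then obtain a u where t: "t = apply_act a u" "u \<in> set ts"
      using assms(2) by (auto simp: qts step_unfold dest: set_zip_rightD)
    have "length (case peek (fst u) of None \<Rightarrow> [] | Some z \<Rightarrow> [z]) \<le> 1"
      by (auto split: option.splits)
    from length_new_left[OF this, of a] length_new_right[of a "peek (fst u)"]
    have "length (fst t) \<le> 2 + length (fst u)" "length (snd t) \<le> 2 + length (snd u)"
      using apply_act_stacks[of a "fst u" "snd u"] by (auto simp: t)
    then show ?thesis using assms(1)[of u] t(2) by (simp add: qts)
  qed
qed

lemma length_run:
  "t \<in> set (snd ((step M ^^ i) (init M w))) \<Longrightarrow>
    length (fst t) \<le> length w + 2 * i \<and> length (snd t) \<le> length w + 2 * i"
proof (induction i arbitrary: t)
  case 0
  then show ?case by (auto simp: init_def split: if_splits)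
next
  case (Suc i)
  from length_step[OF Suc.IH, of "(step M ^^ i) (init M w)"] Suc.prems show ?case by simp
qed

section \<open>Halting time and verdict of the given machine\<close>

definition halts_at :: "'a list \<Rightarrow> nat \<Rightarrow> bool" where
  "halts_at w i \<longleftrightarrow> fst ((step M ^^ i) (init M w)) \<in> {accept M, reject M}"

text \<open>The simulation keeps no clock: it stops when a halting state appears. The polynomial
  \<open>p\<close> serves only to bound the number of passes.\<close>

definition run_length :: "'a list \<Rightarrow> nat" where
  "run_length w = (LEAST i. halts_at w i)"

lemma halts_at_bound: "halts_at w (poly p (length w))"
  using decides by (auto simp: decides_in_def halts_at_def)

lemma run_length_le: "run_length w \<le> poly p (length w)"
  unfolding run_length_def 
    by (rule Least_le[where P = "halts_at w", OF halts_at_bound])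

lemma halts_at_run_length: "halts_at w (run_length w)"
  unfolding run_length_def 
    by (rule LeastI[where P = "halts_at w", OF halts_at_bound])

lemma not_halts_before: "i < run_length w \<Longrightarrow> \<not> halts_at w i"
  unfolding run_length_def by (rule not_less_Least)

lemma run_result:
  "fst ((step M ^^ run_length w) (init M w)) = (if w \<in> L then accept M else reject M)"
proof -
  obtain k where "poly p (length w) = k + run_length w"
    using run_length_le le_Suc_ex by (metis add.commute)
  then have "(step M ^^ poly p (length w)) (init M w) = (step M ^^ run_length w) (init M w)"
    using halted[of "(step M ^^ run_length w) (init M w)" M k] halts_at_run_length[of w]
    by (auto simp: funpow_add halts_at_def)
  then show ?thesis using decides[unfolded decides_in_def, rule_format, of w] by simp
qed

section \<open>One step of the given machine as one action\<close>

definition load :: "'a stacks \<Rightarrow> 'a config \<Rightarrow> 'a stacks" where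
  "load \<sigma> c = (\<lambda>r.
     if r = 13 then [Aux (fst c)]
     else if 16 \<le> r \<and> r < 16 + 2 * tapes M then
       (if even r then fst (snd c ! ((r - 16) div 2)) else snd (snd c ! ((r - 16) div 2)))
     else \<sigma> r)"

definition cur_state :: "'a tops \<Rightarrow> nat" where
  "cur_state tp = (case tp 13 of Some (Aux q) \<Rightarrow> q | _ \<Rightarrow> 0)"

definition cur_reads :: "'a tops \<Rightarrow> 'a cell list" where
  "cur_reads tp = map (\<lambda>j. case tp (17 + 2 * j) of None \<Rightarrow> Blank | Some z \<Rightarrow> z) [0..<tapes M]"

text \<open>The guard is there for \<open>wf_cmd\<close>, which considers all tops over the
  alphabet. Where the transition function of \<open>M\<close> is unconstrained, everything is left
  as it is; this also makes the default value 0 of \<open>cur_state\<close> harmless.\<close>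

definition sim_act :: "'a tops \<Rightarrow> nat \<Rightarrow> 'a cell list" where
  "sim_act tp r =
     (if cur_state tp \<in> states M - {accept M, reject M} \<and> set (cur_reads tp) \<subseteq> symbols M then
        (case delta M (cur_state tp) (cur_reads tp) of (q, as) \<Rightarrow>
           if r = 13 then [Aux q]
           else if 16 \<le> r \<and> r < 16 + 2 * tapes M then
             (if even r then new_left (as ! ((r - 16) div 2)) (keep tp r)
              else new_right (as ! ((r - 16) div 2)) (tp (r - 1)))
           else keep tp r)
      else keep tp r)"

lemma load_regs:
  fixes j :: nat
  shows
  "load \<sigma> c 13 = [Aux (fst c)]"
  "j < tapes M \<Longrightarrow> load \<sigma> c (16 + 2 * j) = fst (snd c ! j)"
  "j < tapes M \<Longrightarrow> load \<sigma> c (17 + 2 * j) = snd (snd c ! j)"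
  by (auto simp: load_def)

lemma length_sim_act: "length (sim_act tp r) \<le> 2"
  using length_keep[of tp r]
  by (simp add: sim_act_def length_new_left length_new_right split: prod.splits)

lemma tape_register_cases:
  fixes r k :: nat
  assumes "16 \<le> r" "r < 16 + 2 * k"
  obtains j where "j < k" "r = 16 + 2 * j" | j where "j < k" "r = 17 + 2 * j"
proof (cases "even r")
  case True
  have "(r - 16) div 2 < k" "r = 16 + 2 * ((r - 16) div 2)" using assms True by presburger+
  then show ?thesis using that(1) by blast
next
  case False
  have "(r - 16) div 2 < k" "r = 17 + 2 * ((r - 16) div 2)" using assms False by presburger+
  then show ?thesis using that(2) by blast
qed

lemma exec_sim_act:
  assumes valid: "valid_config c" and "fst c \<noteq> accept M" "fst c \<noteq> reject M"
  shows "exec (Act sim_act) (load \<sigma> c) 2 (load \<sigma> (step M c))"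
proof -
  obtain q ts where c: "c = (q, ts)" by fastforce
  have len: "length ts = tapes M" and q: "q \<in> states M" "q \<noteq> accept M" "q \<noteq> reject M"
    using assms by (auto simp: valid_config_def c)
  let ?tp = "tops_of (load \<sigma> c)"
  have state: "cur_state ?tp = q" by (simp add: cur_state_def load_regs c)
  have reads: "cur_reads ?tp = map read ts"
    unfolding cur_reads_def by (rule nth_equalityI) (simp_all add: load_regs c len read_peek)
  obtain q' as where d: "delta M q (map read ts) = (q', as)" by fastforce
  have symb: "set (map read ts) \<subseteq> symbols M" using reads_wf valid by (simp add: c)
  have las: "length as = tapes M"
    using delta_wf(2)[OF q symb] len by (simp add: d)
  have st: "step M c = (q', map2 apply_act as ts)" using q by (simp add: c step_unfold d)
  have sim: "sim_act ?tp r =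
      (if r = 13 then [Aux q'] else if 16 \<le> r \<and> r < 16 + 2 * tapes M then
         (if even r then new_left (as ! ((r - 16) div 2)) (keep ?tp r)
          else new_right (as ! ((r - 16) div 2)) (?tp (r - 1)))
       else keep ?tp r)" for r
    using q symb unfolding sim_act_def state reads d by simp
  have "act sim_act (load \<sigma> c) r = load \<sigma> (step M c) r" for r
  proof -
    consider "r = 13" | "r \<noteq> 13" "16 \<le> r" "r < 16 + 2 * tapes M"
      | "r \<noteq> 13" "\<not> (16 \<le> r \<and> r < 16 + 2 * tapes M)" by linarith
    then show ?thesis
    proof cases
      case 1
      then show ?thesis by (simp add: act_def sim load_regs st)
    next
      case 2
      from 2(2,3) show ?thesis
      proof (cases rule: tape_register_cases)
        case (1 j)
        have "even (16 + 2 * j)" "(16 + 2 * j - 16) div 2 = j" by presburger+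
        then have "sim_act ?tp r = new_left (as ! j) (keep ?tp r)"
          using sim[of r] 1 2 by (simp del: even_add even_mult_iff)
        moreover have "load \<sigma> (step M c) r = fst (apply_act (as ! j) (ts ! j))"
          unfolding 1 load_regs(2)[OF 1(1)] by (simp add: st 1 las len)
        moreover have "load \<sigma> c r = fst (ts ! j)" unfolding 1 load_regs(2)[OF 1(1)] by (simp add: c)
        ultimately show ?thesis
          using apply_act_stacks[of "as ! j" "fst (ts ! j)" "snd (ts ! j)"]
          by (simp add: act_def keep_def)
      next
        case (2 j)
        have o: "odd (17 + 2 * j)" "(17 + 2 * j - 16) div 2 = j" "17 + 2 * j - 1 = 16 + 2 * j"
          by presburger+
        have "sim_act ?tp r = new_right (as ! j) (?tp (16 + 2 * j))"
          using sim[of r] 2 o \<open>16 \<le> r\<close> \<open>r < 16 + 2 * tapes M\<close> \<open>r \<noteq> 13\<close>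
          by (simp del: even_add even_mult_iff tops_of_apply)
        moreover have "load \<sigma> (step M c) r = snd (apply_act (as ! j) (ts ! j))"
          unfolding 2 load_regs(3)[OF 2(1)] by (simp add: st 2 las len)
        moreover have "load \<sigma> c r = snd (ts ! j)" unfolding 2 load_regs(3)[OF 2(1)] by (simp add: c)
        moreover have "?tp (16 + 2 * j) = peek (fst (ts ! j))"
          using load_regs(2)[OF 2(1), of \<sigma> c] by (simp add: c)
        ultimately show ?thesis
          using apply_act_stacks[of "as ! j" "fst (ts ! j)" "snd (ts ! j)"]
          by (simp add: act_def del: tops_of_apply)
      qed
    next
      case 3
      then have "sim_act ?tp r = keep ?tp r" unfolding sim by auto
      then show ?thesis using 3 by (simp add: act_def) (auto simp: load_def)
    qed
  qed
  then have "act sim_act (load \<sigma> c) = load \<sigma> (step M c)" by blast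
  then show ?thesis using exec.Act[of sim_act "load \<sigma> c"] length_sim_act by metis
qed

text \<open>Register 17 is the right half of tape 0, so a caller only has to write the query there.
  All simulated tapes are emptied afterwards, which makes repeated calls possible; acceptance leaves
  one \<open>Blank\<close> on register 12.\<close>

definition run_M :: "'a cmd" where
  "run_M = Seq (push 13 (Aux (start M)))
     (Seq (Loop (\<lambda>tp. tp 13 \<notin> {Some (Aux (accept M)), Some (Aux (reject M))}) (Act sim_act))
     (Seq (Cond (\<lambda>tp. tp 13 = Some (Aux (accept M))) (push 12 Blank) nop)
     (seqs (map clear (13 # [16..<16 + 2 * tapes M])))))"

lemma ptime_sim_loop:
  "ptime (Loop (\<lambda>tp. tp 13 \<notin> {Some (Aux (accept M)), Some (Aux (reject M))}) (Act sim_act)) X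
    (\<lambda>x. load (s x) (init M (w x)))
    (\<lambda>x. load (s x) ((step M ^^ run_length (w x)) (init M (w x))))"
proof -
  let ?A = "\<lambda>x i. load (s x) ((step M ^^ i) (init M (w x)))"
  have T: "tapes M > 0" using wf_M by (simp add: wf_tm_def)
  \<comment> \<open>Register 17 initially holds the whole input of the simulated machine, so a bound
    on the registers bounds this input and thereby the number of passes.\<close>
  have w_le: "length (w x) \<le> N" if "\<And>r. length (?A x 0 r) \<le> N" for x N
  proof -
    have "?A x 0 17 = map Input (w x)"
      using load_regs(3)[OF T, of "s x" "init M (w x)"] by (simp add: init_def)
    then show ?thesis using that[of 17] by simp
  qed
  have "ptime (Loop (\<lambda>tp. tp 13 \<notin> {Some (Aux (accept M)), Some (Aux (reject M))}) (Act sim_act)) X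
    (\<lambda>x. ?A x 0) (\<lambda>x. ?A x (run_length (w x)))"
  \<comment> \<open>After \<open>i\<close> steps each half of a tape has length at most
    \<open>length w + 2 * i\<close>, by \<open>length_run\<close>; the constant 1 covers the single
    symbol in the state register.\<close>
  proof (rule ptime_Loop[where q = p and q' = "[:1, 1:] + 2 * p"])
    show "ptime (Act sim_act) (\<lambda>(x, i). X x \<and> i < run_length (w x)) (\<lambda>(x, i). ?A x i)
        (\<lambda>(x, i). ?A x (Suc i))"
    proof (rule ptime_const[where d = 2], clarify)
      fix x i
      assume "i < run_length (w x)"
      then have "\<not> halts_at (w x) i" by (rule not_halts_before)
      then show "exec (Act sim_act) (?A x i) 2 (?A x (Suc i))"
        using exec_sim_act[OF valid_run, of i "w x" "s x"] by (simp add: halts_at_def)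
    qed
  next
    fix x i
    assume "i < run_length (w x)"
    then have "\<not> halts_at (w x) i" by (rule not_halts_before)
    then show "tops_of (?A x i) 13 \<notin> {Some (Aux (accept M)), Some (Aux (reject M))}"
      by (simp add: load_regs halts_at_def)
  next
    fix x
    show "\<not> tops_of (?A x (run_length (w x))) 13 \<notin> {Some (Aux (accept M)), Some (Aux (reject M))}"
      using halts_at_run_length[of "w x"] by (auto simp: load_regs halts_at_def)
  next
    fix x N
    assume "\<And>r. length (?A x 0 r) \<le> N"
    from poly_nat_mono[OF w_le[OF this], of p] show "run_length (w x) \<le> poly p N"
      using run_length_le[of "w x"] by linarith
  next
    fix x N i r
    assume N: "\<And>r. length (?A x 0 r) \<le> N" and i: "i < run_length (w x)"
    have w: "length (w x) \<le> N" by (rule w_le[OF N])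
    have i': "i \<le> poly p N"
      using poly_nat_mono[OF w, of p] run_length_le[of "w x"] i by linarith
    let ?c = "(step M ^^ i) (init M (w x))"
    have len: "length (snd ?c) = tapes M" using valid_run by (simp add: valid_config_def)
    have "length (?A x i r) \<le> 1 + N + 2 * poly p N"
    proof (cases "16 \<le> r \<and> r < 16 + 2 * tapes M")
      case True
      then have "(r - 16) div 2 < tapes M" by auto
      then have "snd ?c ! ((r - 16) div 2) \<in> set (snd ?c)" using len by simp
      from length_run[OF this] w i' True show ?thesis by (auto simp: load_def)
    next
      case False
      then have "r \<noteq> 13 \<Longrightarrow> ?A x i r = ?A x 0 r" by (auto simp: load_def)
      then show ?thesis using N[of r] by (cases "r = 13") (auto simp: load_regs)
    qed
    then show "length (?A x i r) \<le> poly ([:1, 1:] + 2 * p) N" by simp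
  qed
  then show ?thesis by simp
qed

lemma ptime_run_M:
  assumes "\<And>x. X x \<Longrightarrow> s x 13 = [] \<and> s x 17 = map Input (w x) \<and>
    (\<forall>r. 16 \<le> r \<longrightarrow> r \<noteq> 17 \<longrightarrow> s x r = [])"
  shows "ptime run_M X s (\<lambda>x. (s x)(17 := [], 12 := (if w x \<in> L then [Blank] else []) @ s x 12))"
proof -
  let ?c = "\<lambda>x. (step M ^^ run_length (w x)) (init M (w x))"
  have T: "tapes M > 0" using wf_M by (simp add: wf_tm_def)
  have acc: "accept M \<noteq> reject M" using wf_M by (simp add: wf_tm_def)
  have load: "(s x)(13 := Aux (start M) # s x 13) = load (s x) (init M (w x))" if "X x" for x
  proof
    fix r
    consider "r < 16 \<or> 16 + 2 * tapes M \<le> r" | "16 \<le> r \<and> r < 16 + 2 * tapes M" by linarith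
    then show "((s x)(13 := Aux (start M) # s x 13)) r = load (s x) (init M (w x)) r"
    proof cases
      case 1
      then show ?thesis using assms[OF that] by (auto simp: load_def init_def)
    next
      case 2
      then have "(r - 16) div 2 < tapes M" by auto
      moreover have "odd r \<Longrightarrow> (r - 16) div 2 = 0 \<longleftrightarrow> r = 17" using 2 by presburger
      ultimately show ?thesis
        using assms[OF that] 2 by (auto simp: load_def init_def nth_Cons')
    qed
  qed
  have l12: "load (s x) c 12 = s x 12" for x c by (simp add: load_def)
  show ?thesis
    unfolding run_M_def
  proof (rule ptime_post, rule ptime_Seq)
    show "ptime (push 13 (Aux (start M))) X s (\<lambda>x. load (s x) (init M (w x)))"
      by (rule ptime_post[OF ptime_push load])
    show "ptime (Seq (Loop (\<lambda>tp. tp 13 \<notin> {Some (Aux (accept M)), Some (Aux (reject M))}) (Act sim_act))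
     (Seq (Cond (\<lambda>tp. tp 13 = Some (Aux (accept M))) (push 12 Blank) nop)
       (seqs (map clear (13 # [16..<16 + 2 * tapes M]))))) X (\<lambda>x. load (s x) (init M (w x)))
       (\<lambda>x r. if r \<in> set (13 # [16..<16 + 2 * tapes M]) then [] else
         (if tops_of (load (s x) (?c x)) 13 = Some (Aux (accept M))
          then (load (s x) (?c x))(12 := Blank # load (s x) (?c x) 12) else load (s x) (?c x)) r)"
      by (rule ptime_Seq[OF ptime_sim_loop] ptime_Seq[OF ptime_Cond] ptime_seqs_clear ptime_push
          ptime_nop)+
  next
    fix x
    assume "X x"
    show "(\<lambda>r. if r \<in> set (13 # [16..<16 + 2 * tapes M]) then [] else
         (if tops_of (load (s x) (?c x)) 13 = Some (Aux (accept M))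
          then (load (s x) (?c x))(12 := Blank # load (s x) (?c x) 12) else load (s x) (?c x)) r) =
       (s x)(17 := [], 12 := (if w x \<in> L then [Blank] else []) @ s x 12)"
    proof
      fix r
      have tp: "tops_of (load (s x) (?c x)) 13 = Some (Aux (accept M)) \<longleftrightarrow> w x \<in> L"
        using run_result[of "w x"] acc by (simp add: load_regs)
      consider "r = 12" | "r = 13" | "16 \<le> r" "r < 16 + 2 * tapes M" | "16 + 2 * tapes M \<le> r"
        | "r < 16" "r \<noteq> 12" "r \<noteq> 13" by linarith
      then show "(if r \<in> set (13 # [16..<16 + 2 * tapes M]) then [] else
         (if tops_of (load (s x) (?c x)) 13 = Some (Aux (accept M))
          then (load (s x) (?c x))(12 := Blank # load (s x) (?c x) 12) else load (s x) (?c x)) r) =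
       ((s x)(17 := [], 12 := (if w x \<in> L then [Blank] else []) @ s x 12)) r"
        unfolding tp using assms[OF \<open>X x\<close>] T
        by cases (auto simp: l12, auto simp: load_def)
    qed
  qed
qed

lemma wf_run_M:
  assumes "symbols M \<subseteq> \<Gamma>" "Aux ` states M \<subseteq> \<Gamma>" "16 + 2 * tapes M \<le> N"
  shows "wf_cmd N \<Gamma> run_M"
proof -
  have "wf_cmd N \<Gamma> (Act sim_act)"
    unfolding wf_cmd.simps
  proof (intro allI impI conjI)
    fix tp :: "'a tops" and r
    assume tp: "wf_tops N \<Gamma> tp"
    have "Blank \<in> \<Gamma>" using Blank_symbol assms(1) by blast
    show "set (sim_act tp r) \<subseteq> \<Gamma>"
    proof (cases "cur_state tp \<in> states M - {accept M, reject M} \<and> set (cur_reads tp) \<subseteq> symbols M")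
      case True
      obtain q as where d: "delta M (cur_state tp) (cur_reads tp) = (q, as)" by fastforce
      have "length (cur_reads tp) = tapes M" by (simp add: cur_reads_def)
      with True have q: "q \<in> states M" and las: "length as = tapes M"
        and as: "\<And>a. a \<in> set as \<Longrightarrow> fst a \<in> symbols M"
        using delta_wf[of "cur_state tp" "cur_reads tp"] by (auto simp: d)
      have a: "fst (as ! ((r - 16) div 2)) \<in> \<Gamma>" if "16 \<le> r" "r < 16 + 2 * tapes M"
        using as[of "as ! ((r - 16) div 2)"] las assms(1) that by auto
      have "set (new_left a (keep tp r)) \<subseteq> \<Gamma>" "set (new_right a (tp (r - 1))) \<subseteq> \<Gamma>"
        if "fst a \<in> \<Gamma>" for a
        using that \<open>Blank \<in> \<Gamma>\<close> keep_wf(1)[OF tp, of r] tp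
        by (auto simp: new_left_def new_right_def wf_tops_def split: dir.splits option.splits)
      then show ?thesis
        using a True d q assms(2) keep_wf(1)[OF tp, of r] by (auto simp: sim_act_def)
    next
      case False
      then have "sim_act tp r = keep tp r" by (auto simp: sim_act_def)
      then show ?thesis using keep_wf(1)[OF tp] by simp
    qed
  next
    fix tp :: "'a tops" and r
    assume "wf_tops N \<Gamma> tp" "N \<le> r"
    then show "sim_act tp r = []"
      using keep_wf(2) assms(3) by (auto simp: sim_act_def split: prod.splits)
  qed
  moreover have "start M \<in> states M" using wf_M by (simp add: wf_tm_def)
  ultimately show ?thesis
    using assms Blank_symbol unfolding run_M_def
    by (auto simp: simp del: list.map intro!: wf_seqs wf_clear wf_nop wf_push)
qed

end

section \<open>The decision procedure\<close>

abbreviation emb :: "symbol list \<Rightarrow> symbol cell list" where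
  "emb \<equiv> map Input"

lemma peek_map [simp]: "peek (map f xs) = map_option f (peek xs)"
  by (cases xs) auto

lemma peek_None [simp]: "peek xs = None \<longleftrightarrow> xs = []"
  by (cases xs) auto

lemma enc_vote_Nil [simp]: "enc_vote [] = []"
  by (simp add: enc_vote_def)

lemma enc_vote_Cons [simp]: "enc_vote (c # v) = enc_cand c @ Comma # enc_vote v"
  by (simp add: enc_vote_def)

lemma enc_vote_append [simp]: "enc_vote (u @ v) = enc_vote u @ enc_vote v"
  by (simp add: enc_vote_def)

lemma enc_cand_Suc: "enc_cand (Suc c) = Tally # enc_cand c"
  by (simp add: enc_cand_def)

lemma length_le_length_enc_vote: "length v \<le> length (enc_vote v)"
  by (induction v) auto

text \<open>
  The weights \<open>ry\<close> are given in reverse, so that a weight starts at a symbol which is followed by a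
  semicolon or by nothing.
\<close>

primrec insert_votes :: "symbol list \<Rightarrow> symbol list \<Rightarrow> nat \<Rightarrow> symbol list" where
  "insert_votes v ry 0 = []"
| "insert_votes v ry (Suc i) =
     (if peek (drop (Suc i) ry) \<in> {None, Some Semicolon} then v @ [Colon] else []) @
     ry ! i # insert_votes v ry i"

lemma length_insert_votes: "length (insert_votes v ry i) \<le> i * (length v + 2)"
  by (induction i) auto

definition query_word ::
  "symbol list \<Rightarrow> symbol list \<Rightarrow> symbol list \<Rightarrow> symbol list \<Rightarrow> symbol list \<Rightarrow> symbol list" where
  "query_word tm c xs ry v = tm @ Bar # c @ Bar # xs @ insert_votes v ry (length ry)"

text \<open>
  Registers: 0 input, 1 hits, 2 number of candidates, 3 candidate \<open>h\<close>, 4 given votes, 5 reversed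
  weights, 6 candidates still to be tried, 7 candidates tried before, 8 current candidate, 9 scratch,
  10 errors, 11 candidate of the query, 12 verdict, 14 and 15 scratch, 13 and from 16 on the simulated machine.
\<close>

definition add_vote :: "symbol cmd" where
  "add_vote = Seq (push 17 (Input Comma)) (Seq (copy 3 17) (Seq (copy 6 17) (Seq (copy 7 17)
     (Seq (push 17 (Input Comma)) (copy 8 17)))))"

definition add_votes :: "symbol cmd" where
  "add_votes = Loop (\<lambda>tp. tp 15 \<noteq> None)
     (Seq (shift 15 17)
       (Cond (\<lambda>tp. tp 15 \<in> {None, Some (Input Semicolon)})
         (Seq (push 17 (Input Colon)) add_vote) nop))"

text \<open>The vote is pushed from its end to its beginning, so it reads: current candidate, those
  tried before, those still to be tried, and \<open>h\<close> last. Registers 6 and 7 hold lists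
  whose entries carry their commas, whereas 8 and 3 hold bare candidates; hence the two explicit
  commas.\<close>

lemma ptime_add_vote:
  assumes "\<And>x. X x \<Longrightarrow> s x 9 = []"
  shows "ptime add_vote X s
    (\<lambda>x. (s x)(17 := s x 8 @ Input Comma # s x 7 @ s x 6 @ s x 3 @ Input Comma # s x 17))"
  unfolding add_vote_def
  by (rule ptime_post, (rule ptime_Seq ptime_push ptime_copy | simp add: assms)+)

lemma ptime_add_votes:
  assumes pre: "\<And>x. X x \<Longrightarrow> s x 9 = [] \<and> s x 17 = [] \<and> s x 15 = emb (ry x) \<and>
    s x 8 @ Input Comma # s x 7 @ s x 6 @ s x 3 @ [Input Comma] = emb (v x)"
  shows "ptime add_votes X s
    (\<lambda>x. (s x)(15 := [], 17 := emb (insert_votes (v x) (ry x) (length (ry x)))))"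
proof -
  let ?A = "\<lambda>x i. (s x)(15 := emb (drop i (ry x)), 17 := emb (insert_votes (v x) (ry x) i))"
  have A0: "?A x 0 = s x" if "X x" for x
    using pre[OF that] by (auto simp: fun_eq_iff)
  have "ptime add_votes X (\<lambda>x. ?A x 0) (\<lambda>x. ?A x (length (ry x)))"
    unfolding add_votes_def
  \<comment> \<open>The vote is composed of four registers and two commas, so a pass adds at most
    \<open>4 * N + 4\<close> symbols. At most \<open>N\<close> passes, together with the unread
    weights, give \<open>N + N * (4 * N + 4)\<close>.\<close>
  proof (rule ptime_Loop[where q = "[:0, 1:]" and q' = "[:0, 5, 4:]"])
    let ?Y = "\<lambda>(x, i). X x \<and> i < length (ry x)"
    let ?B = "\<lambda>(x, i). (s x)(15 := emb (drop (Suc i) (ry x)),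
      17 := Input (ry x ! i) # emb (insert_votes (v x) (ry x) i))"
    have 1: "ptime (shift 15 17) ?Y (\<lambda>(x, i). ?A x i) ?B"
    proof (rule ptime_post[OF ptime_shift[where z = "\<lambda>(x, i). Input (ry x ! i)"
          and xs = "\<lambda>(x, i). emb (drop (Suc i) (ry x))"]])
      fix y :: "'a \<times> nat"
      assume "?Y y"
      then show "(case y of (x, i) \<Rightarrow> ?A x i) 15 =
          (case y of (x, i) \<Rightarrow> Input (ry x ! i)) # (case y of (x, i) \<Rightarrow> emb (drop (Suc i) (ry x)))"
        by (auto simp: Cons_nth_drop_Suc[symmetric] split: prod.splits)
    qed (auto simp: fun_eq_iff split: prod.splits)
    have 2: "ptime (Seq (push 17 (Input Colon)) add_vote) (\<lambda>y. ?Y y \<and> P y) ?B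
        (\<lambda>(x, i). (?B (x, i))(17 := emb (v x @ Colon # ry x ! i # insert_votes (v x) (ry x) i)))"
      for P
    proof (rule ptime_post[OF ptime_Seq[OF ptime_push ptime_add_vote]])
      fix y :: "'a \<times> nat"
      obtain x i where y: "y = (x, i)" by fastforce
      assume "?Y y \<and> P y"
      then have x: "X x" by (simp add: y)
      note v = pre[OF x, THEN conjunct2, THEN conjunct2, THEN conjunct2, symmetric]
      show "((?B y)(17 := Input Colon # ?B y 17)) 9 = []" using pre[OF x] by (simp add: y)
      show "((?B y)(17 := Input Colon # ?B y 17))
         (17 := ((?B y)(17 := Input Colon # ?B y 17)) 8 @ Input Comma #
           ((?B y)(17 := Input Colon # ?B y 17)) 7 @ ((?B y)(17 := Input Colon # ?B y 17)) 6 @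
           ((?B y)(17 := Input Colon # ?B y 17)) 3 @ Input Comma #
           ((?B y)(17 := Input Colon # ?B y 17)) 17) =
        (case y of (x, i) \<Rightarrow>
          (?B (x, i))(17 := emb (v x @ Colon # ry x ! i # insert_votes (v x) (ry x) i)))"
        using v by (auto simp: y)
    qed
    show "ptime (Seq (shift 15 17) (Cond (\<lambda>tp. tp 15 \<in> {None, Some (Input Semicolon)})
        (Seq (push 17 (Input Colon)) add_vote) nop)) ?Y (\<lambda>(x, i). ?A x i) (\<lambda>(x, i). ?A x (Suc i))"
    proof (rule ptime_post[OF ptime_Seq[OF 1 ptime_Cond[OF 2 ptime_nop]]])
      fix y :: "'a \<times> nat"
      obtain x i where y: "y = (x, i)" by fastforce
      show "(if tops_of (?B y) 15 \<in> {None, Some (Input Semicolon)}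
         then case y of (x, i) \<Rightarrow>
           (?B (x, i))(17 := emb (v x @ Colon # ry x ! i # insert_votes (v x) (ry x) i))
         else ?B y) = (case y of (x, i) \<Rightarrow> ?A x (Suc i))"
        by (auto simp: y)
    qed
  next
    fix x i
    assume "X x" "i < length (ry x)"
    then show "tops_of (?A x i) 15 \<noteq> None" by simp
  next
    fix x
    show "\<not> tops_of (?A x (length (ry x))) 15 \<noteq> None" by simp
  next
    fix x N
    assume "\<And>r. length (?A x 0 r) \<le> N"
    from this[of 15] show "length (ry x) \<le> poly [:0, 1:] N" by simp
  next
    fix x N i r
    assume x: "X x" and N: "\<And>r. length (?A x 0 r) \<le> N" and i: "i < length (ry x)"
    have s: "length (s x r) \<le> N" for r using N[of r] unfolding A0[OF x] .
    have ry: "length (ry x) \<le> N" using N[of 15] by simp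
    have "length (emb (v x)) \<le> 4 * N + 2"
      unfolding pre[OF x, THEN conjunct2, THEN conjunct2, THEN conjunct2, symmetric]
      using s[of 8] s[of 7] s[of 6] s[of 3] by simp
    then have v: "length (v x) + 2 \<le> 4 * N + 4" by simp
    have "length (insert_votes (v x) (ry x) i) \<le> N * (4 * N + 4)"
      using length_insert_votes[of "v x" "ry x" i] mult_le_mono[of i N, OF _ v] i ry by linarith
    moreover have "length (ry x) - i \<le> N + N * (4 * N + 4)"
      by (rule trans_le_add1) (use ry in simp)
    ultimately have "length (?A x i r) \<le> N + N * (4 * N + 4)"
      using s[of r] by simp
    then show "length (?A x i r) \<le> poly [:0, 5, 4:] N" by (simp add: algebra_simps)
  qed
  then show ?thesis
    by (rule ptime_cong) (simp_all only: A0, simp)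
qed

text \<open>Monotonicity only sees which candidates lie below a given one, so the order between the
  first and the last place may follow the stacks: candidates tried before have been piled up in
  reverse.\<close>

definition trial_vote :: "nat list \<Rightarrow> nat \<Rightarrow> nat \<Rightarrow> vote" where
  "trial_vote us h i = us ! i # rev (take i us) @ drop (Suc i) us @ [h]"

section \<open>Posing the two queries for every rival\<close>

locale query_decider = decider M L p
  for M :: "symbol tm" and L :: "symbol list set" and p :: "nat poly"
begin

text \<open>The word is written onto the input tape from right to left. Moving the reversed weights
  over one by one restores their order; they come from a copy in register 15, so register 5 remains
  for later queries.\<close>

definition query :: "symbol cmd" where
  "query = Seq (copy 5 15) (Seq add_votes (Seq (copy 4 17) (Seq (push 17 (Input Bar))
     (Seq (copy 11 17) (Seq (push 17 (Input Bar)) (Seq (copy 2 17) run_M))))))"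

definition ready :: "symbol stacks \<Rightarrow> bool" where
  "ready \<sigma> \<longleftrightarrow> \<sigma> 9 = [] \<and> \<sigma> 13 = [] \<and> \<sigma> 15 = [] \<and> (\<forall>r \<ge> 16. \<sigma> r = [])"

lemma ptime_query:
  assumes pre: "\<And>x. X x \<Longrightarrow> ready (s x) \<and> s x 2 = emb (tm x) \<and> s x 11 = emb (c x) \<and>
    s x 4 = emb (xs x) \<and> s x 5 = emb (ry x) \<and>
    s x 8 @ Input Comma # s x 7 @ s x 6 @ s x 3 @ [Input Comma] = emb (v x)"
  shows "ptime query X s (\<lambda>x. (s x)
    (12 := (if query_word (tm x) (c x) (xs x) (ry x) (v x) \<in> L then [Blank] else []) @ s x 12))"
proof -
  let ?s1 = "\<lambda>x. (s x)(15 := emb (ry x))"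
  let ?s2 = "\<lambda>x. (s x)(17 := emb (insert_votes (v x) (ry x) (length (ry x))))"
  let ?s3 = "\<lambda>x. (s x)(17 := emb (query_word (tm x) (c x) (xs x) (ry x) (v x)))"
  have nine: "s x 9 = []" if "X x" for x using pre[OF that] by (simp add: ready_def)
  have 1: "ptime (copy 5 15) X s ?s1"
    by (rule ptime_post[OF ptime_copy]) (use pre in \<open>auto simp: ready_def nine\<close>)
  have 2: "ptime add_votes X ?s1 ?s2"
    by (rule ptime_post[OF ptime_add_votes[where v = v and ry = ry]])
       (use pre in \<open>auto simp: ready_def fun_eq_iff\<close>)
  have 3: "ptime (Seq (copy 4 17) (Seq (push 17 (Input Bar)) (Seq (copy 11 17)
      (Seq (push 17 (Input Bar)) (Seq (copy 2 17) run_M))))) X ?s2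
     (\<lambda>x. (?s3 x)(17 := [],
       12 := (if query_word (tm x) (c x) (xs x) (ry x) (v x) \<in> L then [Blank] else []) @ ?s3 x 12))"
  proof (rule ptime_Seq)
    show "ptime (copy 4 17) X ?s2 (\<lambda>x. (?s2 x)(17 := ?s2 x 4 @ ?s2 x 17))"
      by (rule ptime_copy) (simp_all add: nine)
    let ?t = "\<lambda>x. (?s2 x)(17 := emb (Bar # c x @ Bar # xs x) @ ?s2 x 17)"
    have 4: "ptime (Seq (copy 2 17) run_M) X ?t (\<lambda>x. (?s3 x)(17 := [],
       12 := (if query_word (tm x) (c x) (xs x) (ry x) (v x) \<in> L then [Blank] else []) @ ?s3 x 12))"
    proof (rule ptime_Seq)
      show "ptime (copy 2 17) X ?t ?s3"
        by (rule ptime_post[OF ptime_copy]) (use pre in \<open>auto simp: ready_def query_word_def\<close>)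
      show "ptime run_M X ?s3 (\<lambda>x. (?s3 x)(17 := [],
       12 := (if query_word (tm x) (c x) (xs x) (ry x) (v x) \<in> L then [Blank] else []) @ ?s3 x 12))"
        by (rule ptime_run_M) (use pre in \<open>auto simp: ready_def\<close>)
    qed
    have 5: "ptime (push 17 (Input Bar)) X (\<lambda>x. (?s2 x)(17 := emb (c x @ Bar # xs x) @ ?s2 x 17)) ?t"
      by (rule ptime_post[OF ptime_push]) simp
    have 6: "ptime (copy 11 17) X (\<lambda>x. (?s2 x)(17 := emb (Bar # xs x) @ ?s2 x 17))
        (\<lambda>x. (?s2 x)(17 := emb (c x @ Bar # xs x) @ ?s2 x 17))"
      by (rule ptime_post[OF ptime_copy]) (use pre in \<open>auto simp: ready_def\<close>)
    have 7: "ptime (push 17 (Input Bar)) X (\<lambda>x. (?s2 x)(17 := ?s2 x 4 @ ?s2 x 17))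
        (\<lambda>x. (?s2 x)(17 := emb (Bar # xs x) @ ?s2 x 17))"
      by (rule ptime_post[OF ptime_push]) (use pre in auto)
    from ptime_Seq[OF 7 ptime_Seq[OF 6 ptime_Seq[OF 5 4]]]
    show "ptime (Seq (push 17 (Input Bar)) (Seq (copy 11 17)
      (Seq (push 17 (Input Bar)) (Seq (copy 2 17) run_M)))) X
     (\<lambda>x. (?s2 x)(17 := ?s2 x 4 @ ?s2 x 17)) (\<lambda>x. (?s3 x)(17 := [],
       12 := (if query_word (tm x) (c x) (xs x) (ry x) (v x) \<in> L then [Blank] else []) @ ?s3 x 12))" .
  qed
  show ?thesis
    unfolding query_def
    by (rule ptime_post[OF ptime_Seq[OF 1 ptime_Seq[OF 2 3]]])
       (use pre in \<open>auto simp: ready_def fun_eq_iff\<close>)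
qed

text \<open>Both queries are posed with the same vote, as registers 6, 7 and 8 stay fixed between
  them and only the named candidate in register 11 changes. The second is posed only after a
  positive first answer. The current candidate is added to register 7 at the very end.\<close>

definition round :: "symbol cmd" where
  "round = Seq (shift_while (\<lambda>z. z = Input Tally) 6 8) (Seq (pop 6) (Seq (copy 8 11) (Seq query
     (Seq (clear 11) (Seq
       (Cond (\<lambda>tp. tp 12 \<noteq> None)
         (Seq (clear 12) (Seq (copy 3 11) (Seq query (Seq (clear 11)
           (Seq (Cond (\<lambda>tp. tp 12 = None) (push 1 Blank) nop) (clear 12))))))
         nop)
       (Seq (push 7 (Input Comma)) (Seq (copy 8 7) (clear 8))))))))"

lemma takeWhile_cand: "takeWhile ((\<lambda>z. z = Input Tally) \<circ> Input) (enc_cand a @ Comma # ys) = enc_cand a"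
  "dropWhile ((\<lambda>z. z = Input Tally) \<circ> Input) (enc_cand a @ Comma # ys) = Comma # ys"
  by (induction a) (auto simp: enc_cand_def)

lemma ptime_round:
  assumes pre: "\<And>x. X x \<Longrightarrow> ready (s x) \<and> s x 2 = emb (tm x) \<and> s x 3 = emb (hh x) \<and>
    s x 4 = emb (xs x) \<and> s x 5 = emb (ry x) \<and> s x 6 = emb (enc_cand (a x) @ Comma # rest x) \<and>
    s x 7 = emb (pp x) \<and> s x 8 = [] \<and> s x 11 = [] \<and> s x 12 = []"
  defines "v \<equiv> \<lambda>x. enc_cand (a x) @ Comma # pp x @ rest x @ hh x @ [Comma]"
  defines "hit \<equiv> \<lambda>x. query_word (tm x) (enc_cand (a x)) (xs x) (ry x) (v x) \<in> L \<and>
    query_word (tm x) (hh x) (xs x) (ry x) (v x) \<notin> L"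
  shows "ptime round X s (\<lambda>x. (s x)(6 := emb (rest x), 7 := emb (enc_cand (a x) @ Comma # pp x),
    1 := (if hit x then [Blank] else []) @ s x 1))"
proof -
  let ?flag = "\<lambda>b. if b then [Blank :: symbol cell] else []"
  let ?q = "\<lambda>x c. query_word (tm x) c (xs x) (ry x) (v x) \<in> L"
  let ?u = "\<lambda>x. (s x)(6 := emb (rest x), 8 := emb (enc_cand (a x)))"
  let ?s4 = "\<lambda>x. (?u x)(11 := emb (enc_cand (a x)), 12 := ?flag (?q x (enc_cand (a x))))"
  let ?s5 = "\<lambda>x. (?u x)(12 := ?flag (?q x (enc_cand (a x))))"
  let ?s6 = "\<lambda>x. (?u x)(1 := ?flag (hit x) @ s x 1)"
  have u: "?u x 9 = []" "ready (?u x)" "ready ((?u x)(11 := l))" "?u x 11 = []" "?u x 12 = []"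
    "?u x 3 = emb (hh x)" if "X x" for x l
    using pre[OF that] by (simp_all add: ready_def)
  have 1: "ptime (shift_while (\<lambda>z. z = Input Tally) 6 8) X s
      (\<lambda>x. (s x)(6 := emb (Comma # rest x), 8 := emb (enc_cand (a x))))"
    by (rule ptime_post[OF ptime_shift_while])
       (simp_all add: pre takeWhile_map dropWhile_map takeWhile_cand del: map_append,
        simp add: enc_cand_def)
  have 2: "ptime (pop 6) X (\<lambda>x. (s x)(6 := emb (Comma # rest x), 8 := emb (enc_cand (a x)))) ?u"
    by (rule ptime_post[OF ptime_pop]) (simp add: fun_upd_twist)
  have 3: "ptime (copy 8 11) X ?u (\<lambda>x. (?u x)(11 := emb (enc_cand (a x))))"
    by (rule ptime_post[OF ptime_copy]) (use pre u in auto)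
  have 4: "ptime query X (\<lambda>x. (?u x)(11 := emb (enc_cand (a x)))) ?s4"
  proof (rule ptime_post[OF ptime_query[where tm = tm and c = "\<lambda>x. enc_cand (a x)" and xs = xs
        and ry = ry and v = v]])
  qed (use pre u in \<open>auto simp: v_def\<close>)
  have 5: "ptime (clear 11) X ?s4 ?s5"
    by (rule ptime_post[OF ptime_clear]) (use pre in \<open>auto simp: fun_eq_iff\<close>)
  have c1: "ptime (clear 12) (\<lambda>x. X x \<and> P x) ?s5 ?u" for P
    by (rule ptime_post[OF ptime_clear]) (use pre in \<open>auto simp: fun_eq_iff\<close>)
  have c2: "ptime (copy 3 11) (\<lambda>x. X x \<and> P x) ?u (\<lambda>x. (?u x)(11 := emb (hh x)))" for P
    by (rule ptime_post[OF ptime_copy]) (use pre u in auto)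
  have c3: "ptime query (\<lambda>x. X x \<and> P x) (\<lambda>x. (?u x)(11 := emb (hh x)))
      (\<lambda>x. (?u x)(11 := emb (hh x), 12 := ?flag (?q x (hh x))))" for P
  proof (rule ptime_post[OF ptime_query[where tm = tm and c = hh and xs = xs
        and ry = ry and v = v]])
  qed (use pre u in \<open>auto simp: v_def\<close>)
  have c4: "ptime (clear 11) (\<lambda>x. X x \<and> P x) (\<lambda>x. (?u x)(11 := emb (hh x), 12 := ?flag (?q x (hh x))))
      (\<lambda>x. (?u x)(12 := ?flag (?q x (hh x))))" for P
    by (rule ptime_post[OF ptime_clear]) (use pre in \<open>auto simp: fun_eq_iff\<close>)
  have c5: "ptime (Cond (\<lambda>tp. tp 12 = None) (push 1 Blank) nop) (\<lambda>x. X x \<and> P x)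
      (\<lambda>x. (?u x)(12 := ?flag (?q x (hh x))))
      (\<lambda>x. (?u x)(12 := ?flag (?q x (hh x)), 1 := ?flag (\<not> ?q x (hh x)) @ s x 1))" for P
    by (rule ptime_post[OF ptime_Cond[OF ptime_push ptime_nop]]) (auto simp: fun_eq_iff)
  have c6: "ptime (clear 12) (\<lambda>x. X x \<and> P x)
      (\<lambda>x. (?u x)(12 := ?flag (?q x (hh x)), 1 := ?flag (\<not> ?q x (hh x)) @ s x 1))
      (\<lambda>x. (?u x)(1 := ?flag (\<not> ?q x (hh x)) @ s x 1))" for P
    by (rule ptime_post[OF ptime_clear]) (use pre in \<open>auto simp: fun_eq_iff\<close>)
  have 6: "ptime (Cond (\<lambda>tp. tp 12 \<noteq> None)
         (Seq (clear 12) (Seq (copy 3 11) (Seq query (Seq (clear 11)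
           (Seq (Cond (\<lambda>tp. tp 12 = None) (push 1 Blank) nop) (clear 12))))))
         nop) X ?s5 ?s6"
    by (rule ptime_post[OF ptime_Cond[OF ptime_Seq[OF c1 ptime_Seq[OF c2 ptime_Seq[OF c3
          ptime_Seq[OF c4 ptime_Seq[OF c5 c6]]]]] ptime_nop]])
       (use u in \<open>auto simp: fun_eq_iff hit_def\<close>)
  have 7: "ptime (push 7 (Input Comma)) X ?s6 (\<lambda>x. (?s6 x)(7 := emb (Comma # pp x)))"
    by (rule ptime_post[OF ptime_push]) (use pre in auto)
  have 8: "ptime (copy 8 7) X (\<lambda>x. (?s6 x)(7 := emb (Comma # pp x)))
      (\<lambda>x. (?s6 x)(7 := emb (enc_cand (a x) @ Comma # pp x)))"
    by (rule ptime_post[OF ptime_copy]) (use pre u in auto)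
  show ?thesis
    unfolding round_def
    by (rule ptime_post[OF ptime_Seq[OF 1 ptime_Seq[OF 2 ptime_Seq[OF 3 ptime_Seq[OF 4
          ptime_Seq[OF 5 ptime_Seq[OF 6 ptime_Seq[OF 7 ptime_Seq[OF 8 ptime_clear]]]]]]]]])
       (use pre in \<open>auto simp: fun_eq_iff\<close>)
qed

definition rounds :: "symbol cmd" where
  "rounds = Loop (\<lambda>tp. tp 6 \<noteq> None) round"

definition hit ::
  "symbol list \<Rightarrow> nat \<Rightarrow> symbol list \<Rightarrow> symbol list \<Rightarrow> nat list \<Rightarrow> nat \<Rightarrow> bool" where
  "hit tm h xs ry us i \<longleftrightarrow>
     query_word tm (enc_cand (us ! i)) xs ry (enc_vote (trial_vote us h i)) \<in> L \<and>
     query_word tm (enc_cand h) xs ry (enc_vote (trial_vote us h i)) \<notin> L"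

lemma ptime_rounds:
  assumes pre: "\<And>x. X x \<Longrightarrow> ready (s x) \<and> s x 2 = emb (tm x) \<and> s x 3 = emb (enc_cand (h x)) \<and>
    s x 4 = emb (xs x) \<and> s x 5 = emb (ry x) \<and> s x 6 = emb (enc_vote (us x)) \<and>
    s x 7 = [] \<and> s x 8 = [] \<and> s x 11 = [] \<and> s x 12 = []"
  defines "hits \<equiv> \<lambda>x i. replicate (length (filter (hit (tm x) (h x) (xs x) (ry x) (us x)) [0..<i])) Blank"
  shows "ptime rounds X s (\<lambda>x. (s x)(6 := [], 7 := emb (enc_vote (rev (us x))),
    1 := hits x (length (us x)) @ s x 1))"
proof -
  let ?A = "\<lambda>x i. (s x)(6 := emb (enc_vote (drop i (us x))), 7 := emb (enc_vote (rev (take i (us x)))),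
    1 := hits x i @ s x 1)"
  have A0: "?A x 0 = s x" if "X x" for x
    using pre[OF that] by (auto simp: fun_eq_iff hits_def)
  have "ptime rounds X (\<lambda>x. ?A x 0) (\<lambda>x. ?A x (length (us x)))"
    unfolding rounds_def
  \<comment> \<open>Each candidate contributes a comma, so the list has at most \<open>N\<close>
    entries. Registers 6 and 7 merely share the original list between them, and register 1 grows by
    at most one hit per pass.\<close>
  proof (rule ptime_Loop[where q = "[:0, 1:]" and q' = "[:0, 2:]"])
    let ?Y = "\<lambda>(x, i). X x \<and> i < length (us x)"
    have A: "ready (?A x i)" "?A x i 2 = emb (tm x)" "?A x i 3 = emb (enc_cand (h x))"
      "?A x i 4 = emb (xs x)" "?A x i 5 = emb (ry x)"
      "?A x i 6 = emb (enc_cand (us x ! i) @ Comma # enc_vote (drop (Suc i) (us x)))"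
      "?A x i 7 = emb (enc_vote (rev (take i (us x))))"
      "?A x i 8 = []" "?A x i 11 = []" "?A x i 12 = []"
      if "X x" "i < length (us x)" for x i
      using pre[OF that(1)] that(2) by (auto simp: ready_def Cons_nth_drop_Suc[symmetric])
    show "ptime round ?Y (\<lambda>(x, i). ?A x i) (\<lambda>(x, i). ?A x (Suc i))"
    proof (rule ptime_post[OF ptime_round[where tm = "\<lambda>(x, i). tm x" and hh = "\<lambda>(x, i). enc_cand (h x)"
          and xs = "\<lambda>(x, i). xs x" and ry = "\<lambda>(x, i). ry x" and a = "\<lambda>(x, i). us x ! i"
          and rest = "\<lambda>(x, i). enc_vote (drop (Suc i) (us x))"
          and pp = "\<lambda>(x, i). enc_vote (rev (take i (us x)))"]], goal_cases)
      case (1 y)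
      obtain x i where y: "y = (x, i)" by fastforce
      from 1 show ?case using A[of x i] unfolding y by simp
    next
      case (2 y)
      obtain x i where y: "y = (x, i)" by fastforce
      have i: "i < length (us x)" using 2 by (simp add: y)
      have "rev (take (Suc i) (us x)) = us x ! i # rev (take i (us x))"
        using i by (simp add: take_Suc_conv_app_nth)
      then show ?case
        by (simp add: y hits_def hit_def trial_vote_def fun_eq_iff)
    qed
  next
    fix x i
    assume "X x" "i < length (us x)"
    then show "tops_of (?A x i) 6 \<noteq> None" by (simp add: Cons_nth_drop_Suc[symmetric])
  next
    fix x
    show "\<not> tops_of (?A x (length (us x))) 6 \<noteq> None" by simp
  next
    fix x N
    assume "\<And>r. length (?A x 0 r) \<le> N"
    from this[of 6] length_le_length_enc_vote[of "us x"] show "length (us x) \<le> poly [:0, 1:] N"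
      by simp
  next
    fix x N i r
    assume x: "X x" and N: "\<And>r. length (?A x 0 r) \<le> N" and i: "i < length (us x)"
    have s: "length (s x r) \<le> N" for r using N[of r] unfolding A0[OF x] .
    have us: "length (enc_vote (us x)) \<le> N" using N[of 6] by simp
    have "length (enc_vote (take i (us x) @ drop i (us x))) \<le> N" using us by simp
    then have 1: "length (enc_vote (take i (us x))) + length (enc_vote (drop i (us x))) \<le> N"
      unfolding enc_vote_append by simp
    have 2: "length (enc_vote (rev v)) = length (enc_vote v)" for v
      by (induction v) auto
    have "length (hits x i) \<le> i" unfolding hits_def
      using length_filter_le[of _ "[0..<i]"] by simp
    moreover have "i \<le> N" using i length_le_length_enc_vote[of "us x"] us by linarith
    ultimately have "length (?A x i r) \<le> N + N" using 1 2 s[of r] s[of 1] by auto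
    then show "length (?A x i r) \<le> poly [:0, 2:] N" by simp
  qed
  then show ?thesis
    by (rule ptime_cong) (simp_all only: A0, simp)
qed

end

section \<open>Cutting the input into its parts\<close>

definition weight_symbol :: "symbol \<Rightarrow> bool" where
  "weight_symbol z \<longleftrightarrow> z \<in> {Zero, One, Semicolon}"

text \<open>An input \<open>w\<close> is cut into \<open>tallies w | cand_part w | votes_part w | weights_part w\<close>.\<close>

definition "tallies w = takeWhile (\<lambda>z. z = Tally) w"
definition "rest1 w = dropWhile (\<lambda>z. z = Tally) w"
definition "cand_part w = takeWhile (\<lambda>z. z = Tally) (tl (rest1 w))"
definition "rest2 w = dropWhile (\<lambda>z. z = Tally) (tl (rest1 w))"
definition "votes_part w = takeWhile (\<lambda>z. z \<noteq> Bar) (tl (rest2 w))"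
definition "rest3 w = dropWhile (\<lambda>z. z \<noteq> Bar) (tl (rest2 w))"
definition "weights_part w = takeWhile weight_symbol (tl (rest3 w))"
definition "rest4 w = dropWhile weight_symbol (tl (rest3 w))"

text \<open>The latest check comes first, because each failure is pushed onto register 10; so
  \<open>drop k (checks w)\<close> lists the checks made up to an intermediate point. Only the
  separators are examined; the two semicolon conditions are those of
  \<open>ex_semis\<close>.\<close>

definition checks :: "symbol list \<Rightarrow> bool list" where
  "checks w =
     [peek (rev (weights_part w)) \<in> {None, Some Semicolon},
      rest4 w = [],
      peek (rest3 w) = Some Bar,
      peek (rev (votes_part w)) \<in> {None, Some Semicolon},
      peek (rest2 w) = Some Bar,
      peek (rest1 w) = Some Bar]"

text \<open>This is the order in which \<open>list_others\<close> leaves the rivals on a stack after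
  pushing them in ascending order. The bound \<open>Suc h + (m - Suc h)\<close> equals
  \<open>m\<close> if \<open>h < m\<close>; for faulty inputs with \<open>m \<le> h\<close> the
  first part is empty.\<close>

definition others :: "nat \<Rightarrow> nat \<Rightarrow> nat list" where
  "others m h = rev [Suc h..<Suc h + (m - Suc h)] @ rev [0..<h]"

definition error :: "bool \<Rightarrow> symbol cell list" where
  "error b = (if b then [] else [Blank])"

definition check :: "(symbol tops \<Rightarrow> bool) \<Rightarrow> symbol cmd" where
  "check b = Cond b nop (push 10 Blank)"

lemma ptime_check:
  "ptime (check b) X s (\<lambda>x. (s x)(10 := error (b (tops_of (s x))) @ s x 10))"
  unfolding check_def
  by (rule ptime_post[OF ptime_Cond[OF ptime_nop ptime_push]]) (simp add: error_def)

definition pop_bar :: "symbol cmd" where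
  "pop_bar = Seq (check (\<lambda>tp. tp 0 = Some (Input Bar))) (pop 0)"

lemma map_option_Input [simp]: "map_option Input x = Some (Input a) \<longleftrightarrow> x = Some a"
  by (cases x) auto

lemma ptime_pop_bar:
  assumes "\<And>x. X x \<Longrightarrow> s x 0 = emb (r x)"
  shows "ptime pop_bar X s
    (\<lambda>x. (s x)(0 := emb (tl (r x)), 10 := error (peek (r x) = Some Bar) @ s x 10))"
  unfolding pop_bar_def
  by (rule ptime_post[OF ptime_Seq[OF ptime_check ptime_pop]])
     (simp add: assms fun_upd_twist map_tl)

text \<open>The votes make a detour through register 14, where their last symbol is on top and can
  be checked; the second transfer restores their order. The weights stay reversed, as the insertion
  of votes requires, and reversing a row of tallies changes nothing.\<close>

definition parse :: "symbol cmd" where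
  "parse = Seq (shift_while (\<lambda>z. z = Input Tally) 0 2) (Seq pop_bar
     (Seq (shift_while (\<lambda>z. z = Input Tally) 0 3) (Seq pop_bar
     (Seq (shift_while (\<lambda>z. z \<noteq> Input Bar) 0 14)
     (Seq (check (\<lambda>tp. tp 14 \<in> {None, Some (Input Semicolon)}))
     (Seq (shift_while (\<lambda>_. True) 14 4) (Seq pop_bar
     (Seq (shift_while (\<lambda>z. z \<in> Input ` Collect weight_symbol) 0 5)
     (Seq (check (\<lambda>tp. tp 0 = None)) (check (\<lambda>tp. tp 5 \<in> {None, Some (Input Semicolon)})))))))))))"

definition input_state :: "symbol list \<Rightarrow> symbol stacks" where
  "input_state w = (\<lambda>i. if i = 0 then emb w else [])"

definition parsed :: "symbol list \<Rightarrow> symbol stacks" where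
  "parsed w = (\<lambda>_. [])(0 := emb (rest4 w), 2 := emb (tallies w), 3 := emb (cand_part w),
     4 := emb (votes_part w), 5 := emb (rev (weights_part w)), 10 := concat (map error (checks w)))"

lemma rev_takeWhile_Tally: "rev (takeWhile (\<lambda>z. z = Tally) xs) = takeWhile (\<lambda>z. z = Tally) xs"
proof -
  have "takeWhile (\<lambda>z. z = Tally) xs = replicate (length (takeWhile (\<lambda>z. z = Tally) xs)) Tally"
    by (induction xs) auto
  then show ?thesis by (metis rev_replicate)
qed

lemma ptime_parse: "ptime parse (\<lambda>_. True) input_state parsed"
proof -
  let ?Z = "\<lambda>_. [] :: symbol cell list"
  let ?s1 = "\<lambda>w. ?Z(0 := emb (rest1 w), 2 := emb (tallies w))"
  let ?s2 = "\<lambda>w. ?Z(0 := emb (tl (rest1 w)), 2 := emb (tallies w),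
    10 := error (peek (rest1 w) = Some Bar))"
  let ?s3 = "\<lambda>w. ?Z(0 := emb (rest2 w), 2 := emb (tallies w), 3 := emb (cand_part w),
    10 := error (peek (rest1 w) = Some Bar))"
  let ?s4 = "\<lambda>w. ?Z(0 := emb (tl (rest2 w)), 2 := emb (tallies w), 3 := emb (cand_part w),
    10 := concat (map error (drop 4 (checks w))))"
  let ?s5 = "\<lambda>w. ?Z(0 := emb (rest3 w), 2 := emb (tallies w), 3 := emb (cand_part w),
    10 := concat (map error (drop 4 (checks w))), 14 := emb (rev (votes_part w)))"
  let ?s6 = "\<lambda>w. ?Z(0 := emb (rest3 w), 2 := emb (tallies w), 3 := emb (cand_part w),
    10 := concat (map error (drop 3 (checks w))), 14 := emb (rev (votes_part w)))"
  let ?s7 = "\<lambda>w. ?Z(0 := emb (rest3 w), 2 := emb (tallies w), 3 := emb (cand_part w),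
    4 := emb (votes_part w), 10 := concat (map error (drop 3 (checks w))))"
  let ?s8 = "\<lambda>w. ?Z(0 := emb (tl (rest3 w)), 2 := emb (tallies w), 3 := emb (cand_part w),
    4 := emb (votes_part w), 10 := concat (map error (drop 2 (checks w))))"
  let ?s9 = "\<lambda>w. ?Z(0 := emb (rest4 w), 2 := emb (tallies w), 3 := emb (cand_part w),
    4 := emb (votes_part w), 5 := emb (rev (weights_part w)),
    10 := concat (map error (drop 2 (checks w))))"
  let ?s10 = "\<lambda>w. ?Z(0 := emb (rest4 w), 2 := emb (tallies w), 3 := emb (cand_part w),
    4 := emb (votes_part w), 5 := emb (rev (weights_part w)),
    10 := concat (map error (drop 1 (checks w))))"
  let ?X = "\<lambda>_. True"
  have o: "(\<lambda>z. z = Input Tally) \<circ> Input = (\<lambda>z. z = Tally)"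
    "(\<lambda>z. z \<noteq> Input Bar) \<circ> Input = (\<lambda>z. z \<noteq> Bar)"
    "(\<lambda>z. z \<in> Input ` Collect weight_symbol) \<circ> Input = weight_symbol"
    by (auto simp: fun_eq_iff)
  have tW: "takeWhile (\<lambda>_. True) xs = xs" "dropWhile (\<lambda>_. True) xs = []" for xs :: "'z list"
    by (induction xs) auto
  have 1: "ptime (shift_while (\<lambda>z. z = Input Tally) 0 2) ?X input_state ?s1"
    by (rule ptime_post[OF ptime_shift_while])
       (auto simp: takeWhile_map dropWhile_map o input_state_def rest1_def tallies_def
          rev_takeWhile_Tally rev_map fun_eq_iff)
  have 2: "ptime pop_bar ?X ?s1 ?s2"
    by (rule ptime_post[OF ptime_pop_bar[where r = rest1]]) (auto simp: fun_eq_iff)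
  have 3: "ptime (shift_while (\<lambda>z. z = Input Tally) 0 3) ?X ?s2 ?s3"
    by (rule ptime_post[OF ptime_shift_while])
       (auto simp: takeWhile_map dropWhile_map o rest2_def cand_part_def
          rev_takeWhile_Tally rev_map fun_eq_iff)
  have 4: "ptime pop_bar ?X ?s3 ?s4"
    by (rule ptime_post[OF ptime_pop_bar[where r = rest2]]) (auto simp: fun_eq_iff checks_def)
  have 5: "ptime (shift_while (\<lambda>z. z \<noteq> Input Bar) 0 14) ?X ?s4 ?s5"
    by (rule ptime_post[OF ptime_shift_while])
       (auto simp: takeWhile_map dropWhile_map o rest3_def votes_part_def rev_map fun_eq_iff)
  have 6: "ptime (check (\<lambda>tp. tp 14 \<in> {None, Some (Input Semicolon)})) ?X ?s5 ?s6"
    by (rule ptime_post[OF ptime_check]) (auto simp: fun_eq_iff checks_def)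
  have 7: "ptime (shift_while (\<lambda>_. True) 14 4) ?X ?s6 ?s7"
    by (rule ptime_post[OF ptime_shift_while]) (auto simp: tW fun_eq_iff rev_map)
  have 8: "ptime pop_bar ?X ?s7 ?s8"
    by (rule ptime_post[OF ptime_pop_bar[where r = rest3]]) (auto simp: fun_eq_iff checks_def)
  have 9: "ptime (shift_while (\<lambda>z. z \<in> Input ` Collect weight_symbol) 0 5) ?X ?s8 ?s9"
    by (rule ptime_post[OF ptime_shift_while])
       (auto simp: takeWhile_map dropWhile_map o rest4_def weights_part_def rev_map fun_eq_iff
         simp del: image_iff)
  have 10: "ptime (check (\<lambda>tp. tp 0 = None)) ?X ?s9 ?s10"
    by (rule ptime_post[OF ptime_check]) (auto simp: fun_eq_iff checks_def)
  have 11: "ptime (check (\<lambda>tp. tp 5 \<in> {None, Some (Input Semicolon)})) ?X ?s10 parsed"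
    by (rule ptime_post[OF ptime_check]) (auto simp: fun_eq_iff checks_def parsed_def)
  show ?thesis
    unfolding parse_def
    by (intro ptime_Seq[OF 1] ptime_Seq[OF 2] ptime_Seq[OF 3] ptime_Seq[OF 4] ptime_Seq[OF 5]
        ptime_Seq[OF 6] ptime_Seq[OF 7] ptime_Seq[OF 8] ptime_Seq[OF 9] ptime_Seq[OF 10] 11)
qed

section \<open>Listing the rivals of \<open>h\<close>\<close>

definition subtract :: "symbol cmd" where
  "subtract = Loop (\<lambda>tp. tp 15 \<noteq> None) (Seq (pop 14) (pop 15))"

lemma ptime_subtract:
  "ptime subtract X s (\<lambda>x. (s x)(14 := drop (length (s x 15)) (s x 14), 15 := []))"
proof -
  let ?A = "\<lambda>x i. (s x)(14 := drop i (s x 14), 15 := drop i (s x 15))"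
  have "ptime subtract X (\<lambda>x. ?A x 0) (\<lambda>x. ?A x (length (s x 15)))"
    unfolding subtract_def
  proof (rule ptime_Loop[where q = "[:0, 1:]" and q' = "[:0, 1:]"])
    show "ptime (Seq (pop 14) (pop 15)) (\<lambda>(x, i). X x \<and> i < length (s x 15)) (\<lambda>(x, i). ?A x i)
        (\<lambda>(x, i). ?A x (Suc i))"
      by (rule ptime_post[OF ptime_Seq[OF ptime_pop ptime_pop]])
         (auto simp: fun_eq_iff drop_Suc tl_drop)
  next
    fix x N
    assume "\<And>r. length (?A x 0 r) \<le> N"
    from this[of 15] show "length (s x 15) \<le> poly [:0, 1:] N" by simp
  next
    fix x N i r
    assume N: "\<And>r. length (?A x 0 r) \<le> N"
    show "length (?A x i r) \<le> poly [:0, 1:] N"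
      using N[of 14] N[of 15] N[of r] by auto
  qed (auto simp: drop_eq_Nil)
  then show ?thesis by (rule ptime_cong) auto
qed

text \<open>Register \<open>r\<close> counts the passes in unary, and register 11 holds the next
  candidate to be written on top of register 6.\<close>

definition blocks :: "nat \<Rightarrow> symbol cmd" where
  "blocks r = Loop (\<lambda>tp. tp r \<noteq> None)
     (Seq (pop r) (Seq (push 6 (Input Comma)) (Seq (copy 11 6) (push 11 (Input Tally)))))"

lemma length_enc_vote_upt: "length (enc_vote (rev [c..<c + i])) \<le> i * (c + i)"
proof (induction i)
  case (Suc i)
  have "length (enc_vote (rev [c..<c + Suc i])) \<le> c + i + 1 + i * (c + i)"
    using Suc by (simp add: enc_cand_def)
  also have "\<dots> \<le> Suc i * (c + Suc i)" by simp
  finally show ?case .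
qed simp

lemma ptime_blocks:
  assumes r: "r \<notin> {6, 9, 11}"
    and pre: "\<And>x. X x \<Longrightarrow> s x 9 = [] \<and> s x 11 = emb (enc_cand (c x)) \<and> s x 6 = emb (enc_vote (us x))"
  shows "ptime (blocks r) X s (\<lambda>x. (s x)(r := [],
    6 := emb (enc_vote (rev [c x..<c x + length (s x r)] @ us x)),
    11 := emb (enc_cand (c x + length (s x r)))))"
proof -
  let ?A = "\<lambda>x i. (s x)(r := drop i (s x r), 6 := emb (enc_vote (rev [c x..<c x + i] @ us x)),
    11 := emb (enc_cand (c x + i)))"
  have A0: "?A x 0 = s x" if "X x" for x
    using pre[OF that] by (auto simp: fun_eq_iff)
  have "ptime (blocks r) X (\<lambda>x. ?A x 0) (\<lambda>x. ?A x (length (s x r)))"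
    unfolding blocks_def
  \<comment> \<open>In unary, the \<open>i\<close> new candidates take at most
    \<open>i * (c + i)\<close> symbols, hence at most \<open>N * (N + N)\<close>, in addition to the
    previous \<open>N\<close>. The linear coefficient 2 also leaves room for the counter
    \<open>c + i\<close>.\<close>
  proof (rule ptime_Loop[where q = "[:0, 1:]" and q' = "[:0, 2, 2:]"])
    let ?Y = "\<lambda>(x, i). X x \<and> i < length (s x r)"
    let ?s1 = "\<lambda>(x, i). (?A x i)(r := drop (Suc i) (s x r))"
    let ?s2 = "\<lambda>(x, i). (?s1 (x, i))(6 := emb (Comma # enc_vote (rev [c x..<c x + i] @ us x)))"
    let ?s3 = "\<lambda>(x, i). (?s1 (x, i))(6 := emb (enc_vote (rev [c x..<c x + Suc i] @ us x)))"
    have 1: "ptime (pop r) ?Y (\<lambda>(x, i). ?A x i) ?s1"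
      by (rule ptime_post[OF ptime_pop]) (use r in \<open>auto simp: fun_eq_iff drop_Suc tl_drop\<close>)
    have 2: "ptime (push 6 (Input Comma)) ?Y ?s1 ?s2"
      by (rule ptime_post[OF ptime_push]) (use r in \<open>auto simp: fun_eq_iff\<close>)
    have 3: "ptime (copy 11 6) ?Y ?s2 ?s3"
      by (rule ptime_post[OF ptime_copy]) (use r pre in \<open>auto simp: fun_eq_iff\<close>)
    have 4: "ptime (push 11 (Input Tally)) ?Y ?s3 (\<lambda>(x, i). ?A x (Suc i))"
      by (rule ptime_post[OF ptime_push]) (use r in \<open>auto simp: fun_eq_iff enc_cand_Suc\<close>)
    show "ptime (Seq (pop r) (Seq (push 6 (Input Comma)) (Seq (copy 11 6) (push 11 (Input Tally)))))
        ?Y (\<lambda>(x, i). ?A x i) (\<lambda>(x, i). ?A x (Suc i))"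
      by (rule ptime_Seq[OF 1 ptime_Seq[OF 2 ptime_Seq[OF 3 4]]])
  next
    fix x N
    assume "\<And>k. length (?A x 0 k) \<le> N"
    from this[of r] r show "length (s x r) \<le> poly [:0, 1:] N" by simp
  next
    fix x N i k
    assume x: "X x" and N: "\<And>k. length (?A x 0 k) \<le> N" and i: "i < length (s x r)"
    have s: "length (s x k) \<le> N" for k using N[of k] unfolding A0[OF x] .
    have iN: "i \<le> N" using i s[of r] by simp
    have cN: "c x \<le> N" using s[of 11] pre[OF x] by (simp add: enc_cand_def)
    have us: "length (enc_vote (us x)) \<le> N" using s[of 6] pre[OF x] by simp
    have "i * (c x + i) \<le> N * (N + N)" using iN cN by (intro mult_le_mono) auto
    then have "length (enc_vote (rev [c x..<c x + i] @ us x)) \<le> N * (N + N) + N"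
      using length_enc_vote_upt[of "c x" i] us unfolding enc_vote_append length_append by linarith
    moreover have "length (?A x i k) \<le> max (length (s x k))
        (max (length (enc_vote (rev [c x..<c x + i] @ us x))) (c x + i))"
      by (auto simp: enc_cand_def)
    moreover have "N * (N + N) + N \<le> poly [:0, 2, 2:] N" "N \<le> poly [:0, 2, 2:] N"
      "N + N \<le> poly [:0, 2, 2:] N" by (simp_all add: algebra_simps)
    ultimately show "length (?A x i k) \<le> poly [:0, 2, 2:] N"
      using s[of k] cN iN by linarith
  qed (use r in auto)
  then show ?thesis
    by (rule ptime_cong) (simp_all only: A0, simp)
qed

text \<open>Register 14 receives \<open>m - h\<close> symbols, so it is nonempty iff
  \<open>h < m\<close>; the pop reduces it to \<open>m - Suc h\<close>. The tally pushed between the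
  two runs of \<open>blocks\<close> makes the counter skip \<open>h\<close>.\<close>

definition list_others :: "symbol cmd" where
  "list_others = Seq (copy 2 14) (Seq (copy 3 15) (Seq subtract (Seq (check (\<lambda>tp. tp 14 \<noteq> None))
     (Seq (pop 14) (Seq (copy 3 15) (Seq (blocks 15) (Seq (push 11 (Input Tally))
     (Seq (blocks 14) (clear 11)))))))))"

definition num_cands :: "symbol list \<Rightarrow> nat" where
  "num_cands w = length (tallies w)"

definition cand :: "symbol list \<Rightarrow> nat" where
  "cand w = length (cand_part w)"

lemma tallies_eq: "tallies w = replicate (num_cands w) Tally"
  unfolding num_cands_def tallies_def by (induction w) auto

lemma cand_part_eq: "cand_part w = enc_cand (cand w)"
proof -
  have "takeWhile (\<lambda>z. z = Tally) xs = replicate (length (takeWhile (\<lambda>z. z = Tally) xs)) Tally" for xs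
    by (induction xs) auto
  then show ?thesis unfolding cand_def cand_part_def enc_cand_def by blast
qed

definition listed :: "symbol list \<Rightarrow> symbol stacks" where
  "listed w = (parsed w)(6 := emb (enc_vote (others (num_cands w) (cand w))),
     10 := error (cand w < num_cands w) @ concat (map error (checks w)))"

lemma ptime_list_others: "ptime list_others (\<lambda>_. True) parsed listed"
proof -
  let ?X = "\<lambda>_. True"
  let ?m = num_cands and ?h = cand
  let ?T = "\<lambda>n. replicate n (Input Tally) :: symbol cell list"
  let ?s1 = "\<lambda>w. (parsed w)(14 := ?T (?m w))"
  let ?s2 = "\<lambda>w. (parsed w)(14 := ?T (?m w), 15 := ?T (?h w))"
  let ?s3 = "\<lambda>w. (parsed w)(14 := ?T (?m w - ?h w))"
  let ?u = "\<lambda>w. (parsed w)(10 := error (cand w < num_cands w) @ concat (map error (checks w)))"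
  let ?s4 = "\<lambda>w. (?u w)(14 := ?T (?m w - ?h w))"
  let ?s5 = "\<lambda>w. (?u w)(14 := ?T (?m w - Suc (?h w)))"
  let ?s6 = "\<lambda>w. (?u w)(14 := ?T (?m w - Suc (?h w)), 15 := ?T (?h w))"
  let ?s7 = "\<lambda>w. (?u w)(14 := ?T (?m w - Suc (?h w)), 6 := emb (enc_vote (rev [0..<?h w])),
    11 := emb (enc_cand (?h w)))"
  let ?s8 = "\<lambda>w. (?u w)(14 := ?T (?m w - Suc (?h w)), 6 := emb (enc_vote (rev [0..<?h w])),
    11 := emb (enc_cand (Suc (?h w))))"
  let ?s9 = "\<lambda>w. (?u w)(6 := emb (enc_vote (others (?m w) (?h w))),
    11 := emb (enc_cand (Suc (?h w) + (?m w - Suc (?h w)))))"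
  have p: "parsed w 2 = ?T (?m w)" "parsed w 3 = ?T (?h w)" "parsed w 6 = []" "parsed w 9 = []"
    "parsed w 10 = concat (map error (checks w))" "parsed w 11 = []" "parsed w 14 = []"
    "parsed w 15 = []" for w
    by (simp_all add: parsed_def tallies_eq cand_part_eq enc_cand_def)
  have 1: "ptime (copy 2 14) ?X parsed ?s1"
    by (rule ptime_post[OF ptime_copy]) (simp_all add: p)
  have 2: "ptime (copy 3 15) ?X ?s1 ?s2"
    by (rule ptime_post[OF ptime_copy]) (simp_all add: p)
  have 3: "ptime subtract ?X ?s2 ?s3"
    by (rule ptime_post[OF ptime_subtract]) (auto simp: p fun_eq_iff)
  have 4: "ptime (check (\<lambda>tp. tp 14 \<noteq> None)) ?X ?s3 ?s4"
    by (rule ptime_post[OF ptime_check]) (auto simp: p fun_eq_iff error_def)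
  have 5: "ptime (pop 14) ?X ?s4 ?s5"
  proof (rule ptime_post[OF ptime_pop])
    fix w
    show "(?s4 w)(14 := tl (?s4 w 14)) = ?s5 w"
      by (cases "?m w - ?h w") (auto simp: fun_eq_iff dest: Suc_diff_Suc)
  qed
  have 6: "ptime (copy 3 15) ?X ?s5 ?s6"
    by (rule ptime_post[OF ptime_copy]) (simp_all add: p)
  have 7: "ptime (blocks 15) ?X ?s6 ?s7"
    by (rule ptime_post[OF ptime_blocks[where c = "\<lambda>_. 0" and us = "\<lambda>_. []"]])
       (auto simp: p fun_eq_iff enc_cand_def)
  have 8: "ptime (push 11 (Input Tally)) ?X ?s7 ?s8"
    by (rule ptime_post[OF ptime_push]) (auto simp: enc_cand_Suc)
  have 9: "ptime (blocks 14) ?X ?s8 ?s9"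
    by (rule ptime_post[OF ptime_blocks[where c = "\<lambda>w. Suc (?h w)" and us = "\<lambda>w. rev [0..<?h w]"]])
       (auto simp: p fun_eq_iff others_def simp del: upt_Suc)
  have 10: "ptime (clear 11) ?X ?s9 listed"
    by (rule ptime_post[OF ptime_clear]) (auto simp: p fun_eq_iff listed_def)
  show ?thesis
    unfolding list_others_def
    by (intro ptime_Seq[OF 1] ptime_Seq[OF 2] ptime_Seq[OF 3] ptime_Seq[OF 4] ptime_Seq[OF 5]
        ptime_Seq[OF 6] ptime_Seq[OF 7] ptime_Seq[OF 8] ptime_Seq[OF 9] 10)
qed

section \<open>The whole decision program and its machine\<close>

context query_decider
begin

text \<open>Errors do not interrupt the program. The queries are posed even for faulty inputs, which
  is safe because the given machine halts in polynomial time on every word; at the end an error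
  erases all hits.\<close>

definition main :: "symbol cmd" where
  "main = Seq parse (Seq list_others (Seq rounds (Cond (\<lambda>tp. tp 10 = None) nop (clear 1))))"

definition hits :: "symbol list \<Rightarrow> nat \<Rightarrow> bool" where
  "hits w i \<longleftrightarrow> hit (tallies w) (cand w) (votes_part w) (rev (weights_part w))
     (others (num_cands w) (cand w)) i"

definition well_formed :: "symbol list \<Rightarrow> bool" where
  "well_formed w \<longleftrightarrow> cand w < num_cands w \<and> False \<notin> set (checks w)"

lemma ptime_main:
  "\<exists>s. ptime main (\<lambda>_. True) input_state s \<and>
    (\<forall>w. s w 1 \<noteq> [] \<longleftrightarrow> well_formed w \<and>
      (\<exists>i < length (others (num_cands w) (cand w)). hits w i))"
proof -
  let ?us = "\<lambda>w. others (num_cands w) (cand w)"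
  let ?n = "\<lambda>w. length (filter (hits w) [0..<length (?us w)])"
  let ?s = "\<lambda>w. (listed w)(6 := [], 7 := emb (enc_vote (rev (?us w))),
    1 := replicate (?n w) Blank)"
  let ?s' = "\<lambda>w. if tops_of (?s w) 10 = None then ?s w else (?s w)(1 := [])"
  have 3: "ptime rounds (\<lambda>_. True) listed ?s"
  proof (rule ptime_post[OF ptime_rounds[where tm = tallies and h = cand and xs = votes_part
        and ry = "\<lambda>w. rev (weights_part w)" and us = ?us]])
  qed (auto simp: listed_def parsed_def ready_def cand_part_eq hits_def[abs_def])
  have "ptime main (\<lambda>_. True) input_state ?s'"
    unfolding main_def
    by (rule ptime_Seq[OF ptime_parse ptime_Seq[OF ptime_list_others ptime_Seq[OF 3
          ptime_Cond[OF ptime_nop ptime_clear]]]])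
  moreover have "?s' w 1 \<noteq> [] \<longleftrightarrow> well_formed w \<and> (\<exists>i < length (?us w). hits w i)" for w
  proof -
    have "tops_of (?s w) 10 = None \<longleftrightarrow> well_formed w"
      by (auto simp: listed_def well_formed_def error_def split: if_splits)
    moreover have "replicate (?n w) (Blank :: symbol cell) \<noteq> [] \<longleftrightarrow> (\<exists>i < length (?us w). hits w i)"
      by (auto simp: filter_empty_conv)
    ultimately show ?thesis by auto
  qed
  ultimately show ?thesis by blast
qed

lemma hits_in_class_P:
  "{w. well_formed w \<and> (\<exists>i < length (others (num_cands w) (cand w)). hits w i)} \<in> class_P"
  (is "?H \<in> _")
proof -
  \<comment> \<open>The states of \<open>M\<close> occur as work symbols, since register 13 stores
    the current one.\<close>
  let ?\<Gamma> = "symbols M \<union> Aux ` states M" and ?N = "16 + 2 * tapes M"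
  have inp: "range Input \<subseteq> ?\<Gamma>" "Blank \<in> ?\<Gamma>" "Input z \<in> ?\<Gamma>" for z
    using wf_M by (auto simp: wf_tm_def)
  have run: "wf_cmd ?N ?\<Gamma> run_M" by (rule wf_run_M) auto
  \<comment> \<open>\<open>M\<close> has at least one tape, so the highest register that the program
    addresses by number lies within the range.\<close>
  have "17 < ?N" using wf_M by (simp add: wf_tm_def)
  then have "wf_cmd ?N ?\<Gamma> main"
    using inp(2,3) run unfolding main_def parse_def pop_bar_def check_def list_others_def
      subtract_def blocks_def rounds_def round_def query_def add_votes_def add_vote_def
    by (simp add: wf_basic del: Un_iff)
  moreover have "finite ?\<Gamma>" using wf_M by (auto simp: wf_tm_def)
  ultimately interpret compiled ?N ?\<Gamma> main 1
    using inp(1) by unfold_locales auto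
  obtain s where s: "ptime main (\<lambda>_. True) input_state s"
    "\<And>w. s w 1 \<noteq> [] \<longleftrightarrow> w \<in> ?H"
    using ptime_main by auto
  from s(1) obtain q :: "nat poly" where q: "\<And>w N. (\<And>i. length (input_state w i) \<le> N) \<Longrightarrow>
      \<exists>t \<le> poly q N. exec main (input_state w) t (s w)"
    unfolding ptime_def by blast
  \<comment> \<open>The additional step is the one that turns the final stacks into a
    verdict.\<close>
  have "decides_in machine ?H (poly (q + 1))"
    unfolding decides_in_def
  proof
    fix w :: "symbol list"
    have "length (input_state w i) \<le> length w" for i by (simp add: input_state_def)
    from q[OF this] obtain t where t: "t \<le> poly q (length w)" "exec main (input_state w) t (s w)"
      by blast
    from exec_decides[OF t(2)[unfolded input_state_def], of "poly (q + 1) (length w)"] t(1) s(2)[of w]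
    show "fst ((step machine ^^ poly (q + 1) (length w)) (init machine w)) =
        (if w \<in> ?H then accept machine else reject machine)" by simp
  qed
  then show ?thesis using wf_machine unfolding class_P_def by blast
qed

end

section \<open>Encodings\<close>

lemma append_separator_eq:
  "z \<notin> set xs \<Longrightarrow> z \<notin> set ys \<Longrightarrow> xs @ z # us = ys @ z # vs \<longleftrightarrow> xs = ys \<and> us = vs"
proof (induction xs arbitrary: ys)
  case Nil
  then show ?case by (cases ys) auto
next
  case (Cons x xs)
  then show ?case by (cases ys) auto
qed

section \<open>Words cut at semicolons, and votes inserted into them\<close>

definition semis :: "symbol list list \<Rightarrow> symbol list" where
  "semis ys = concat (map (\<lambda>y. y @ [Semicolon]) ys)"

lemma semis_simps [simp]:
  "semis [] = []" "semis (y # ys) = y @ Semicolon # semis ys" "semis (xs @ ys) = semis xs @ semis ys"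
  by (simp_all add: semis_def)

lemma semis_inject:
  assumes "\<forall>x \<in> set xs. Semicolon \<notin> set x" "\<forall>y \<in> set ys. Semicolon \<notin> set y" "semis xs = semis ys"
  shows "xs = ys"
  using assms
proof (induction xs arbitrary: ys)
  case Nil
  then show ?case by (cases ys) auto
next
  case (Cons x xs)
  from Cons.prems(3) obtain y ys' where ys: "ys = y # ys'" by (cases ys) auto
  have "x = y \<and> semis xs = semis ys'"
    using Cons.prems append_separator_eq[of Semicolon x y "semis xs" "semis ys'"] by (simp add: ys)
  then show ?case using Cons.IH[of ys'] Cons.prems by (simp add: ys)
qed

lemma ex_semis_remainder:
  "\<exists>ys z. w = semis ys @ z \<and> (\<forall>y \<in> set ys. Semicolon \<notin> set y) \<and> Semicolon \<notin> set z"
proof (induction w)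
  case Nil
  have "[] = semis [] @ []" by simp
  then show ?case by (metis empty_iff empty_set)
next
  case (Cons c w)
  then obtain ys z where w: "w = semis ys @ z" "\<forall>y \<in> set ys. Semicolon \<notin> set y" "Semicolon \<notin> set z"
    by blast
  show ?case
  proof (cases "c = Semicolon")
    case True
    have "c # w = semis ([] # ys) @ z" using True w by simp
    then show ?thesis using w by (intro exI[of _ "[] # ys"] exI[of _ z]) auto
  next
    case False
    show ?thesis
    proof (cases ys)
      case Nil
      then show ?thesis using w False by (intro exI[of _ "[]"] exI[of _ "c # z"]) auto
    next
      case (Cons y ys')
      then show ?thesis using w False by (intro exI[of _ "(c # y) # ys'"] exI[of _ z]) auto
    qed
  qed
qed

lemma ex_semis:
  assumes "peek (rev w) \<in> {None, Some Semicolon}"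
  shows "\<exists>ys. w = semis ys \<and> (\<forall>y \<in> set ys. Semicolon \<notin> set y)"
proof -
  obtain ys z where w: "w = semis ys @ z" "\<forall>y \<in> set ys. Semicolon \<notin> set y" "Semicolon \<notin> set z"
    using ex_semis_remainder by blast
  have "z = []"
    using assms w(1,3) by (cases z rule: rev_cases) auto
  then show ?thesis using w by auto
qed

lemma peek_rev_semis: "peek (rev (semis ys)) \<in> {None, Some Semicolon}"
  by (cases ys rule: rev_cases) auto

text \<open>As long as the following symbol still belongs to the same weight, it is not a semicolon
  and no vote is inserted. The positions before the last symbol of \<open>s # z\<close> are of this
  kind.\<close>

lemma insert_votes_in_weight:
  "Semicolon \<notin> set z \<Longrightarrow> i \<le> length z \<Longrightarrow> insert_votes v (s # z @ r) i = rev (take i (s # z))"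
proof (induction i)
  case (Suc i)
  then have "drop i (z @ r) = z ! i # drop (Suc i) (z @ r)"
    by (metis Cons_nth_drop_Suc Suc_le_lessD length_append nth_append trans_less_add1)
  moreover have "z ! i \<noteq> Semicolon" using Suc.prems by (metis Suc_le_lessD nth_mem)
  moreover have "(s # z @ r) ! i = (s # z) ! i"
    using Suc.prems by (cases i) (auto simp: nth_append)
  moreover have "take (Suc i) (s # z) = take i (s # z) @ [(s # z) ! i]"
    using Suc.prems by (intro take_Suc_conv_app_nth) simp
  ultimately show ?case using Suc by simp
qed simp

text \<open>The only insertion happens at the last position of \<open>s # z\<close>, where
  \<open>r\<close> follows. The case \<open>z = []\<close> covers weight 0, whose code is empty:
  there the closing semicolon itself is preceded by the vote.\<close>

lemma insert_votes_weight:
  assumes "Semicolon \<notin> set z" "peek r \<in> {None, Some Semicolon}"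
  shows "insert_votes v (s # z @ r) (Suc (length z)) = v @ Colon # rev z @ [s]"
proof -
  have "(s # z @ r) ! length z = (s # z) ! length z"
    using nth_append[of "s # z" r "length z"] by simp
  moreover have "take (Suc (length z)) (s # z) = take (length z) (s # z) @ [(s # z) ! length z]"
    by (rule take_Suc_conv_app_nth) simp
  then have "(s # z) ! length z # rev (take (length z) (s # z)) = rev z @ [s]"
    by (metis length_Cons order_refl rev.simps(2) rev_append rev_rev_ident take_all
        append_Cons append_Nil)
  ultimately show ?thesis
    using assms insert_votes_in_weight[OF assms(1) order_refl, of v s r] by simp
qed

text \<open>Whether a vote is inserted at a position depends only on what follows it in the reversed
  word. So \<open>r'\<close> can be treated without \<open>r\<close>, but not the other way round,
  since the last symbol of \<open>r\<close> looks at the first one of \<open>r'\<close>.\<close>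

lemma insert_votes_append:
  "insert_votes v (r @ r') (length r + i) = insert_votes v r' i @ insert_votes v (r @ r') (length r)"
  by (induction i) (auto simp: nth_append)

lemma insert_votes_semis:
  "\<forall>y \<in> set ys. Semicolon \<notin> set y \<Longrightarrow>
    insert_votes v (rev (semis ys)) (length (semis ys)) = semis (map (\<lambda>y. v @ Colon # y) ys)"
proof (induction ys rule: rev_induct)
  case (snoc y ys)
  let ?r = "Semicolon # rev y" and ?r' = "rev (semis ys)"
  have "insert_votes v (?r @ ?r') (length ?r + length (semis ys)) =
      insert_votes v ?r' (length (semis ys)) @ insert_votes v (?r @ ?r') (length ?r)"
    by (rule insert_votes_append)
  also have "insert_votes v (?r @ ?r') (length ?r) = v @ Colon # y @ [Semicolon]"
    using insert_votes_weight[of "rev y" ?r' v Semicolon] snoc.prems peek_rev_semis[of ys] by simp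
  also have "insert_votes v ?r' (length (semis ys)) = semis (map (\<lambda>y. v @ Colon # y) ys)"
    using snoc by simp
  finally show ?case by (simp add: add.commute)
qed simp

section \<open>Injectivity of the encodings\<close>

lemma set_enc_weight: "set (enc_weight k) \<subseteq> {Zero, One}"
proof (induction k rule: less_induct)
  case (less k)
  then show ?case by (subst enc_weight.simps) auto
qed

lemma enc_weight_inject: "enc_weight k = enc_weight k' \<Longrightarrow> k = k'"
proof (induction k arbitrary: k' rule: less_induct)
  case (less k)
  have nil: "enc_weight n = [] \<longleftrightarrow> n = 0" for n
    by (subst enc_weight.simps) simp
  show ?case
  proof (cases "k = 0")
    case True
    then show ?thesis using less.prems nil by metis
  next
    case False
    then have "k' \<noteq> 0" using less.prems nil by metis
    with False have e: "(if odd k then One else Zero) # enc_weight (k div 2) =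
        (if odd k' then One else Zero) # enc_weight (k' div 2)"
      using less.prems enc_weight.simps[of k] enc_weight.simps[of k'] by metis
    then have "k div 2 = k' div 2" using less.IH[of "k div 2" "k' div 2"] False by simp
    moreover have "odd k = odd k'" using e by (auto split: if_splits)
    ultimately show ?thesis by (metis even_two_times_div_two odd_two_times_div_two_succ)
  qed
qed

lemma set_enc_cand: "set (enc_cand c) \<subseteq> {Tally}"
  by (auto simp: enc_cand_def)

lemma set_enc_vote: "set (enc_vote v) \<subseteq> {Tally, Comma}"
  using set_enc_cand by (induction v) fastforce+

lemma enc_cand_inject [simp]: "enc_cand c = enc_cand c' \<longleftrightarrow> c = c'"
  by (simp add: enc_cand_def)

lemma enc_vote_inject: "enc_vote v = enc_vote v' \<Longrightarrow> v = v'"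
proof (induction v arbitrary: v')
  case Nil
  then show ?case by (cases v') auto
next
  case (Cons c v)
  have "Comma \<notin> set (enc_cand c)" for c using set_enc_cand by fastforce
  with Cons show ?case by (cases v') (auto simp: append_separator_eq)
qed

definition enc_weighted :: "vote \<times> nat \<Rightarrow> symbol list" where
  "enc_weighted x = enc_vote (fst x) @ Colon # enc_weight (snd x)"

lemma enc_votes_semis: "enc_votes W = semis (map enc_weighted W)"
  by (induction W) (auto simp: enc_votes_def enc_weighted_def)

lemma enc_weights_semis: "enc_weights T = semis (map enc_weight T)"
  by (induction T) (auto simp: enc_weights_def)

lemma set_enc_weighted: "set (enc_weighted x) \<subseteq> {Zero, One, Tally, Comma, Colon}"
  using set_enc_vote[of "fst x"] set_enc_weight[of "snd x"] by (auto simp: enc_weighted_def)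

lemma enc_weighted_no_semicolon: "Semicolon \<notin> set (enc_weighted x)" "Semicolon \<notin> set (enc_weight k)"
  using set_enc_weighted[of x] set_enc_weight[of k] by auto

lemma Bar_notin_enc_votes: "Bar \<notin> set (enc_votes W)"
proof -
  have "Bar \<notin> set (enc_weighted x)" for x using set_enc_weighted[of x] by auto
  then show ?thesis unfolding enc_votes_semis by (induction W) simp_all
qed

lemma set_enc_weights: "\<forall>z \<in> set (enc_weights T). weight_symbol z"
proof -
  have "\<forall>z \<in> set (enc_weight k). weight_symbol z" for k
    using set_enc_weight[of k] by (auto simp: weight_symbol_def)
  then show ?thesis unfolding enc_weights_semis
    by (induction T) (simp_all add: ball_Un, simp add: weight_symbol_def)
qed

text \<open>The word \<open>y\<close> is arbitrary. If inserting a vote in front of it yields the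
  code of a weighted vote, then \<open>y\<close> must be the code of a weight; in this way a
  positive answer vouches for the weights in the input.\<close>

lemma enc_weighted_eq_iff:
  "enc_vote v @ Colon # y = enc_weighted x \<longleftrightarrow> v = fst x \<and> y = enc_weight (snd x)"
proof -
  have "Colon \<notin> set (enc_vote v)" for v using set_enc_vote[of v] by auto
  then show ?thesis using enc_vote_inject unfolding enc_weighted_def
    by (auto simp: append_separator_eq)
qed

lemma enc_votes_inject: "enc_votes W = enc_votes W' \<Longrightarrow> W = W'"
proof -
  assume "enc_votes W = enc_votes W'"
  then have "map enc_weighted W = map enc_weighted W'"
    unfolding enc_votes_semis using enc_weighted_no_semicolon by (intro semis_inject) auto
  moreover have "inj enc_weighted"
  proof (rule injI)
    fix x y
    assume "enc_weighted x = enc_weighted y"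
    then have "enc_vote (fst x) @ Colon # enc_weight (snd x) = enc_weighted y"
      by (simp add: enc_weighted_def)
    then show "x = y" unfolding enc_weighted_eq_iff using enc_weight_inject prod_eqI by blast
  qed
  ultimately show ?thesis by (simp add: inj_map_eq_map)
qed

text \<open>Bars cannot occur in candidates, so the first two bars determine the cut. The tail
  \<open>z\<close> is unrestricted, which makes the statement applicable to query words not yet
  known to encode elections.\<close>

lemma enc_election_eq_iff:
  "enc_election m c W = replicate m' Tally @ Bar # enc_cand c' @ Bar # z \<longleftrightarrow>
    m = m' \<and> c = c' \<and> enc_votes W = z"
proof -
  have "Bar \<notin> set (enc_cand c)" for c using set_enc_cand[of c] by auto
  then show ?thesis unfolding enc_election_def by (auto simp: append_separator_eq)
qed

lemma query_word_semis:
  assumes "\<forall>y \<in> set ys. Semicolon \<notin> set y"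
  shows "query_word (replicate m Tally) (enc_cand c) (semis xs) (rev (semis ys)) v =
    replicate m Tally @ Bar # enc_cand c @ Bar # semis (xs @ map (\<lambda>y. v @ Colon # y) ys)"
  using insert_votes_semis[OF assms, of v] by (simp add: query_word_def)

lemma query_word_election:
  "query_word (replicate m Tally) (enc_cand c) (enc_votes S) (rev (enc_weights T)) (enc_vote v) =
    enc_election m c (S @ map (Pair v) T)"
proof -
  have "map (\<lambda>y. enc_vote v @ Colon # y) (map enc_weight T) = map enc_weighted (map (Pair v) T)"
    by (simp add: enc_weighted_def)
  moreover have "\<forall>y \<in> set (map enc_weight T). Semicolon \<notin> set y"
    using enc_weighted_no_semicolon(2) by auto
  ultimately show ?thesis
    unfolding enc_votes_semis enc_weights_semis
    by (simp add: query_word_semis enc_election_def enc_votes_semis del: map_map)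
qed

lemma takeWhile_Tally_Bar:
  "takeWhile (\<lambda>z. z = Tally) (replicate n Tally @ Bar # w) = replicate n Tally"
  "dropWhile (\<lambda>z. z = Tally) (replicate n Tally @ Bar # w) = Bar # w"
  by (induction n) auto

lemma parts_eq:
  assumes w: "w = replicate m Tally @ Bar # replicate h Tally @ Bar # xs @ Bar # ys"
    and "Bar \<notin> set xs" "\<forall>z \<in> set ys. weight_symbol z"
  shows "tallies w = replicate m Tally" "num_cands w = m" "cand w = h" "votes_part w = xs"
    "weights_part w = ys" "rest1 w = Bar # replicate h Tally @ Bar # xs @ Bar # ys"
    "rest2 w = Bar # xs @ Bar # ys" "rest3 w = Bar # ys" "rest4 w = []"
proof -
  show 1: "tallies w = replicate m Tally" "rest1 w = Bar # replicate h Tally @ Bar # xs @ Bar # ys"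
    by (simp_all add: w tallies_def rest1_def takeWhile_Tally_Bar)
  then show "num_cands w = m" "cand w = h" and 2: "rest2 w = Bar # xs @ Bar # ys"
    by (simp_all add: num_cands_def cand_def cand_part_def rest2_def takeWhile_Tally_Bar)
  have "takeWhile (\<lambda>z. z \<noteq> Bar) (xs @ Bar # ys) = xs" "dropWhile (\<lambda>z. z \<noteq> Bar) (xs @ Bar # ys) = Bar # ys"
    using assms(2) by (induction xs) auto
  then show "votes_part w = xs" and 3: "rest3 w = Bar # ys"
    by (simp_all add: votes_part_def rest3_def 2)
  show "weights_part w = ys" "rest4 w = []"
    using assms(3) by (simp_all add: weights_part_def rest4_def 3)
qed

lemma (in query_decider) well_formedE:
  assumes "well_formed w"
  obtains m h xs ys where
    "w = replicate m Tally @ Bar # replicate h Tally @ Bar # semis xs @ Bar # semis ys"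
    "h < m" "Bar \<notin> set (semis xs)" "\<forall>z \<in> set (semis ys). weight_symbol z"
    "\<forall>x \<in> set xs. Semicolon \<notin> set x" "\<forall>y \<in> set ys. Semicolon \<notin> set y"
proof -
  have peekD: "xs = z # tl xs" if "peek xs = Some z" for xs and z :: symbol
    using that by (cases xs) auto
  have c: "peek (rest1 w) = Some Bar" "peek (rest2 w) = Some Bar" "peek (rest3 w) = Some Bar"
    "rest4 w = []" "peek (rev (votes_part w)) \<in> {None, Some Semicolon}"
    "peek (rev (weights_part w)) \<in> {None, Some Semicolon}" "cand w < num_cands w"
    using assms by (auto simp: well_formed_def checks_def)
  have "w = tallies w @ rest1 w" by (simp add: tallies_def rest1_def)
  also have "rest1 w = Bar # cand_part w @ rest2 w"
    using peekD[OF c(1)] by (simp add: cand_part_def rest2_def)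
  also have "rest2 w = Bar # votes_part w @ rest3 w"
    using peekD[OF c(2)] by (simp add: votes_part_def rest3_def)
  also have "weights_part w = tl (rest3 w)"
    using takeWhile_dropWhile_id[of weight_symbol "tl (rest3 w)"] c(4)
    by (simp add: weights_part_def rest4_def del: dropWhile_eq_Nil_conv takeWhile_dropWhile_id)
  then have "rest3 w = Bar # weights_part w" using peekD[OF c(3)] by simp
  finally have w: "w = replicate (num_cands w) Tally @ Bar # replicate (cand w) Tally @ Bar #
      votes_part w @ Bar # weights_part w"
    by (simp add: tallies_eq[symmetric] cand_part_eq enc_cand_def)
  obtain xs where xs: "votes_part w = semis xs" "\<forall>x \<in> set xs. Semicolon \<notin> set x"
    using ex_semis[OF c(5)] by blast
  obtain ys where ys: "weights_part w = semis ys" "\<forall>y \<in> set ys. Semicolon \<notin> set y"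
    using ex_semis[OF c(6)] by blast
  have "Bar \<notin> set (votes_part w)" "\<forall>z \<in> set (weights_part w). weight_symbol z"
    by (auto simp: votes_part_def weights_part_def dest: set_takeWhileD)
  then show ?thesis using that w c(7) xs ys by metis
qed


section \<open>Monotone scores\<close>

definition improves :: "nat \<Rightarrow> vote \<Rightarrow> vote \<Rightarrow> bool" where
  "improves a u v \<longleftrightarrow> {b. prefers u a b} \<subseteq> {b. prefers v a b}"

text \<open>Monotonicity is stated for one voter at a time. The voters are changed from left to
  right, and the prefix \<open>Q\<close>, general in the induction, collects those already
  changed.\<close>

lemma monotone_profile:
  assumes mono: "monotone_score score" and "a < m" and "list_all2 (improves a) P P'"
    and "\<forall>v \<in> set Q \<union> set P \<union> set P'. is_vote m v"
  shows "score m (Q @ P) a \<le> score m (Q @ P') a"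
  using assms(3,4)
proof (induction arbitrary: Q rule: list_all2_induct)
  case (Cons u P v P')
  have "score m (Q @ u # P) a \<le> score m ((Q @ u # P)[length Q := v]) a"
  proof (rule mono[unfolded monotone_score_def, rule_format], intro conjI)
    show "\<forall>w \<in> set (Q @ u # P). is_vote m w" "is_vote m v" using Cons.prems by simp_all
    show "{b. prefers ((Q @ u # P) ! length Q) a b} \<subseteq> {b. prefers v a b}"
      using Cons.hyps(1) by (simp add: improves_def)
  qed (simp_all add: \<open>a < m\<close>)
  also have "(Q @ u # P)[length Q := v] = (Q @ [v]) @ P" by simp
  also have "score m ((Q @ [v]) @ P) a \<le> score m ((Q @ [v]) @ P') a"
    by (rule Cons.IH) (use Cons.prems in simp)
  finally show ?case by simp
qed simp

lemma unweighted_append: "unweighted (V @ W) = unweighted V @ unweighted W"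
  by (simp add: unweighted_def)

lemma unweighted_Cons: "unweighted ((v, k) # W) = replicate k v @ unweighted W"
  by (simp add: unweighted_def)

lemma set_unweighted: "set (unweighted W) \<subseteq> fst ` set W"
proof (induction W)
  case (Cons x W)
  have "set (unweighted (x # W)) \<subseteq> insert (fst x) (set (unweighted W))"
    by (cases x) (auto simp: unweighted_Cons)
  then show ?case using Cons by auto
qed (simp add: unweighted_def)

lemma set_unweighted_zip: "set (unweighted (zip V T)) \<subseteq> set V"
proof -
  have "fst ` set (zip V T) \<subseteq> set V" by (auto dest: set_zip_leftD)
  then show ?thesis using set_unweighted by blast
qed

text \<open>Both coalitions carry the same weights, so their unweighted profiles correspond voter by
  voter: a vote of weight \<open>k\<close> contributes \<open>k\<close> equal changes.\<close>

lemma monotone_coalition: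
  assumes "monotone_score score" "a < m" "list_all2 (improves a) V V'" "length V = length T"
    and "\<forall>(v, k) \<in> set S. is_vote m v" "\<forall>v \<in> set V. is_vote m v" "\<forall>v \<in> set V'. is_vote m v"
  shows "score m (unweighted (S @ zip V T)) a \<le> score m (unweighted (S @ zip V' T)) a"
  unfolding unweighted_append
proof (rule monotone_profile[OF assms(1,2)])
  show "list_all2 (improves a) (unweighted (zip V T)) (unweighted (zip V' T))"
    using assms(3,4)
  proof (induction arbitrary: T rule: list_all2_induct)
    case (Cons u V v V')
    then obtain k T' where T: "T = k # T'" by (cases T) auto
    have "list_all2 (improves a) (replicate k u) (replicate k v)"
      using Cons.hyps by (simp add: list_all2_conv_all_nth)
    then show ?case
      using Cons.IH[of T'] Cons.prems by (simp add: T unweighted_Cons list_all2_appendI)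
  qed (simp add: unweighted_def)
  show "\<forall>v \<in> set (unweighted S) \<union> set (unweighted (zip V T)) \<union> set (unweighted (zip V' T)).
      is_vote m v"
  proof
    fix v
    assume "v \<in> set (unweighted S) \<union> set (unweighted (zip V T)) \<union> set (unweighted (zip V' T))"
    then have "v \<in> fst ` set S \<or> v \<in> set V \<or> v \<in> set V'"
      using set_unweighted[of S] set_unweighted_zip[of V T] set_unweighted_zip[of V' T] by blast
    then show "is_vote m v" using assms(5-7) by auto
  qed
qed

section \<open>Extreme votes for a rival and for \<open>h\<close>\<close>

lemma improves_to_first:
  assumes "is_vote m u" "is_vote m (a # v)"
  shows "improves a u (a # v)"
  unfolding improves_def
proof clarify
  fix b
  assume "prefers u a b"
  then obtain i j where ij: "i < j" "j < length u" "u ! i = a" "u ! j = b"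
    by (auto simp: prefers_def)
  have "distinct u" using assms(1) by (simp add: is_vote_def)
  then have "b \<noteq> a" using nth_eq_iff_index_eq[of u i j] ij by auto
  moreover have "set u = set (a # v)" using assms unfolding is_vote_def by metis
  then have "b \<in> set (a # v)" using ij nth_mem[of j u] by metis
  ultimately have "b \<in> set v" by simp
  then obtain k where "k < length v" "v ! k = b" unfolding in_set_conv_nth by blast
  then show "prefers (a # v) a b"
    unfolding prefers_def by (intro exI[of _ 0] exI[of _ "Suc k"]) auto
qed

text \<open>Nothing lies below the last candidate, so the set to be included is empty and every
  \<open>u\<close> is an improvement for it.\<close>

lemma improves_from_last:
  assumes "distinct (v @ [h])"
  shows "improves h (v @ [h]) u"
  unfolding improves_def
proof clarify
  fix b
  assume "prefers (v @ [h]) h b"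
  then obtain i j where ij: "i < j" "j < length (v @ [h])" "(v @ [h]) ! i = h"
    by (auto simp: prefers_def)
  have "(v @ [h]) ! length v = h" by simp
  then have "i = length v" using ij assms nth_eq_iff_index_eq[of "v @ [h]" i "length v"] by auto
  then show "prefers u h b" using ij by simp
qed

lemma others_props:
  assumes "h < m"
  shows "distinct (others m h)" "set (others m h) = {..<m} - {h}"
  using assms by (auto simp: others_def)

lemma trial_vote_is_vote:
  assumes "h < m" "i < length (others m h)"
  shows "is_vote m (trial_vote (others m h) h i)"
proof -
  let ?us = "others m h"
  have "?us = take i ?us @ ?us ! i # drop (Suc i) ?us" using assms(2) by (rule id_take_nth_drop)
  then have d: "distinct (take i ?us @ ?us ! i # drop (Suc i) ?us)"
    and s: "set (take i ?us @ ?us ! i # drop (Suc i) ?us) = {..<m} - {h}"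
    using others_props[OF assms(1)] by simp_all
  have "set (trial_vote ?us h i) = insert h (set (take i ?us @ ?us ! i # drop (Suc i) ?us))"
    by (auto simp: trial_vote_def)
  also have "\<dots> = {..<m}" unfolding s using assms(1) by blast
  finally have set: "set (trial_vote ?us h i) = {..<m}" .
  have "h \<notin> set (take i ?us @ ?us ! i # drop (Suc i) ?us)" unfolding s by simp
  then have "distinct (trial_vote ?us h i)"
    using d by (simp add: trial_vote_def Int_commute)
  then show ?thesis using set by (simp add: is_vote_def)
qed


lemma zip_replicate_Pair: "zip (replicate (length T) v) T = map (Pair v) T"
  by (induction T) auto

text \<open>
  Among the trial votes, take one whose top candidate \<open>a\<close> has the largest score when its own trial
  vote is cast. No other candidate beats \<open>a\<close> there, since it would have at least that score under
  its own trial vote.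
\<close>

lemma dominating_trial_vote:
  assumes mono: "monotone_score score" and h: "h < m"
    and S: "\<forall>(v, k) \<in> set S. is_vote m v" and V: "length V = length T" "\<forall>v \<in> set V. is_vote m v"
    and lose: "\<not> wins score m (unweighted (S @ zip V T)) h"
  shows "\<exists>i < length (others m h).
    wins score m (unweighted (S @ map (Pair (trial_vote (others m h) h i)) T)) (others m h ! i) \<and>
    \<not> wins score m (unweighted (S @ map (Pair (trial_vote (others m h) h i)) T)) h"
proof -
  let ?us = "others m h"
  let ?v = "\<lambda>i. trial_vote ?us h i"
  let ?P = "\<lambda>i. unweighted (S @ map (Pair (?v i)) T)"
  let ?sc = "\<lambda>i. score m (?P i) (?us ! i)"
  note us = others_props[OF h]
  note vote = trial_vote_is_vote[OF h]
  \<comment> \<open>The votes \<open>U\<close> are general because the bound is applied twice: to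
    the given votes \<open>V\<close>, and to the trial votes of a different rival.\<close>
  have to_first: "score m (unweighted (S @ zip U T)) (?us ! i) \<le> ?sc i"
    if i: "i < length ?us" and U: "length U = length T" "\<forall>v \<in> set U. is_vote m v" for U i
  proof -
    have "improves (?us ! i) u (?v i)" if "u \<in> set U" for u
      using improves_to_first[of m u "?us ! i"] vote[OF i] U that by (simp add: trial_vote_def)
    then have "list_all2 (improves (?us ! i)) U (replicate (length T) (?v i))"
      using U by (simp add: list_all2_conv_all_nth)
    moreover have "?us ! i < m" using i us nth_mem by blast
    ultimately show ?thesis
      using monotone_coalition[OF mono, of "?us ! i" m U "replicate (length T) (?v i)" T S] S U vote[OF i]
      by (simp add: zip_replicate_Pair)
  qed
  have from_last: "score m (?P i) h \<le> score m (unweighted (S @ zip V T)) h"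
    if i: "i < length ?us" for i
  proof -
    have "distinct ((?us ! i # rev (take i ?us) @ drop (Suc i) ?us) @ [h])"
      using vote[OF i] by (simp add: is_vote_def trial_vote_def)
    from improves_from_last[OF this] have "list_all2 (improves h) (replicate (length T) (?v i)) V"
      using V by (auto simp: list_all2_conv_all_nth trial_vote_def)
    then show ?thesis
      using monotone_coalition[OF mono h, of "replicate (length T) (?v i)" V T S] S V vote[OF i]
      by (simp add: zip_replicate_Pair)
  qed
  obtain b where b: "b < m" "b \<noteq> h"
    "score m (unweighted (S @ zip V T)) b > score m (unweighted (S @ zip V T)) h"
    using lose by (auto simp: wins_def)
  then have "b \<in> set ?us" using us by auto
  then obtain ib where ib: "ib < length ?us" "?us ! ib = b" by (auto simp: in_set_conv_nth)
  define top where "top = Max (?sc ` {..<length ?us})"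
  have fin: "finite (?sc ` {..<length ?us})" "?sc ` {..<length ?us} \<noteq> {}" using ib by auto
  have le_top: "?sc i \<le> top" if "i < length ?us" for i
    unfolding top_def using fin that by (intro Max_ge) auto
  obtain i where i: "i < length ?us" "?sc i = top"
    using Max_in[OF fin] by (auto simp: top_def)
  \<comment> \<open>The chain is: \<open>h\<close> under trial \<open>i\<close>, at most
    \<open>h\<close> under \<open>V\<close>, less than \<open>b\<close> under \<open>V\<close>, at
    most \<open>b\<close> under its own trial vote, at most \<open>top\<close>.\<close>
  have lt: "score m (?P i) h < ?sc i"
    using from_last[OF i(1)] b(3) to_first[OF ib(1) V, unfolded ib(2)]
      le_top[OF ib(1), unfolded ib(2)] i(2) by linarith
  have a: "?us ! i < m" "?us ! i \<noteq> h" using nth_mem[OF i(1)] us by auto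
  have le: "score m (?P i) c \<le> ?sc i" if c: "c < m" for c
  proof (cases "c = h")
    case True
    then show ?thesis using lt by simp
  next
    case False
    then have "c \<in> set ?us" using c us by auto
    then obtain j where j: "j < length ?us" "?us ! j = c" by (auto simp: in_set_conv_nth)
    have "score m (?P i) c \<le> ?sc j"
      using to_first[OF j(1), of "replicate (length T) (?v i)"] vote[OF i(1)] j(2)
      by (simp add: zip_replicate_Pair)
    then show ?thesis using le_top[OF j(1)] i(2) by linarith
  qed
  have "wins score m (?P i) (?us ! i)"
    unfolding wins_def using le leD by blast
  moreover have "\<not> wins score m (?P i) h"
    unfolding wins_def using a lt by blast
  ultimately show ?thesis using i(1) by blast
qed

section \<open>Correctness of the decision procedure\<close>

locale monotone_winner = query_decider M "WINNER score" p
  for M :: "symbol tm" and score :: scoring and p +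
  assumes mono: "monotone_score score"
begin

lemma in_DCWM_if_hits:
  assumes "well_formed w" and i: "hits w i"
  shows "w \<in> DCWM score"
proof -
  obtain m h xs ys where
    w: "w = replicate m Tally @ Bar # replicate h Tally @ Bar # semis xs @ Bar # semis ys"
    and h: "h < m" and sym: "Bar \<notin> set (semis xs)" "\<forall>z \<in> set (semis ys). weight_symbol z"
    and semi: "\<forall>x \<in> set xs. Semicolon \<notin> set x" "\<forall>y \<in> set ys. Semicolon \<notin> set y"
    by (rule well_formedE[OF assms(1)])
  note parts = parts_eq[OF w sym]
  define v where "v = trial_vote (others m h) h i"
  define a where "a = others m h ! i"
  define q where "q c = query_word (replicate m Tally) (enc_cand c) (semis xs) (rev (semis ys)) (enc_vote v)" for c
  have "q a \<in> WINNER score" "q h \<notin> WINNER score"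
    using i unfolding hits_def hit_def parts q_def v_def a_def by auto
  then obtain m' c' W where W: "q a = enc_election m' c' W" "\<forall>(v, k) \<in> set W. is_vote m' v"
    by (auto simp: WINNER_def)
  \<comment> \<open>So far \<open>xs\<close> and \<open>ys\<close> are arbitrary fragments of the
    input. The positive answer for \<open>a\<close> identifies their combination with the votes of a
    genuine election \<open>W\<close>.\<close>
  have "m' = m \<and> c' = a \<and> enc_votes W = semis (xs @ map (\<lambda>y. enc_vote v @ Colon # y) ys)"
    using W(1)[symmetric] unfolding q_def query_word_semis[OF semi(2)] enc_election_eq_iff .
  then have m': "m' = m" and eq: "semis (xs @ map (\<lambda>y. enc_vote v @ Colon # y) ys) = semis (map enc_weighted W)"
    by (auto simp: enc_votes_semis)
  have "Semicolon \<notin> set (enc_vote v)" using set_enc_vote[of v] by auto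
  then have 1: "\<forall>x \<in> set (xs @ map (\<lambda>y. enc_vote v @ Colon # y) ys). Semicolon \<notin> set x"
    using semi unfolding set_append ball_Un set_map ball_simps by simp
  have 2: "\<forall>x \<in> set (map enc_weighted W). Semicolon \<notin> set x"
    using enc_weighted_no_semicolon by simp
  \<comment> \<open>\<open>W\<close> is cut where the blocks of \<open>xs\<close> end: the entries
    before that point are the given votes, those behind it come from the open weights with the
    inserted vote.\<close>
  from semis_inject[OF 1 2 eq] obtain S W2 where S: "W = S @ W2" "xs = map enc_weighted S"
    "map (\<lambda>y. enc_vote v @ Colon # y) ys = map enc_weighted W2"
    using map_eq_append_conv[of enc_weighted W] by metis
  define T where "T = map snd W2"
  have len: "length ys = length W2" using S(3) by (metis length_map)
  have nth: "W2 ! j = (v, T ! j) \<and> ys ! j = enc_weight (T ! j)" if "j < length W2" for j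
  proof -
    have "enc_vote v @ Colon # ys ! j = enc_weighted (W2 ! j)"
      using arg_cong[OF S(3), of "\<lambda>l. l ! j"] that len by simp
    then show ?thesis unfolding enc_weighted_eq_iff using that by (simp add: T_def prod_eq_iff)
  qed
  have W2: "W2 = map (Pair v) T" and ys: "ys = map enc_weight T"
    using nth len by (auto simp: T_def intro!: nth_equalityI)
  have xs: "semis xs = enc_votes S" and ys': "semis ys = enc_weights T"
    by (simp_all add: S(2) ys enc_votes_semis enc_weights_semis)
  \<comment> \<open>Only now is the word asked for \<open>h\<close> known to encode a proper
    election, so that its rejection means that \<open>h\<close> does not win.\<close>
  have "q h = enc_election m h (S @ map (Pair v) T)"
    unfolding q_def xs ys' by (rule query_word_election)
  moreover have valid: "\<forall>(v, k) \<in> set (S @ map (Pair v) T). is_vote m v"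
    using W(2) unfolding m' S(1) W2 .
  ultimately have "\<not> wins score m (unweighted (S @ map (Pair v) T)) h"
    using \<open>q h \<notin> WINNER score\<close> h unfolding WINNER_def by blast
  \<comment> \<open>If \<open>T\<close> is empty, the election contains no copy of \<open>v\<close>
    that would show it to be a vote, but then the coalition is empty as well; hence the case
    distinction on \<open>T\<close>.\<close>
  then have "length (replicate (length T) v) = length T \<and>
      (\<forall>v \<in> set (replicate (length T) v). is_vote m v) \<and>
      \<not> wins score m (unweighted (S @ zip (replicate (length T) v) T)) h"
    using valid unfolding zip_replicate_Pair by (cases T) simp_all
  moreover have "w = enc_dcwm m h S T"
    by (simp add: w enc_dcwm_def enc_election_def enc_cand_def xs ys')
  moreover have "\<forall>(v, k) \<in> set S. is_vote m v" using valid by simp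
  ultimately show ?thesis using h unfolding DCWM_def by blast
qed

lemma hits_if_in_DCWM:
  assumes "w \<in> DCWM score"
  shows "well_formed w \<and> (\<exists>i < length (others (num_cands w) (cand w)). hits w i)"
proof -
  obtain m h S T V where w: "w = enc_dcwm m h S T" and h: "h < m"
    and S: "\<forall>(v, k) \<in> set S. is_vote m v" and V: "length V = length T" "\<forall>v \<in> set V. is_vote m v"
    and lose: "\<not> wins score m (unweighted (S @ zip V T)) h"
    using assms unfolding DCWM_def by blast
  have w': "w = replicate m Tally @ Bar # replicate h Tally @ Bar # enc_votes S @ Bar # enc_weights T"
    by (simp add: w enc_dcwm_def enc_election_def enc_cand_def)
  have sym: "Bar \<notin> set (enc_votes S)" "\<forall>z \<in> set (enc_weights T). weight_symbol z"
    by (rule Bar_notin_enc_votes, rule set_enc_weights)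
  note parts = parts_eq[OF w' sym]
  have "well_formed w"
    using h peek_rev_semis unfolding well_formed_def checks_def parts enc_votes_semis enc_weights_semis
    by simp
  moreover obtain i where i: "i < length (others m h)"
    "wins score m (unweighted (S @ map (Pair (trial_vote (others m h) h i)) T)) (others m h ! i)"
    "\<not> wins score m (unweighted (S @ map (Pair (trial_vote (others m h) h i)) T)) h"
    using dominating_trial_vote[OF mono h S V lose] by blast
  have "hits w i"
    unfolding hits_def hit_def parts query_word_election
  proof
    let ?W = "S @ map (Pair (trial_vote (others m h) h i)) T"
    have "others m h ! i < m" using nth_mem[OF i(1)] others_props[OF h] by auto
    moreover have "\<forall>(v, k) \<in> set ?W. is_vote m v" using S trial_vote_is_vote[OF h i(1)] by auto
    ultimately show "enc_election m (others m h ! i) ?W \<in> WINNER score"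
      using i(2) unfolding WINNER_def by blast
    \<comment> \<open>\<open>WINNER score\<close> admits any election with the given code, so
      rejection requires that the code determine the election.\<close>
    show "enc_election m h ?W \<notin> WINNER score"
    proof
      assume "enc_election m h ?W \<in> WINNER score"
      then obtain m' c' W' where W': "enc_election m' c' W' = enc_election m h ?W"
        "wins score m' (unweighted W') c'"
        by (auto simp: WINNER_def)
      then have "m' = m \<and> c' = h \<and> enc_votes W' = enc_votes ?W"
        using enc_election_eq_iff[of m' c' W' m h "enc_votes ?W"] by (simp add: enc_election_def)
      then show False using W'(2) i(3) enc_votes_inject by blast
    qed
  qed
  ultimately show ?thesis using i(1) parts by auto
qed

lemma DCWM_in_class_P: "DCWM score \<in> class_P"
proof -
  have "DCWM score = {w. well_formed w \<and> (\<exists>i < length (others (num_cands w) (cand w)). hits w i)}"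
    using in_DCWM_if_hits hits_if_in_DCWM by blast
  then show ?thesis using hits_in_class_P by simp
qed

end

theorem theorem5:
  fixes score :: scoring
  assumes "monotone_score score"
    and "WINNER score \<in> class_P"
  shows "DCWM score \<in> class_P"
proof -
  obtain M :: "symbol tm" and p :: "nat poly"
    where "wf_tm M" "decides_in M (WINNER score) (poly p)"
    using assms(2) unfolding class_P_def by blast
  then interpret monotone_winner M score p
    using assms(1) by unfold_locales
  show ?thesis by (rule DCWM_in_class_P)
qed

end
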